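(* The circle subgroup $\mathsf S^1<\mathsf T^4<\mathsf{Spin}(8)<\mathsf{SO}(8)\times\mathsf{SO}(8)$ determined by $(n_1,n_2,n_3,n_4)\in\mathbb Z^4$ with $\gcd(n_1,n_2,n_3,n_4)=1$ acts freely on $\mathbb S^7\times\mathbb S^7$ if and only if $\gcd(\ell_i,r_j)=1$ for all $i,j\in\{1,2,3,4\}$. There are infinitely many such free actions up to equivalence of actions. Up to equivalence of actions, there is a unique free action by some circle subgroup $\mathsf S^1<\mathsf T^3<\mathsf{Spin}(7)$ on $\mathbb S^6\times\mathbb S^7$, and the projection of this action to the $\mathbb S^7$-factor is equivalent to the Hopf action.
   Context: Octonions: $\mathbb O=\mathbb H\oplus\mathbb H\cong\mathbb R^8$ with product $(a_1,a_2)(b_1,b_2)=(a_1b_1-\overline{b_2}a_2,\ b_2a_1+a_2\overline{b_1})$ and ordered orthonormal basis $1,i,j,k,\ell,i\ell,j\ell,k\ell$, where $\ell=(0,1)$. Triality equation: $A(x)B(y)=C(xy)$ for all $x,y\in\mathbb O$. $\mathsf{Spin}(8)$ denotes the group of all $(A,B)\in\mathsf{SO}(8)\times\mathsf{SO}(8)$ for which there is $C\in\mathsf{SO}(8)$ satisfying the triality equation; $\mathsf{Spin}(7)$ denotes its subgroup where $B=C$. $\mathsf{Spin}(8)$ acts on $\mathbb S^7\times\mathbb S^7\subset\mathbb O\oplus\mathbb O$ by $(A,B)\ast(x,y)=(Ax,By)$; $\mathsf{Spin}(7)$ acts by restriction on $\mathbb S^6\times\mathbb S^7=\{(x,y)\in\mathbb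 S^7\times\mathbb S^7:\mathrm{Re}(x)=0\}$. Maximal tori: let $R(\theta)=\begin{pmatrix}\cos\theta&-\sin\theta\\ \sin\theta&\cos\theta\end{pmatrix}$. $\mathsf T^4<\mathsf{Spin}(8)$ is the maximal torus of pairs $(A,B)$ with $A=\mathrm{diag}(R(\alpha_1),R(\alpha_1+\alpha_3+\alpha_4),R(\alpha_2+\alpha_3-\alpha_4),R(\alpha_2))$, $B=\mathrm{diag}(R(\alpha_3),R(\alpha_4),R(-\alpha_1+\alpha_2-\alpha_4),R(\alpha_1+\alpha_2+\alpha_3))$, $\alpha_r\in[0,2\pi)$. $\mathsf T^3<\mathsf{Spin}(7)$ is the maximal torus given by $\alpha_1=0$. The circle determined by integers $(n_1,n_2,n_3,n_4)$ with $\gcd=1$ is $\{\alpha_i=n_i\theta\}$, $\theta\in[0,2\pi)$. Set $\ell_1=n_1$, $\ell_2=n_1+n_3+n_4$, $\ell_3=n_2+n_3-n_4$, $\ell_4=n_2$, $r_1=n_3$, $r_2=n_4$, $r_3=-n_1+n_2-n_4$, $r_4=n_1+n_2+n_3$. Conventions: $\gcd(0,x)=|x|$ for $x\neq0$; $\gcd(0,0)$ is undefined and in particular is not $1$. Two actions of $L$ on $M$ and $L'$ on $M'$ are equivalent if there are an isomorphism $\phi:L\to L'$ and a diffeomorphism $F:M\to M'$ with $F(g\ast m)=\phi(g)\ast F(m)$. The Hopf action is the scalar multiplication action of the unit circle on $\mathbb S^7\subset\mathbb C^4$. *)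

theory Defs
  imports "HOL-Analysis.Analysis" "HOL-Algebra.Group"
begin

section \<open>Octonions\<close>

text \<open>Quaternions are coordinate vectors with respect to \<open>1, i, j, k\<close>, and octonions are coordinate
  vectors with respect to \<open>1, i, j, k, l, il, jl, kl\<close> where \<open>l = (0,1)\<close>.  With the product below,
  \<open>(a,0) (0,1) = (0,a)\<close>, so the last four coordinates of \<open>(a\<^sub>1,a\<^sub>2)\<close> are just those of \<open>a\<^sub>2\<close>.\<close>

definition quat_mult :: "real^4 \<Rightarrow> real^4 \<Rightarrow> real^4" where
  "quat_mult a b = vector
    [a$1 * b$1 - a$2 * b$2 - a$3 * b$3 - a$4 * b$4,
     a$1 * b$2 + a$2 * b$1 + a$3 * b$4 - a$4 * b$3,
     a$1 * b$3 - a$2 * b$4 + a$3 * b$1 + a$4 * b$2,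
     a$1 * b$4 + a$2 * b$3 - a$3 * b$2 + a$4 * b$1]"

definition quat_cnj :: "real^4 \<Rightarrow> real^4" where
  "quat_cnj a = vector [a$1, - a$2, - a$3, - a$4]"

type_synonym octonion = "real^8"

definition oct_of :: "real^4 \<Rightarrow> real^4 \<Rightarrow> octonion" where
  "oct_of a b = vector [a$1, a$2, a$3, a$4, b$1, b$2, b$3, b$4]"

definition oct_fst :: "octonion \<Rightarrow> real^4" where
  "oct_fst x = vector [x$1, x$2, x$3, x$4]"

definition oct_snd :: "octonion \<Rightarrow> real^4" where
  "oct_snd x = vector [x$5, x$6, x$7, x$8]"

definition oct_mult :: "octonion \<Rightarrow> octonion \<Rightarrow> octonion" where
  "oct_mult a b = oct_of
     (quat_mult (oct_fst a) (oct_fst b) - quat_mult (quat_cnj (oct_snd b)) (oct_snd a))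
     (quat_mult (oct_snd b) (oct_fst a) + quat_mult (oct_snd a) (quat_cnj (oct_fst b)))"

definition oct_Re :: "octonion \<Rightarrow> real" where
  "oct_Re x = x$1"


section \<open>Spin(8), Spin(7) and their actions\<close>

definition SO8 :: "(real^8^8) monoid" where
  "SO8 = \<lparr>carrier = {A. rotation_matrix A}, mult = (**), one = mat 1\<rparr>"

definition triality :: "real^8^8 \<Rightarrow> real^8^8 \<Rightarrow> real^8^8 \<Rightarrow> bool" where
  "triality A B C \<longleftrightarrow> (\<forall>x y. oct_mult (A *v x) (B *v y) = C *v oct_mult x y)"

definition Spin8 :: "((real^8^8) \<times> (real^8^8)) monoid" where
  "Spin8 = (SO8 \<times>\<times> SO8)\<lparr>carrier :=
     {(A, B). A \<in> carrier SO8 \<and> B \<in> carrier SO8 \<and> (\<exists>C \<in> carrier SO8. triality A B C)}\<rparr>"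

definition Spin7 :: "((real^8^8) \<times> (real^8^8)) monoid" where
  "Spin7 = Spin8\<lparr>carrier := {(A, B) \<in> carrier Spin8. triality A B B}\<rparr>"

definition spin_act :: "(real^8^8) \<times> (real^8^8) \<Rightarrow> octonion \<times> octonion \<Rightarrow> octonion \<times> octonion" where
  "spin_act g m = (fst g *v fst m, snd g *v snd m)"

text \<open>The action induced on the second factor by the equivariant projection \<open>snd\<close>.\<close>

definition spin_act_snd :: "(real^8^8) \<times> (real^8^8) \<Rightarrow> octonion \<Rightarrow> octonion" where
  "spin_act_snd g y = snd g *v y"

definition S7 :: "octonion set" where
  "S7 = sphere 0 1"

definition S7xS7 :: "(octonion \<times> octonion) set" where
  "S7xS7 = S7 \<times> S7"

definition S6xS7 :: "(octonion \<times> octonion) set" where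
  "S6xS7 = {(x, y) \<in> S7xS7. oct_Re x = 0}"


section \<open>Tori and circles\<close>

text \<open>\<open>diag(R(a), R(b), R(c), R(d))\<close>\<close>

definition rot_diag :: "real \<Rightarrow> real \<Rightarrow> real \<Rightarrow> real \<Rightarrow> real^8^8" where
  "rot_diag a b c d = vector
    [vector [cos a, - sin a, 0, 0, 0, 0, 0, 0],
     vector [sin a,   cos a, 0, 0, 0, 0, 0, 0],
     vector [0, 0, cos b, - sin b, 0, 0, 0, 0],
     vector [0, 0, sin b,   cos b, 0, 0, 0, 0],
     vector [0, 0, 0, 0, cos c, - sin c, 0, 0],
     vector [0, 0, 0, 0, sin c,   cos c, 0, 0],
     vector [0, 0, 0, 0, 0, 0, cos d, - sin d],
     vector [0, 0, 0, 0, 0, 0, sin d,   cos d]]"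

definition torus_elt :: "real \<Rightarrow> real \<Rightarrow> real \<Rightarrow> real \<Rightarrow> (real^8^8) \<times> (real^8^8)" where
  "torus_elt a1 a2 a3 a4 =
     (rot_diag a1 (a1 + a3 + a4) (a2 + a3 - a4) a2,
      rot_diag a3 a4 (- a1 + a2 - a4) (a1 + a2 + a3))"

definition T4 :: "((real^8^8) \<times> (real^8^8)) set" where
  "T4 = {torus_elt a1 a2 a3 a4 | a1 a2 a3 a4.
     a1 \<in> {0..<2*pi} \<and> a2 \<in> {0..<2*pi} \<and> a3 \<in> {0..<2*pi} \<and> a4 \<in> {0..<2*pi}}"

definition T3 :: "((real^8^8) \<times> (real^8^8)) set" where
  "T3 = {torus_elt 0 a2 a3 a4 | a2 a3 a4.
     a2 \<in> {0..<2*pi} \<and> a3 \<in> {0..<2*pi} \<and> a4 \<in> {0..<2*pi}}"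

definition circle_of :: "int^4 \<Rightarrow> ((real^8^8) \<times> (real^8^8)) set" where
  "circle_of n = (\<lambda>\<theta>. torus_elt (of_int (n$1) * \<theta>) (of_int (n$2) * \<theta>)
                            (of_int (n$3) * \<theta>) (of_int (n$4) * \<theta>)) ` {0..<2*pi}"

definition left_weights :: "int^4 \<Rightarrow> int^4" where
  "left_weights n = vector [n$1, n$1 + n$3 + n$4, n$2 + n$3 - n$4, n$2]"

definition right_weights :: "int^4 \<Rightarrow> int^4" where
  "right_weights n = vector [n$3, n$4, - n$1 + n$2 - n$4, n$1 + n$2 + n$3]"


section \<open>Smooth maps, Lie group isomorphisms and equivalence of actions\<close>

text \<open>\<open>k\<close> times continuously differentiable on an open subset of a finite-dimensional space: all
  directional derivatives are required to be \<open>k - 1\<close> times continuously differentiable.\<close>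

primrec Ck_on :: "nat \<Rightarrow> ('a::euclidean_space \<Rightarrow> 'b::euclidean_space) \<Rightarrow> 'a set \<Rightarrow> bool" where
  "Ck_on 0 f U \<longleftrightarrow> continuous_on U f"
| "Ck_on (Suc k) f U \<longleftrightarrow> (\<forall>x\<in>U. f differentiable (at x)) \<and>
     (\<forall>v. Ck_on k (\<lambda>x. frechet_derivative f (at x) v) U)"

text \<open>Smoothness of a map defined on an arbitrary subset (here always an embedded submanifold) of a
  Euclidean space: locally it extends to a smooth map on an open subset of the ambient space.\<close>

definition smooth_map_on :: "'a::euclidean_space set \<Rightarrow> ('a \<Rightarrow> 'b::euclidean_space) \<Rightarrow> bool" where
  "smooth_map_on M f \<longleftrightarrow>
     (\<forall>x\<in>M. \<exists>U h. open U \<and> x \<in> U \<and> (\<forall>k. Ck_on k h U) \<and> (\<forall>y\<in>M \<inter> U. f y = h y))"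

definition diffeomorphism_on ::
  "'a::euclidean_space set \<Rightarrow> 'b::euclidean_space set \<Rightarrow> ('a \<Rightarrow> 'b) \<Rightarrow> bool" where
  "diffeomorphism_on M N f \<longleftrightarrow>
     bij_betw f M N \<and> smooth_map_on M f \<and> smooth_map_on N (inv_into M f)"

definition lie_iso ::
  "('a::euclidean_space, 'c) monoid_scheme \<Rightarrow> ('b::euclidean_space, 'd) monoid_scheme \<Rightarrow> ('a \<Rightarrow> 'b) \<Rightarrow> bool" where
  "lie_iso G H \<phi> \<longleftrightarrow> \<phi> \<in> iso G H \<and> diffeomorphism_on (carrier G) (carrier H) \<phi>"

definition unit_circle :: "complex monoid" where
  "unit_circle = \<lparr>carrier = sphere 0 1, mult = (*), one = 1\<rparr>"

definition circle_subgroup :: "'a::euclidean_space set \<Rightarrow> ('a, 'c) monoid_scheme \<Rightarrow> bool" where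
  "circle_subgroup S G \<longleftrightarrow> subgroup S G \<and> (\<exists>\<phi>. lie_iso (G\<lparr>carrier := S\<rparr>) unit_circle \<phi>)"

definition acts_freely :: "('g, 'c) monoid_scheme \<Rightarrow> 'm set \<Rightarrow> ('g \<Rightarrow> 'm \<Rightarrow> 'm) \<Rightarrow> bool" where
  "acts_freely G M act \<longleftrightarrow> (\<forall>g\<in>carrier G. \<forall>m\<in>M. act g m = m \<longrightarrow> g = \<one>\<^bsub>G\<^esub>)"

definition equivalent_actions ::
  "('g::euclidean_space, 'c) monoid_scheme \<Rightarrow> 'm::euclidean_space set \<Rightarrow> ('g \<Rightarrow> 'm \<Rightarrow> 'm) \<Rightarrow>
   ('h::euclidean_space, 'd) monoid_scheme \<Rightarrow> 'n::euclidean_space set \<Rightarrow> ('h \<Rightarrow> 'n \<Rightarrow> 'n) \<Rightarrow> bool" where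
  "equivalent_actions L M act L' M' act' \<longleftrightarrow>
     (\<exists>\<phi> F. lie_iso L L' \<phi> \<and> diffeomorphism_on M M' F \<and>
        (\<forall>g\<in>carrier L. \<forall>m\<in>M. F (act g m) = act' (\<phi> g) (F m)))"

definition hopf_act :: "complex \<Rightarrow> complex^4 \<Rightarrow> complex^4" where
  "hopf_act z v = z *s v"

definition free_tuples :: "(int^4) set" where
  "free_tuples = {n. Gcd (range (($) n)) = 1 \<and>
     acts_freely (Spin8\<lparr>carrier := circle_of n\<rparr>) S7xS7 spin_act}"

definition free_tuples_equiv :: "((int^4) \<times> (int^4)) set" where
  "free_tuples_equiv = {(n, n') \<in> free_tuples \<times> free_tuples.
     equivalent_actions (Spin8\<lparr>carrier := circle_of n\<rparr>) S7xS7 spin_act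
                        (Spin8\<lparr>carrier := circle_of n'\<rparr>) S7xS7 spin_act}"

section \<open>The circles are subgroups of the tori, and these of the spin groups\<close>

lemma exhaust_8:
  fixes x :: 8
  shows "x = 1 \<or> x = 2 \<or> x = 3 \<or> x = 4 \<or> x = 5 \<or> x = 6 \<or> x = 7 \<or> x = 8"
proof (induct x)
  case (of_int z)
  hence "z = 0 \<or> z = 1 \<or> z = 2 \<or> z = 3 \<or> z = 4 \<or> z = 5 \<or> z = 6 \<or> z = 7" by fastforce
  thus ?case by auto
qed

lemma forall_8: "(\<forall>i::8. P i) \<longleftrightarrow> P 1 \<and> P 2 \<and> P 3 \<and> P 4 \<and> P 5 \<and> P 6 \<and> P 7 \<and> P 8"
  by (metis exhaust_8)

lemma UNIV_8: "UNIV = {1::8, 2, 3, 4, 5, 6, 7, 8}"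
  using exhaust_8 by auto

lemma sum_8: "sum f (UNIV::8 set) = f 1 + f 2 + f 3 + f 4 + f 5 + f 6 + f 7 + f 8"
  unfolding UNIV_8 by (simp add: ac_simps)

lemma vector_8 [simp]:
  "(vector [a,b,c,d,e,f,g,h] :: 'a::zero^8) $ 1 = a"
  "(vector [a,b,c,d,e,f,g,h] :: 'a::zero^8) $ 2 = b"
  "(vector [a,b,c,d,e,f,g,h] :: 'a::zero^8) $ 3 = c"
  "(vector [a,b,c,d,e,f,g,h] :: 'a::zero^8) $ 4 = d"
  "(vector [a,b,c,d,e,f,g,h] :: 'a::zero^8) $ 5 = e"
  "(vector [a,b,c,d,e,f,g,h] :: 'a::zero^8) $ 6 = f"
  "(vector [a,b,c,d,e,f,g,h] :: 'a::zero^8) $ 7 = g"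
  "(vector [a,b,c,d,e,f,g,h] :: 'a::zero^8) $ 8 = h"
  unfolding vector_def by simp_all

lemma vector_4 [simp]:
  "(vector [a,b,c,d] :: 'a::zero^4) $ 1 = a"
  "(vector [a,b,c,d] :: 'a::zero^4) $ 2 = b"
  "(vector [a,b,c,d] :: 'a::zero^4) $ 3 = c"
  "(vector [a,b,c,d] :: 'a::zero^4) $ 4 = d"
  unfolding vector_def by simp_all

lemma group_SO8: "group SO8"
proof (rule groupI)
  fix x y z assume "x \<in> carrier SO8" "y \<in> carrier SO8" 
  then show "x \<otimes>\<^bsub>SO8\<^esub> y \<in> carrier SO8"
    by (auto simp: SO8_def rotation_matrix_def orthogonal_matrix_mul det_mul)
next
  show "\<one>\<^bsub>SO8\<^esub> \<in> carrier SO8"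
    by (simp add: SO8_def rotation_matrix_def orthogonal_matrix_id)
next
  fix x assume x: "x \<in> carrier SO8"
  then have "transpose x \<in> carrier SO8 \<and> transpose x ** x = mat 1"
    by (auto simp: SO8_def rotation_matrix_def orthogonal_matrix_def)
  then show "\<exists>y\<in>carrier SO8. y \<otimes>\<^bsub>SO8\<^esub> x = \<one>\<^bsub>SO8\<^esub>"
    by (auto simp: SO8_def)
qed (auto simp: SO8_def matrix_mul_assoc)

lemma inv_SO8: "A \<in> carrier SO8 \<Longrightarrow> inv\<^bsub>SO8\<^esub> A = transpose A"
  by (rule group.inv_equality[OF group_SO8])
    (auto simp: SO8_def rotation_matrix_def orthogonal_matrix_def)

lemma triality_one: "triality (mat 1) (mat 1) (mat 1)"
  by (simp add: triality_def)

lemma triality_mult: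
  "triality A B C \<Longrightarrow> triality A' B' C' \<Longrightarrow> triality (A ** A') (B ** B') (C ** C')"
  by (simp add: triality_def flip: matrix_vector_mul_assoc)

lemma triality_transpose:
  assumes "A \<in> carrier SO8" "B \<in> carrier SO8" "C \<in> carrier SO8" "triality A B C"
  shows "triality (transpose A) (transpose B) (transpose C)"
  unfolding triality_def
proof (intro allI)
  fix x y
  have o: "A ** transpose A = mat 1" "B ** transpose B = mat 1" "transpose C ** C = mat 1"
    using assms by (auto simp: SO8_def rotation_matrix_def orthogonal_matrix_def)
  have "oct_mult x y = oct_mult (A *v (transpose A *v x)) (B *v (transpose B *v y))"
    by (simp only: matrix_vector_mul_assoc o matrix_vector_mul_lid)
  also have "\<dots> = C *v oct_mult (transpose A *v x) (transpose B *v y)"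
    using assms(4) unfolding triality_def by blast
  finally have "transpose C *v oct_mult x y =
      transpose C *v (C *v oct_mult (transpose A *v x) (transpose B *v y))"
    by simp
  then show "oct_mult (transpose A *v x) (transpose B *v y) = transpose C *v oct_mult x y"
    by (simp only: matrix_vector_mul_assoc o matrix_vector_mul_lid)
qed

lemma carrier_Spin8: "carrier Spin8 = {(A, B). A \<in> carrier SO8 \<and> B \<in> carrier SO8 \<and>
    (\<exists>C \<in> carrier SO8. triality A B C)}"
  and mult_Spin8: "(A, B) \<otimes>\<^bsub>Spin8\<^esub> (A', B') = (A ** A', B ** B')"
  and one_Spin8: "\<one>\<^bsub>Spin8\<^esub> = (mat 1, mat 1)"
  by (simp_all add: Spin8_def SO8_def DirProd_def)

lemma SO8_simps:
  "A \<in> carrier SO8 \<Longrightarrow> B \<in> carrier SO8 \<Longrightarrow> A ** B \<in> carrier SO8"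
  "mat 1 \<in> carrier SO8"
  "A \<in> carrier SO8 \<Longrightarrow> transpose A \<in> carrier SO8"
  by (auto simp: SO8_def rotation_matrix_def orthogonal_matrix_mul det_mul orthogonal_matrix_id)

lemma subgroup_Spin8: "subgroup (carrier Spin8) (SO8 \<times>\<times> SO8)"
proof (rule group.subgroupI)
  show "group (SO8 \<times>\<times> SO8)" by (intro DirProd_group group_SO8)
  show "carrier Spin8 \<subseteq> carrier (SO8 \<times>\<times> SO8)" by (auto simp: carrier_Spin8)
  have "(mat 1, mat 1) \<in> carrier Spin8"
    using SO8_simps(2) triality_one by (auto simp: carrier_Spin8)
  then show "carrier Spin8 \<noteq> {}" by blast
next
  fix a assume "a \<in> carrier Spin8"
  then obtain A B C where h: "a = (A, B)" "A \<in> carrier SO8" "B \<in> carrier SO8" "C \<in> carrier SO8"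
    "triality A B C" by (auto simp: carrier_Spin8)
  then have "inv\<^bsub>SO8 \<times>\<times> SO8\<^esub> a = (transpose A, transpose B)"
    by (simp add: group_SO8 inv_SO8)
  then show "inv\<^bsub>SO8 \<times>\<times> SO8\<^esub> a \<in> carrier Spin8"
    using h triality_transpose[OF h(2-5)] SO8_simps(3) by (auto simp: carrier_Spin8)
next
  fix a b assume "a \<in> carrier Spin8" "b \<in> carrier Spin8"
  then obtain A B C A' B' C' where h: "a = (A, B)" "A \<in> carrier SO8" "B \<in> carrier SO8"
    "C \<in> carrier SO8" "triality A B C" "b = (A', B')" "A' \<in> carrier SO8" "B' \<in> carrier SO8"
    "C' \<in> carrier SO8" "triality A' B' C'" by (auto simp: carrier_Spin8)
  have "a \<otimes>\<^bsub>SO8 \<times>\<times> SO8\<^esub> b = (A ** A', B ** B')"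
    using h by (simp add: SO8_def)
  then show "a \<otimes>\<^bsub>SO8 \<times>\<times> SO8\<^esub> b \<in> carrier Spin8"
    using SO8_simps(1)[OF h(2,7)] SO8_simps(1)[OF h(3,8)] SO8_simps(1)[OF h(4,9)]
      triality_mult[OF h(5,10)] by (auto simp: carrier_Spin8)
qed

lemma Spin8_eq: "Spin8 = (SO8 \<times>\<times> SO8)\<lparr>carrier := carrier Spin8\<rparr>"
  by (simp add: Spin8_def)

lemma group_Spin8: "group Spin8"
  by (metis Spin8_eq DirProd_group group.subgroup_imp_group group_SO8 subgroup_Spin8)

lemma inv_Spin8: "(A, B) \<in> carrier Spin8 \<Longrightarrow> inv\<^bsub>Spin8\<^esub> (A, B) = (transpose A, transpose B)"
proof (rule group.inv_equality[OF group_Spin8])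
  assume h: "(A, B) \<in> carrier Spin8"
  then show "(transpose A, transpose B) \<otimes>\<^bsub>Spin8\<^esub> (A, B) = \<one>\<^bsub>Spin8\<^esub>"
    by (auto simp: carrier_Spin8 mult_Spin8 one_Spin8 SO8_def rotation_matrix_def orthogonal_matrix_def)
  from h obtain C where C: "A \<in> carrier SO8" "B \<in> carrier SO8" "C \<in> carrier SO8" "triality A B C"
    by (auto simp: carrier_Spin8)
  then show "(transpose A, transpose B) \<in> carrier Spin8"
    using triality_transpose[OF C] SO8_simps(3) by (auto simp: carrier_Spin8)
qed

lemma subgroup_Spin7: "subgroup (carrier Spin7) Spin8"
proof (rule group.subgroupI[OF group_Spin8])
  show "carrier Spin7 \<subseteq> carrier Spin8" by (auto simp: Spin7_def)
  have "(mat 1, mat 1) \<in> carrier Spin7"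
    using SO8_simps(2) triality_one by (auto simp: Spin7_def carrier_Spin8)
  then show "carrier Spin7 \<noteq> {}" by blast
next
  fix a assume a: "a \<in> carrier Spin7"
  then obtain A B where h: "a = (A, B)" "(A, B) \<in> carrier Spin8" "triality A B B"
    by (auto simp: Spin7_def)
  then have "triality (transpose A) (transpose B) (transpose B)"
    by (intro triality_transpose) (auto simp: carrier_Spin8)
  then show "inv\<^bsub>Spin8\<^esub> a \<in> carrier Spin7"
    using h inv_Spin8 group.inv_closed[OF group_Spin8 h(2)] by (auto simp: Spin7_def)
next
  fix a b assume "a \<in> carrier Spin7" "b \<in> carrier Spin7"
  then obtain A B A' B' where h: "a = (A, B)" "(A, B) \<in> carrier Spin8" "triality A B B"
    "b = (A', B')" "(A', B') \<in> carrier Spin8" "triality A' B' B'"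
    by (auto simp: Spin7_def)
  then have "(A ** A', B ** B') \<in> carrier Spin8"
    by (metis group.subgroup_self group_Spin8 mult_Spin8 subgroup.m_closed)
  then show "a \<otimes>\<^bsub>Spin8\<^esub> b \<in> carrier Spin7"
    using h(1,4) triality_mult[OF h(3,6)] by (auto simp: Spin7_def mult_Spin8)
qed

lemma Spin7_simps: "mult Spin7 = mult Spin8" "one Spin7 = one Spin8"
  by (simp_all add: Spin7_def)

lemma group_Spin7: "group Spin7"
  using group.subgroup_imp_group[OF group_Spin8 subgroup_Spin7] by (simp add: Spin7_def)

lemma rot_diag_mult: "rot_diag a b c d ** rot_diag a' b' c' d' = rot_diag (a+a') (b+b') (c+c') (d+d')"
  by (simp add: vec_eq_iff forall_8 matrix_matrix_mult_def sum_8 rot_diag_def cos_add sin_add)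

lemma rot_diag_0: "rot_diag 0 0 0 0 = mat 1"
  by (simp add: vec_eq_iff forall_8 mat_def rot_diag_def)

lemma rot_diag_transpose: "transpose (rot_diag a b c d) = rot_diag (-a) (-b) (-c) (-d)"
  by (simp add: vec_eq_iff forall_8 transpose_def rot_diag_def)

lemma rot_diag_SO8: "rot_diag a b c d \<in> carrier SO8"
proof -
  have orth: "orthogonal_matrix (rot_diag a b c d)" for a b c d
    by (simp add: orthogonal_matrix_def rot_diag_transpose rot_diag_mult rot_diag_0)
  have "rot_diag a b c d = rot_diag (a/2) (b/2) (c/2) (d/2) ** rot_diag (a/2) (b/2) (c/2) (d/2)"
    by (simp add: rot_diag_mult)
  moreover have "det (rot_diag (a/2) (b/2) (c/2) (d/2)) = 1 \<or> det (rot_diag (a/2) (b/2) (c/2) (d/2)) = -1"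
    using det_orthogonal_matrix orth by blast
  ultimately have "det (rot_diag a b c d) = 1"
    by (auto simp: det_mul)
  then show ?thesis using orth by (simp add: SO8_def rotation_matrix_def)
qed

lemmas oct_unfold = triality_def oct_mult_def oct_of_def oct_fst_def oct_snd_def quat_mult_def
  quat_cnj_def vec_eq_iff forall_8 matrix_vector_mult_def sum_8 rot_diag_def

lemma torus_triality:
  "triality (rot_diag a1 (a1 + a3 + a4) (a2 + a3 - a4) a2)
            (rot_diag a3 a4 (- a1 + a2 - a4) (a1 + a2 + a3))
            (rot_diag (a1 + a3) (a1 + a4) (a2 - a4) (a2 + a3))"
proof -
  have sc: "sin a * (sin a * z) = z - cos a * (cos a * z)" for a z :: real
    using sin_cos_squared_add[of a] by algebra
  have 1: "triality (rot_diag a a 0 0) (rot_diag 0 0 (-a) a) (rot_diag a a 0 0)" for a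
    by (simp add: oct_unfold algebra_simps sc)
  have 2: "triality (rot_diag 0 0 a a) (rot_diag 0 0 a a) (rot_diag 0 0 a a)" for a
    by (simp add: oct_unfold algebra_simps sc)
  have 3: "triality (rot_diag 0 a a 0) (rot_diag a 0 0 a) (rot_diag a 0 0 a)" for a
    by (simp add: oct_unfold algebra_simps sc)
  have 4: "triality (rot_diag 0 a (-a) 0) (rot_diag 0 a (-a) 0) (rot_diag 0 a (-a) 0)" for a
    by (simp add: oct_unfold algebra_simps sc)
  show ?thesis
    using triality_mult[OF triality_mult[OF 1[of a1] 2[of a2]] triality_mult[OF 3[of a3] 4[of a4]]]
    by (simp add: rot_diag_mult algebra_simps)
qed

lemma torus_elt_Spin8: "torus_elt a1 a2 a3 a4 \<in> carrier Spin8"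
  unfolding torus_elt_def carrier_Spin8 using rot_diag_SO8 torus_triality by blast

lemma torus_elt_Spin7: "torus_elt 0 a2 a3 a4 \<in> carrier Spin7"
  using torus_elt_Spin8[of 0 a2 a3 a4] torus_triality[of 0 a3 a4 a2]
  by (simp add: torus_elt_def Spin7_def add.commute)

lemma torus_elt_mult: "torus_elt a1 a2 a3 a4 \<otimes>\<^bsub>Spin8\<^esub> torus_elt b1 b2 b3 b4 =
    torus_elt (a1 + b1) (a2 + b2) (a3 + b3) (a4 + b4)"
  by (simp add: torus_elt_def mult_Spin8 rot_diag_mult algebra_simps)

lemma torus_elt_inv: "inv\<^bsub>Spin8\<^esub> (torus_elt a1 a2 a3 a4) = torus_elt (- a1) (- a2) (- a3) (- a4)"
  using torus_elt_Spin8[of a1 a2 a3 a4]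
  by (simp add: torus_elt_def inv_Spin8 rot_diag_transpose algebra_simps)

lemma torus_elt_periodic:
  assumes "cos a1 = cos b1" "sin a1 = sin b1" "cos a2 = cos b2" "sin a2 = sin b2"
    "cos a3 = cos b3" "sin a3 = sin b3" "cos a4 = cos b4" "sin a4 = sin b4"
  shows "torus_elt a1 a2 a3 a4 = torus_elt b1 b2 b3 b4"
  using assms by (simp add: torus_elt_def rot_diag_def cos_add sin_add cos_diff sin_diff)

definition angle_mod :: "real \<Rightarrow> real" where
  "angle_mod t = t - 2 * pi * of_int \<lfloor>t / (2 * pi)\<rfloor>"

lemma angle_mod_range: "angle_mod t \<in> {0..<2*pi}"
  using floor_divide_lower[of "2 * pi" t] floor_divide_upper[of "2 * pi" t] pi_gt_zero
  by (simp add: angle_mod_def algebra_simps)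

lemma cos_sin_mult_angle_mod: "cos (of_int k * angle_mod t) = cos (of_int k * t)" "sin (of_int k * angle_mod t) = sin (of_int k * t)"
proof -
  have "of_int k * angle_mod t = of_int k * t - 2 * pi * of_int (k * \<lfloor>t / (2 * pi)\<rfloor>)"
    by (simp add: angle_mod_def algebra_simps)
  then show "cos (of_int k * angle_mod t) = cos (of_int k * t)" "sin (of_int k * angle_mod t) = sin (of_int k * t)"
    by (simp_all only: cos_diff sin_diff cos_int_2pin sin_int_2pin)
qed

lemma cos_sin_angle_mod: "cos (angle_mod t) = cos t" "sin (angle_mod t) = sin t"
  using cos_sin_mult_angle_mod[of 1] by simp_all

lemma T4_eq: "T4 = {torus_elt a1 a2 a3 a4 | a1 a2 a3 a4. True}"
proof -
  have "torus_elt a1 a2 a3 a4 \<in> T4" for a1 a2 a3 a4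
    unfolding T4_def using angle_mod_range torus_elt_periodic[of a1 "angle_mod a1" a2 "angle_mod a2" a3 "angle_mod a3" a4 "angle_mod a4"]
    by (intro CollectI exI[of _ "angle_mod a1"] exI[of _ "angle_mod a2"] exI[of _ "angle_mod a3"] exI[of _ "angle_mod a4"])
      (simp add: cos_sin_angle_mod)
  then show ?thesis unfolding T4_def by blast
qed

lemma T3_eq: "T3 = {torus_elt 0 a2 a3 a4 | a2 a3 a4. True}"
proof -
  have "torus_elt 0 a2 a3 a4 \<in> T3" for a2 a3 a4
    unfolding T3_def using angle_mod_range torus_elt_periodic[of 0 0 a2 "angle_mod a2" a3 "angle_mod a3" a4 "angle_mod a4"]
    by (intro CollectI exI[of _ "angle_mod a2"] exI[of _ "angle_mod a3"] exI[of _ "angle_mod a4"])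
      (simp add: cos_sin_angle_mod)
  then show ?thesis unfolding T3_def by blast
qed

lemma circle_of_eq: "circle_of n = range (\<lambda>\<theta>. torus_elt (of_int (n$1) * \<theta>) (of_int (n$2) * \<theta>)
    (of_int (n$3) * \<theta>) (of_int (n$4) * \<theta>))"
proof -
  have "torus_elt (of_int (n$1) * t) (of_int (n$2) * t) (of_int (n$3) * t) (of_int (n$4) * t) \<in> circle_of n" for t
    unfolding circle_of_def
    by (rule image_eqI[OF _ angle_mod_range[of t]], rule torus_elt_periodic) (simp_all add: cos_sin_mult_angle_mod)
  then show ?thesis unfolding circle_of_def by blast
qed

lemma subgroup_T4: "subgroup T4 Spin8"
proof (rule group.subgroupI[OF group_Spin8])
  show "T4 \<subseteq> carrier Spin8" using torus_elt_Spin8 by (auto simp: T4_eq)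
  show "T4 \<noteq> {}" unfolding T4_eq by blast
  show "inv\<^bsub>Spin8\<^esub> a \<in> T4" if "a \<in> T4" for a
    using that unfolding T4_eq by clarify (unfold torus_elt_inv, blast)
  show "a \<otimes>\<^bsub>Spin8\<^esub> b \<in> T4" if "a \<in> T4" "b \<in> T4" for a b
    using that unfolding T4_eq by clarify (unfold torus_elt_mult, blast)
qed

lemma T3_subset_T4: "T3 \<subseteq> T4"
  by (auto simp: T3_eq T4_eq)

lemma subgroup_T3: "subgroup T3 Spin7"
proof -
  have "subgroup T3 Spin8"
  proof (rule group.subgroupI[OF group_Spin8])
    show "T3 \<subseteq> carrier Spin8" using torus_elt_Spin8 by (auto simp: T3_eq)
    show "T3 \<noteq> {}" unfolding T3_eq by blast
    show "inv\<^bsub>Spin8\<^esub> a \<in> T3" if "a \<in> T3" for a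
      using that unfolding T3_eq by clarify (unfold torus_elt_inv minus_zero, blast)
    show "a \<otimes>\<^bsub>Spin8\<^esub> b \<in> T3" if "a \<in> T3" "b \<in> T3" for a b
      using that unfolding T3_eq by clarify (unfold torus_elt_mult add_0, blast)
  qed
  moreover have "T3 \<subseteq> carrier Spin7" using torus_elt_Spin7 by (auto simp: T3_eq)
  ultimately show ?thesis
    using group.subgroup_incl[OF group_Spin8 _ subgroup_Spin7] by (simp add: Spin7_def)
qed

lemma subgroup_circle_of: "subgroup (circle_of n) (Spin8\<lparr>carrier := T4\<rparr>)"
proof -
  have "subgroup (circle_of n) Spin8"
  proof (rule group.subgroupI[OF group_Spin8])
    show "circle_of n \<subseteq> carrier Spin8" using torus_elt_Spin8 by (auto simp: circle_of_eq)
    show "circle_of n \<noteq> {}" by (auto simp: circle_of_eq)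
    show "inv\<^bsub>Spin8\<^esub> a \<in> circle_of n" if "a \<in> circle_of n" for a
      using that unfolding circle_of_eq by clarify (unfold torus_elt_inv mult_minus_right[symmetric], blast)
    show "a \<otimes>\<^bsub>Spin8\<^esub> b \<in> circle_of n" if "a \<in> circle_of n" "b \<in> circle_of n" for a b
      using that unfolding circle_of_eq by clarify (unfold torus_elt_mult distrib_left[symmetric], blast)
  qed
  moreover have "circle_of n \<subseteq> T4" by (auto simp: circle_of_eq T4_eq)
  ultimately show ?thesis
    using group.subgroup_incl[OF group_Spin8 _ subgroup_T4] by simp
qed

lemma norm_SO8: "A \<in> carrier SO8 \<Longrightarrow> norm (A *v x) = norm x"
  by (metis SO8_def mem_Collect_eq partial_object.select_convs(1) rotation_matrix_def
      orthogonal_transformation_matrix matrix_of_matrix_vector_mul matrix_vector_mul_linear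
      orthogonal_transformation_norm)

lemma spin_act_S7xS7: "g \<in> carrier Spin8 \<Longrightarrow> m \<in> S7xS7 \<Longrightarrow> spin_act g m \<in> S7xS7"
  by (auto simp: spin_act_def S7xS7_def S7_def carrier_Spin8 norm_SO8)

lemma oct_mult_one_right: "oct_mult x (axis 1 1) = x"
  by (simp add: oct_unfold axis_def)

lemma oct_mult_one_left: "oct_mult (axis 1 1) x = x"
  by (simp add: oct_unfold axis_def)

lemma spin_act_S6xS7:
  assumes g: "g \<in> carrier Spin7" and m: "m \<in> S6xS7"
  shows "spin_act g m \<in> S6xS7"
proof -
  obtain A B where h: "g = (A, B)" "g \<in> carrier Spin8" "A \<in> carrier SO8" "B \<in> carrier SO8" "triality A B B"
    using g by (auto simp: Spin7_def carrier_Spin8)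
  have o: "B ** transpose B = mat 1" "transpose A ** A = mat 1"
    using h by (auto simp: SO8_def rotation_matrix_def orthogonal_matrix_def)
  let ?e = "axis 1 1 :: octonion"
  let ?y = "transpose B *v ?e"
  have y: "B *v ?y = ?e" by (simp only: matrix_vector_mul_assoc o matrix_vector_mul_lid)
  have "oct_mult (A *v ?e) (B *v ?y) = B *v oct_mult ?e ?y"
    using h(5) unfolding triality_def by blast
  then have Ae: "A *v ?e = ?e" by (simp only: y oct_mult_one_left oct_mult_one_right)
  then have tAe: "transpose A *v ?e = ?e"
    by (metis o(2) matrix_vector_mul_assoc matrix_vector_mul_lid)
  have "(A *v x) $ 1 = x $ 1" for x
  proof -
    have "(A *v x) $ 1 = (A *v x) \<bullet> ?e" by (simp add: inner_axis)
    also have "\<dots> = x \<bullet> (transpose A *v ?e)" 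
      by (metis dot_lmul_matrix inner_commute transpose_matrix_vector)
    finally show ?thesis unfolding tAe by (simp add: inner_axis)
  qed
  then show ?thesis
    using m spin_act_S7xS7[OF h(2)] by (auto simp: S6xS7_def spin_act_def h(1) oct_Re_def)
qed

end

theory Submission
  imports Defs
begin

text \<open>\<^bold>\<open>Freeness.\<close> A torus element fixes a point of the product of spheres exactly if one of the
  rotation blocks of each of its two components is trivial.  On the circle with parameter \<open>s\<close> the
  blocks are rotations by the weights times \<open>s\<close>, and two weights \<open>l\<close>, \<open>r\<close> have a common period outside
  \<open>2 \<pi> \<int>\<close> unless \<open>gcd l r = 1\<close> (\<open>circle_acts_freely_iff\<close>).

  \<^bold>\<open>Infinitely many classes.\<close> The invariant is the sum of the squares of all eight weights; for a
  free circle this is the first Pontryagin class of the quotient, up to sign.  The following argument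
  replaces the theory of characteristic classes.  An equivariant diffeomorphism \<open>F\<close> extends
  homogeneously to an open set of \<open>\<real>\<^sup>1\<^sup>6\<close>, and its derivative is a map into \<open>GL\<^sub>1\<^sub>6\<close> which intertwines the
  two circles.  Pull it back to a 4-ball in this open set whose boundary 3-sphere is invariant under the
  circle, and call the result \<open>g\<close>.  The form \<open>trace ((g\<inverse> dg)\<^sup>3)\<close> is closed
  (\<open>trace_form_closed\<close>), so its integral over the boundary sphere vanishes.  There \<open>g\<close> is
  equivariant, \<open>\<partial>g = D' g - g D\<close> along the circle with \<open>D\<close>, \<open>D'\<close> the generators, which makes the
  contraction of the form with the circle direction exact (\<open>boundary_form_derivative\<close>), and Stokes'
  theorem evaluates the integral as a non-zero multiple of \<open>trace D'\<^sup>2 - trace D\<^sup>2\<close>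
  (\<open>trace_square_eq\<close>).  Since \<open>trace D\<^sup>2\<close> is \<open>-2\<close> times the sum of the squared weights, the latter is an
  invariant.  It is injective on the free family \<open>(2, 6k + 2, 1, -1)\<close>.

  \<^bold>\<open>Spin(7).\<close> If \<open>\<alpha>\<^sub>1 = 0\<close>, then \<open>A\<close> fixes the imaginary unit \<open>i\<close>, so a circle acting freely on the
  product must already act freely on the 7-sphere: its right weights are \<open>\<plusminus>1\<close>.  This leaves, up to
  orientation of the circle, three circles, in each of which exactly one left weight is non-zero and
  equal to \<open>\<plusminus>2\<close>.  Permuting coordinate planes and conjugating complex coordinates carries all of them
  to one model (\<open>free_circle_equivalent_model\<close>) and the projected action to the Hopf action
  (\<open>free_circle_projection_hopf\<close>).  An abstract circle subgroup of the torus is brought into the form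
  \<open>circle_of m\<close> because differentiable homomorphisms of the circle to itself are power maps.\<close>

section \<open>Calculus of k times continuously differentiable maps\<close>

lemma Ck_on_Suc_has_derivative:
  "Ck_on (Suc k) f U \<Longrightarrow> x \<in> U \<Longrightarrow> (f has_derivative frechet_derivative f (at x)) (at x)"
  by (simp add: frechet_derivative_works)

lemma Ck_on_SucI:
  assumes "\<And>x. x \<in> U \<Longrightarrow> (f has_derivative f' x) (at x)"
    and "\<And>v. Ck_on k (\<lambda>x. frechet_derivative f (at x) v) U"
  shows "Ck_on (Suc k) f U"
  using assms by (auto simp: differentiable_def)

lemma Ck_on_cong:
  assumes "open U" "\<And>x. x \<in> U \<Longrightarrow> f x = g x" "Ck_on k f U"
  shows "Ck_on k g U"
  using assms(2,3)
proof (induction k arbitrary: f g)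
  case 0
  then show ?case by (simp cong: continuous_on_cong)
next
  case (Suc k)
  have der: "(g has_derivative frechet_derivative f (at x)) (at x)" if "x \<in> U" for x
    by (rule has_derivative_transform_within_open[OF Ck_on_Suc_has_derivative[OF Suc.prems(2) that] assms(1) that])
      (rule Suc.prems(1))
  show ?case
  proof (rule Ck_on_SucI[OF der])
    fix v
    show "Ck_on k (\<lambda>x. frechet_derivative g (at x) v) U"
      by (rule Suc.IH[of "\<lambda>x. frechet_derivative f (at x) v"])
        (use Suc.prems(2) frechet_derivative_at[OF der] in auto)
  qed auto
qed

lemma Ck_on_SucI':
  assumes "open U" "\<And>x. x \<in> U \<Longrightarrow> (f has_derivative f' x) (at x)"
    and "\<And>v. Ck_on k (\<lambda>x. f' x v) U"
  shows "Ck_on (Suc k) f U"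
proof (rule Ck_on_SucI[OF assms(2)])
  fix v show "Ck_on k (\<lambda>x. frechet_derivative f (at x) v) U"
    by (rule Ck_on_cong[OF assms(1) _ assms(3)[of v]]) (use frechet_derivative_at[OF assms(2)] in auto)
qed auto

lemma Ck_on_subset: "Ck_on k f U \<Longrightarrow> V \<subseteq> U \<Longrightarrow> Ck_on k f V"
  by (induction k arbitrary: f) (auto intro: continuous_on_subset)

lemma Ck_on_SucD: "Ck_on (Suc k) f U \<Longrightarrow> Ck_on k f U"
proof (induction k arbitrary: f)
  case 0
  then show ?case
    by (auto intro!: continuous_at_imp_continuous_on differentiable_imp_continuous_within)
qed simp

lemma Ck_on_imp_continuous_on: "Ck_on k f U \<Longrightarrow> continuous_on U f"
  by (induction k) (use Ck_on_SucD in auto)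

lemma Ck_on_local:
  assumes "\<And>x. x \<in> U \<Longrightarrow> \<exists>V. open V \<and> x \<in> V \<and> Ck_on k f V"
  shows "Ck_on k f U"
  using assms
proof (induction k arbitrary: f)
  case 0
  show ?case unfolding Ck_on.simps
  proof (rule continuous_at_imp_continuous_on, rule ballI)
    fix x assume "x \<in> U"
    then obtain V where "open V" "x \<in> V" "continuous_on V f" using 0 by auto
    then show "isCont f x" by (simp add: continuous_on_eq_continuous_at)
  qed
next
  case (Suc k)
  show ?case unfolding Ck_on.simps
  proof (intro conjI ballI allI)
    fix x assume "x \<in> U"
    then show "f differentiable at x" using Suc.prems by fastforce
  next
    fix v show "Ck_on k (\<lambda>x. frechet_derivative f (at x) v) U"
      by (rule Suc.IH) (use Suc.prems in fastforce)
  qed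
qed

lemma Ck_on_const: "open U \<Longrightarrow> Ck_on k (\<lambda>x. c) U"
  by (induction k arbitrary: c) (auto intro!: Ck_on_SucI')

lemma Ck_on_linear:
  assumes "open U" "bounded_linear f"
  shows "Ck_on k f U"
proof (cases k)
  case 0
  then show ?thesis using assms(2) by (auto intro: linear_continuous_on)
next
  case (Suc k')
  show ?thesis unfolding Suc
    by (rule Ck_on_SucI'[OF assms(1), of f "\<lambda>_. f"])
      (auto intro: Ck_on_const[OF assms(1)] bounded_linear_imp_has_derivative assms)
qed

lemma Ck_on_add:
  assumes "open U" "Ck_on k f U" "Ck_on k g U"
  shows "Ck_on k (\<lambda>x. f x + g x) U"
  using assms(2,3)
proof (induction k arbitrary: f g)
  case (Suc k)
  show ?case
  proof (rule Ck_on_SucI'[OF assms(1)])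
    fix x assume "x \<in> U"
    then show "((\<lambda>x. f x + g x) has_derivative
        (\<lambda>v. frechet_derivative f (at x) v + frechet_derivative g (at x) v)) (at x)"
      by (intro has_derivative_add Ck_on_Suc_has_derivative[of k _ U] Suc.prems)
  next
    show "Ck_on k (\<lambda>x. frechet_derivative f (at x) v + frechet_derivative g (at x) v) U" for v
      by (rule Suc.IH) (use Suc.prems in auto)
  qed
qed (auto intro: continuous_intros)

lemma Ck_on_sum:
  assumes "open U" "\<And>i. i \<in> I \<Longrightarrow> Ck_on k (f i) U"
  shows "Ck_on k (\<lambda>x. \<Sum>i\<in>I. f i x) U"
  using assms(2)
  by (induction I rule: infinite_finite_induct) (auto intro!: Ck_on_const Ck_on_add assms(1))

lemma Ck_on_bilinear:
  assumes "bounded_bilinear pr" "open U" "Ck_on k f U" "Ck_on k g U"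
  shows "Ck_on k (\<lambda>x. pr (f x) (g x)) U"
  using assms(3,4)
proof (induction k arbitrary: f g)
  case 0
  then show ?case by (auto intro: bounded_bilinear.continuous_on[OF assms(1)])
next
  case (Suc k)
  show ?case
  proof (rule Ck_on_SucI'[OF assms(2)])
    fix x assume "x \<in> U"
    then show "((\<lambda>x. pr (f x) (g x)) has_derivative
        (\<lambda>v. pr (f x) (frechet_derivative g (at x) v) + pr (frechet_derivative f (at x) v) (g x))) (at x)"
      by (intro bounded_bilinear.FDERIV[OF assms(1)] Ck_on_Suc_has_derivative[of k _ U] Suc.prems)
  next
    fix v
    show "Ck_on k (\<lambda>x. pr (f x) (frechet_derivative g (at x) v) + pr (frechet_derivative f (at x) v) (g x)) U"
      by (intro Ck_on_add assms Suc.IH Suc.prems(1,2)[THEN Ck_on_SucD]) (use Suc.prems in auto)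
  qed
qed

lemmas Ck_on_scaleR = Ck_on_bilinear[OF bounded_bilinear_scaleR]
  and Ck_on_mult = Ck_on_bilinear[OF bounded_bilinear_mult]
  and Ck_on_inner = Ck_on_bilinear[OF bounded_bilinear_inner]

text \<open>In coordinates the chain rule reads \<open>D(f \<circ> g)(x) v = \<Sum>\<^sub>b (Dg(x) v \<bullet> b) D f (g x) b\<close>, so that
  an induction on \<open>k\<close> reduces the composition to products and sums.\<close>

lemma Ck_on_compose:
  assumes "open U" "open V" "g ` U \<subseteq> V" "Ck_on k f V" "Ck_on k g U"
  shows "Ck_on k (\<lambda>x. f (g x)) U"
  using assms(4,5)
proof (induction k arbitrary: f)
  case 0
  then show ?case using assms(3) by (auto intro: continuous_on_compose2)
next
  case (Suc k)
  let ?f' = "\<lambda>x v. \<Sum>b\<in>Basis. (frechet_derivative g (at x) v \<bullet> b) *\<^sub>R frechet_derivative f (at (g x)) b"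
  show ?case
  proof (rule Ck_on_SucI'[OF assms(1)])
    fix x assume x: "x \<in> U"
    have f: "(f has_derivative frechet_derivative f (at (g x))) (at (g x))"
      using x assms(3) Suc.prems(1) by (intro Ck_on_Suc_has_derivative[of k _ V]) auto
    interpret lf: bounded_linear "frechet_derivative f (at (g x))"
      by (rule has_derivative_bounded_linear[OF f])
    have "((\<lambda>x. f (g x)) has_derivative (\<lambda>v. frechet_derivative f (at (g x)) (frechet_derivative g (at x) v))) (at x)"
      by (rule has_derivative_compose[OF Ck_on_Suc_has_derivative[OF Suc.prems(2) x] f])
    moreover have "frechet_derivative f (at (g x)) w = (\<Sum>b\<in>Basis. (w \<bullet> b) *\<^sub>R frechet_derivative f (at (g x)) b)" for w
      by (subst (1) euclidean_representation[symmetric, of w]) (simp only: lf.sum lf.scaleR)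
    ultimately show "((\<lambda>x. f (g x)) has_derivative ?f' x) (at x)"
      by (rule has_derivative_eq_rhs[OF _ ext])
  next
    fix v show "Ck_on k (\<lambda>x. ?f' x v) U"
    proof (intro Ck_on_sum Ck_on_scaleR Ck_on_inner Ck_on_const assms(1))
      show "Ck_on k (\<lambda>x. frechet_derivative f (at (g x)) b) U" for b
        by (rule Suc.IH) (use Suc.prems Ck_on_SucD in auto)
    qed (use Suc.prems in auto)
  qed
qed

lemma Ck_on_linear_compose:
  assumes "bounded_linear L" "open U" "Ck_on k f U"
  shows "Ck_on k (\<lambda>x. L (f x)) U"
  by (rule Ck_on_compose[OF assms(2) open_UNIV _ Ck_on_linear[OF open_UNIV assms(1)] assms(3)]) auto

lemma Ck_on_componentwise:
  assumes "open U" "\<And>b. b \<in> Basis \<Longrightarrow> Ck_on k (\<lambda>x. f x \<bullet> b) U"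
  shows "Ck_on k f U"
proof -
  have "Ck_on k (\<lambda>x. \<Sum>b\<in>Basis. (f x \<bullet> b) *\<^sub>R b) U"
    by (intro Ck_on_sum Ck_on_scaleR Ck_on_const assms)
  then show ?thesis by (simp add: euclidean_representation)
qed

lemma Ck_on_Pair:
  assumes "open U" "Ck_on k f U" "Ck_on k g U"
  shows "Ck_on k (\<lambda>x. (f x, g x)) U"
proof -
  have "Ck_on k (\<lambda>x. (f x, 0) + (0, g x)) U"
    by (intro Ck_on_add assms Ck_on_linear_compose[of "\<lambda>x. (x, 0)"] Ck_on_linear_compose[of "\<lambda>x. (0, x)"])
      (auto intro!: bounded_linear_intros)
  then show ?thesis by simp
qed

text \<open>The derivative of \<open>1 / norm x\<close> is a polynomial in \<open>x\<close> and \<open>1 / norm x\<close> itself, so smoothness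
  follows by induction.\<close>

lemma Ck_on_inverse_norm:
  fixes U :: "'a::euclidean_space set"
  assumes "open U" "0 \<notin> U"
  shows "Ck_on k (\<lambda>x. inverse (norm x)) U"
proof (induction k)
  case 0
  then show ?case using assms by (auto intro!: continuous_intros)
next
  case (Suc k)
  let ?q = "\<lambda>x::'a. inverse (norm x)"
  show ?case
  proof (rule Ck_on_SucI'[OF assms(1), where f' = "\<lambda>x v. (- (x \<bullet> v)) * (?q x * (?q x * ?q x))"])
    fix x assume "x \<in> U"
    then have "x \<noteq> 0" using assms by auto
    then show "(?q has_derivative (\<lambda>v. - (x \<bullet> v) * (?q x * (?q x * ?q x)))) (at x)"
      by (auto intro!: derivative_eq_intros has_derivative_norm simp: sgn_div_norm inner_commute divide_simps)
  next
    have "bounded_linear (\<lambda>x. - (x \<bullet> v))" for v :: 'a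
      by (intro bounded_linear_minus bounded_linear_inner_left)
    then show "Ck_on k (\<lambda>x. - (x \<bullet> v) * (?q x * (?q x * ?q x))) U" for v
      by (intro Ck_on_mult assms Suc.IH Ck_on_linear)
  qed
qed

lemma Ck_on_norm:
  fixes U :: "'a::euclidean_space set"
  assumes "open U" "0 \<notin> U"
  shows "Ck_on k norm U"
proof (rule Ck_on_cong[OF assms(1)])
  show "Ck_on k (\<lambda>x::'a. inverse (norm x) * (x \<bullet> x)) U"
    by (intro Ck_on_mult Ck_on_inner Ck_on_inverse_norm Ck_on_linear bounded_linear_ident assms)
  show "inverse (norm x) * (x \<bullet> x) = norm x" if "x \<in> U" for x
    using that assms by (auto simp: divide_simps dot_square_norm power2_eq_square)
qed

lemma Ck_on_cos_sin:
  "Ck_on k (cos :: real \<Rightarrow> real) UNIV" "Ck_on k (sin :: real \<Rightarrow> real) UNIV"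
proof (induction k)
  case 0
  case 1 show ?case by (simp add: continuous_on_cos continuous_on_id)
  case 2 show ?case by (simp add: continuous_on_sin continuous_on_id)
next
  case (Suc k)
  case 1
  have "Ck_on k (\<lambda>x::real. v * - sin x) UNIV" for v
    by (intro Ck_on_mult Ck_on_const Ck_on_linear_compose[of uminus] Suc bounded_linear_minus bounded_linear_ident open_UNIV)
  then show ?case by (intro Ck_on_SucI'[where f' = "\<lambda>x v. v * - sin x"])
      (auto intro!: derivative_eq_intros)
  case 2
  have "Ck_on k (\<lambda>x::real. v * cos x) UNIV" for v
    by (intro Ck_on_mult Ck_on_const Suc open_UNIV)
  then show ?case by (intro Ck_on_SucI'[where f' = "\<lambda>x v. v * cos x"])
      (auto intro!: derivative_eq_intros)
qed

lemmas Ck_on_cos = Ck_on_compose[OF _ open_UNIV subset_UNIV Ck_on_cos_sin(1)]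
  and Ck_on_sin = Ck_on_compose[OF _ open_UNIV subset_UNIV Ck_on_cos_sin(2)]

section \<open>Smooth maps between subsets of Euclidean spaces\<close>

lemma smooth_map_onI:
  assumes "open U" "M \<subseteq> U" "\<And>k. Ck_on k f U"
  shows "smooth_map_on M f"
  unfolding smooth_map_on_def using assms by blast

lemma smooth_map_on_cong:
  "smooth_map_on M f \<Longrightarrow> (\<And>x. x \<in> M \<Longrightarrow> f x = g x) \<Longrightarrow> smooth_map_on M g"
  unfolding smooth_map_on_def by (fastforce simp: Ball_def)

lemma smooth_map_on_extension:
  assumes "smooth_map_on M f" "x \<in> M"
  obtains U h where "open U" "x \<in> U" "\<And>k. Ck_on k h U" "\<And>y. y \<in> M \<Longrightarrow> y \<in> U \<Longrightarrow> f y = h y"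
  using bspec[OF assms(1)[unfolded smooth_map_on_def] assms(2)] IntI by metis

lemma smooth_map_on_compose:
  assumes f: "smooth_map_on M f" and g: "smooth_map_on N g" and MN: "f ` M \<subseteq> N"
  shows "smooth_map_on M (\<lambda>x. g (f x))"
  unfolding smooth_map_on_def
proof
  fix x assume x: "x \<in> M"
  then have fx: "f x \<in> N" using MN by (rule subsetD[OF _ imageI, rotated])
  obtain U h where U: "open U" "x \<in> U" "\<And>k. Ck_on k h U" "\<And>y. y \<in> M \<Longrightarrow> y \<in> U \<Longrightarrow> f y = h y"
    using smooth_map_on_extension[OF f x] by blast
  obtain V l where V: "open V" "f x \<in> V" "\<And>k. Ck_on k l V" "\<And>y. y \<in> N \<Longrightarrow> y \<in> V \<Longrightarrow> g y = l y"
    using smooth_map_on_extension[OF g fx] by blast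
  have "continuous_on U h" by (rule Ck_on_imp_continuous_on[OF U(3)])
  then have o: "open (U \<inter> h -` V)" using U(1) V(1) by (rule continuous_open_preimage)
  have c: "Ck_on k (\<lambda>y. l (h y)) (U \<inter> h -` V)" for k
    by (rule Ck_on_compose[OF o V(1) _ V(3) Ck_on_subset[OF U(3)]]) blast+
  show "\<exists>U h. open U \<and> x \<in> U \<and> (\<forall>k. Ck_on k h U) \<and> (\<forall>y\<in>M \<inter> U. g (f y) = h y)"
  proof (intro exI conjI allI ballI)
    show "open (U \<inter> h -` V)" "Ck_on k (\<lambda>y. l (h y)) (U \<inter> h -` V)" for k by (fact o c)+
    show "x \<in> U \<inter> h -` V" using U(2) V(2) U(4)[OF x U(2)] by simp
    fix y assume y: "y \<in> M \<inter> (U \<inter> h -` V)"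
    then have "f y = h y" "f y \<in> N" "f y \<in> V" using U(4)[of y] MN by auto
    then show "g (f y) = l (h y)" using V(4)[of "f y"] by simp
  qed
qed

lemma diffeomorphism_onI:
  assumes "smooth_map_on M f" "smooth_map_on N g" "f ` M \<subseteq> N" "g ` N \<subseteq> M"
    "\<And>x. x \<in> M \<Longrightarrow> g (f x) = x" "\<And>y. y \<in> N \<Longrightarrow> f (g y) = y"
  shows "diffeomorphism_on M N f"
proof -
  have b: "bij_betw f M N" by (rule bij_betw_byWitness[where f' = g]) (use assms in auto)
  have "inv_into M f y = g y" if "y \<in> N" for y
  proof (rule inv_into_f_eq)
    show "inj_on f M" using b by (simp add: bij_betw_def)
    show "g y \<in> M" "f (g y) = y" using assms(4,6) that by auto
  qed
  then have "smooth_map_on N (inv_into M f)"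
    by (intro smooth_map_on_cong[OF assms(2)]) simp
  then show ?thesis unfolding diffeomorphism_on_def using b assms(1) by blast
qed

lemma diffeomorphism_on_inv:
  assumes "diffeomorphism_on M N f" shows "diffeomorphism_on N M (inv_into M f)"
proof (rule diffeomorphism_onI[of _ _ _ f])
  have b: "bij_betw f M N" using assms by (simp add: diffeomorphism_on_def)
  show "inv_into M f ` N \<subseteq> M" "f ` M \<subseteq> N"
    using b bij_betw_inv_into[OF b] by (simp_all add: bij_betw_def)
  show "f (inv_into M f x) = x" if "x \<in> N" for x
    by (rule bij_betw_inv_into_right[OF b that])
  show "inv_into M f (f y) = y" if "y \<in> M" for y
    by (rule bij_betw_inv_into_left[OF b that])
  show "smooth_map_on N (inv_into M f)" "smooth_map_on M f"
    using assms by (simp_all add: diffeomorphism_on_def)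
qed

lemma diffeomorphism_on_compose:
  assumes "diffeomorphism_on M N f" "diffeomorphism_on N P g"
  shows "diffeomorphism_on M P (\<lambda>x. g (f x))"
proof -
  have b: "bij_betw f M N" "bij_betw g N P"
    and sm: "smooth_map_on M f" "smooth_map_on N g"
      "smooth_map_on N (inv_into M f)" "smooth_map_on P (inv_into N g)"
    using assms unfolding diffeomorphism_on_def by blast+
  have img: "f ` M \<subseteq> N" "g ` N \<subseteq> P" "inv_into M f ` N \<subseteq> M" "inv_into N g ` P \<subseteq> N"
    using b b[THEN bij_betw_inv_into] by (simp_all add: bij_betw_def)
  note inv = bij_betw_inv_into_left[OF b(1)] bij_betw_inv_into_right[OF b(1)]
    bij_betw_inv_into_left[OF b(2)] bij_betw_inv_into_right[OF b(2)]
  show ?thesis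
  proof (rule diffeomorphism_onI)
    show "smooth_map_on M (\<lambda>x. g (f x))" "smooth_map_on P (\<lambda>x. inv_into M f (inv_into N g x))"
      by (rule smooth_map_on_compose[OF sm(1,2) img(1)], rule smooth_map_on_compose[OF sm(4,3) img(4)])
    show "(\<lambda>x. g (f x)) ` M \<subseteq> P" "(\<lambda>x. inv_into M f (inv_into N g x)) ` P \<subseteq> M"
      using img by (simp_all add: image_subset_iff)
    show "inv_into M f (inv_into N g (g (f x))) = x" if "x \<in> M" for x
      using img that inv by (simp add: image_subset_iff)
    show "g (f (inv_into M f (inv_into N g y))) = y" if "y \<in> P" for y
      using img that inv by (simp add: image_subset_iff)
  qed
qed

lemma lie_iso_inv:
  assumes "group G" "lie_iso G H \<phi>"
  shows "lie_iso H G (inv_into (carrier G) \<phi>)"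
  using assms group.iso_set_sym[OF assms(1)] diffeomorphism_on_inv unfolding lie_iso_def by metis

lemma lie_iso_compose:
  assumes "lie_iso G H \<phi>" "lie_iso H K \<psi>"
  shows "lie_iso G K (\<lambda>x. \<psi> (\<phi> x))"
  using iso_set_trans[of \<phi> G H \<psi> K] diffeomorphism_on_compose assms
  unfolding lie_iso_def comp_def by blast

lemma equivalent_actions_sym:
  assumes "group L" and closed: "\<And>g m. g \<in> carrier L \<Longrightarrow> m \<in> M \<Longrightarrow> act g m \<in> M"
    and "equivalent_actions L M act L' M' act'"
  shows "equivalent_actions L' M' act' L M act"
proof -
  obtain \<phi> F where h: "lie_iso L L' \<phi>" "diffeomorphism_on M M' F"
    "\<And>g m. g \<in> carrier L \<Longrightarrow> m \<in> M \<Longrightarrow> F (act g m) = act' (\<phi> g) (F m)"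
    using assms(3) unfolding equivalent_actions_def by blast
  have b: "bij_betw F M M'" "bij_betw \<phi> (carrier L) (carrier L')"
    using h(1,2) by (auto simp: lie_iso_def diffeomorphism_on_def)
  have "inv_into M F (act' g m) = act (inv_into (carrier L) \<phi> g) (inv_into M F m)"
    if "g \<in> carrier L'" "m \<in> M'" for g m
  proof -
    have i: "inv_into (carrier L) \<phi> g \<in> carrier L" "inv_into M F m \<in> M"
      using b that by (auto simp: bij_betw_def inv_into_into)
    have "F (act (inv_into (carrier L) \<phi> g) (inv_into M F m)) = act' g m"
      using h(3)[OF i] b that by (simp add: bij_betw_inv_into_right)
    then show ?thesis using bij_betw_inv_into_left[OF b(1) closed[OF i]] by simp
  qed
  then show ?thesis unfolding equivalent_actions_def
    using lie_iso_inv[OF assms(1) h(1)] diffeomorphism_on_inv[OF h(2)] by blast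
qed

lemma equivalent_actions_trans:
  assumes "equivalent_actions L M act L' M' act'" "equivalent_actions L' M' act' L'' M'' act''"
  shows "equivalent_actions L M act L'' M'' act''"
proof -
  obtain \<phi> F where h: "lie_iso L L' \<phi>" "diffeomorphism_on M M' F"
    "\<And>g m. g \<in> carrier L \<Longrightarrow> m \<in> M \<Longrightarrow> F (act g m) = act' (\<phi> g) (F m)"
    using assms(1) unfolding equivalent_actions_def by blast
  obtain \<psi> G where k: "lie_iso L' L'' \<psi>" "diffeomorphism_on M' M'' G"
    "\<And>g m. g \<in> carrier L' \<Longrightarrow> m \<in> M' \<Longrightarrow> G (act' g m) = act'' (\<psi> g) (G m)"
    using assms(2) unfolding equivalent_actions_def by blast
  have "\<phi> g \<in> carrier L'" "F m \<in> M'" if "g \<in> carrier L" "m \<in> M" for g m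
    using that h(1,2) by (auto simp: lie_iso_def diffeomorphism_on_def bij_betw_def)
  then have "G (F (act g m)) = act'' (\<psi> (\<phi> g)) (G (F m))" if "g \<in> carrier L" "m \<in> M" for g m
    using that h(3) k(3) by simp
  then show ?thesis unfolding equivalent_actions_def
    using lie_iso_compose[OF h(1) k(1)] diffeomorphism_on_compose[OF h(2) k(2)] by blast
qed

section \<open>Integrals depending on a parameter, and mixed partial derivatives\<close>

lemma Ck_on_frechet_derivative:
  "Ck_on (Suc k) f U \<Longrightarrow> Ck_on k (\<lambda>x. frechet_derivative f (at x) v) U"
  by simp

lemma integral_parameter_has_derivative:
  fixes f :: "'a::euclidean_space \<times> real \<Rightarrow> 'c::euclidean_space"
  assumes f: "Ck_on (Suc 0) f UNIV"
  shows "((\<lambda>x. integral {a..b} (\<lambda>y. f (x, y))) has_derivative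
    (\<lambda>v. integral {a..b} (\<lambda>y. frechet_derivative f (at (x, y)) (v, 0)))) (at x)"
proof -
  define f' where "f' = (\<lambda>x y. Blinfun (\<lambda>v. frechet_derivative f (at (x, y)) (v, 0)))"
  have der: "(f has_derivative frechet_derivative f (at z)) (at z)" for z
    by (rule Ck_on_Suc_has_derivative[OF f]) simp
  have bl: "bounded_linear (\<lambda>v. frechet_derivative f (at (x, y)) (v, 0))" for x y
    by (rule bounded_linear_compose[OF has_derivative_bounded_linear[OF der]])
      (auto intro!: bounded_linear_intros)
  have app': "blinfun_apply (f' x y) = (\<lambda>v. frechet_derivative f (at (x, y)) (v, 0))" for x y
    unfolding f'_def by (rule bounded_linear_Blinfun_apply[OF bl])
  have app: "blinfun_apply (f' x y) v = frechet_derivative f (at (x, y)) (v, 0)" for x y v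
    by (simp only: app')
  have cont': "continuous_on UNIV (\<lambda>z. frechet_derivative f (at z) v)" for v
    using Ck_on_frechet_derivative[OF f] by simp
  have cont: "continuous_on UNIV (\<lambda>z. f' (fst z) (snd z))"
    by (rule continuous_on_blinfun_componentwise) (simp add: app cont')
  have contf: "continuous_on UNIV f"
    by (rule Ck_on_imp_continuous_on[OF f])
  have int: "(\<lambda>y. f (x, y)) integrable_on cbox a b" for x
    by (intro integrable_continuous continuous_on_compose2[OF contf]) (auto intro!: continuous_intros)
  have "((\<lambda>x. integral (cbox a b) (\<lambda>y. f (x, y))) has_derivative integral (cbox a b) (f' x)) (at x within UNIV)"
  proof (rule leibniz_rule[OF _ int])
    show "((\<lambda>x. f (x, t)) has_derivative blinfun_apply (f' x t)) (at x within UNIV)" for x t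
    proof -
      have "((\<lambda>x. f (x, t)) has_derivative (\<lambda>v. frechet_derivative f (at (x, t)) (v, 0))) (at x)"
        by (rule has_derivative_compose[OF _ der]) (auto intro!: derivative_eq_intros)
      then show ?thesis by (simp only: app')
    qed
    show "continuous_on (UNIV \<times> cbox a b) (\<lambda>(x, t). f' x t)"
      using continuous_on_subset[OF cont] by (simp add: case_prod_unfold)
  qed auto
  moreover have "blinfun_apply (integral (cbox a b) (f' x)) v =
      integral (cbox a b) (\<lambda>y. frechet_derivative f (at (x, y)) (v, 0))" for v
  proof -
    have "f' x integrable_on cbox a b"
      by (intro integrable_continuous continuous_on_compose2[OF cont, of _ "\<lambda>y. (x, y)", simplified])
        (auto intro!: continuous_intros)
    then show ?thesis by (subst blinfun_apply_integral) (simp_all add: app)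
  qed
  then have "blinfun_apply (integral (cbox a b) (f' x)) =
      (\<lambda>v. integral (cbox a b) (\<lambda>y. frechet_derivative f (at (x, y)) (v, 0)))" by (rule ext)
  ultimately show ?thesis by simp
qed

lemma integral_parameter_frechet_derivative:
  fixes f :: "'a::euclidean_space \<times> real \<Rightarrow> 'c::euclidean_space"
  assumes "Ck_on (Suc 0) f UNIV"
  shows "frechet_derivative (\<lambda>x. integral {a..b} (\<lambda>y. f (x, y))) (at x) v =
    integral {a..b} (\<lambda>y. frechet_derivative f (at (x, y)) (v, 0))"
  using frechet_derivative_at[OF integral_parameter_has_derivative[OF assms]] by metis

lemma integral_parameter_Ck1:
  fixes f :: "'a::euclidean_space \<times> real \<Rightarrow> 'c::euclidean_space"
  assumes f: "Ck_on (Suc 0) f UNIV"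
  shows "Ck_on (Suc 0) (\<lambda>x. integral {a..b} (\<lambda>y. f (x, y))) UNIV"
proof (rule Ck_on_SucI'[OF open_UNIV integral_parameter_has_derivative[OF f]])
  fix v
  have "continuous_on UNIV (\<lambda>z. frechet_derivative f (at z) (v, 0))"
    using Ck_on_frechet_derivative[OF f] by simp
  then have "continuous_on (UNIV \<times> cbox a b) (\<lambda>(x, y). frechet_derivative f (at (x, y)) (v, 0))"
    by (auto simp: case_prod_unfold intro: continuous_on_subset)
  then show "Ck_on 0 (\<lambda>x. integral {a..b} (\<lambda>y. frechet_derivative f (at (x, y)) (v, 0))) UNIV"
    using integral_continuous_on_param by fastforce
qed

lemma frechet_derivative_along_line:
  assumes "Ck_on (Suc k) f UNIV"
  shows "((\<lambda>s. f (x + s *\<^sub>R v)) has_vector_derivative frechet_derivative f (at (x + s *\<^sub>R v)) v) (at s within S)"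
proof -
  have f: "(f has_derivative frechet_derivative f (at (x + s *\<^sub>R v))) (at (x + s *\<^sub>R v))"
    by (rule Ck_on_Suc_has_derivative[OF assms]) simp
  interpret bounded_linear "frechet_derivative f (at (x + s *\<^sub>R v))"
    by (rule has_derivative_bounded_linear[OF f])
  have "((\<lambda>s. f (x + s *\<^sub>R v)) has_derivative (\<lambda>h. frechet_derivative f (at (x + s *\<^sub>R v)) (h *\<^sub>R v))) (at s within S)"
    by (rule has_derivative_compose[where f = "\<lambda>s. x + s *\<^sub>R v", OF _ f]) (auto intro!: derivative_eq_intros)
  then show ?thesis by (simp add: has_vector_derivative_def scaleR)
qed

text \<open>Symmetry of second derivatives: differentiate
  \<open>f(x + s u + t v) - f(x + s u) = \<integral>\<^sub>0\<^sup>t D f(x + s u + \<tau> v) v d\<tau>\<close>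
  first in \<open>s\<close>, under the integral sign, and then in \<open>t\<close>.\<close>

lemma frechet_derivative_commute:
  fixes f :: "'a::euclidean_space \<Rightarrow> 'b::euclidean_space"
  assumes f: "Ck_on (Suc (Suc 0)) f UNIV"
  shows "frechet_derivative (\<lambda>y. frechet_derivative f (at y) u) (at x) v =
         frechet_derivative (\<lambda>y. frechet_derivative f (at y) v) (at x) u"
proof -
  let ?fu = "\<lambda>y. frechet_derivative f (at y) u" and ?fv = "\<lambda>y. frechet_derivative f (at y) v"
  have C: "Ck_on (Suc 0) ?fu UNIV" "Ck_on (Suc 0) ?fv UNIV" "Ck_on (Suc 0) f UNIV"
    using f Ck_on_SucD[OF f] by simp_all
  define p :: "real \<times> real \<Rightarrow> 'a" where "p = (\<lambda>z. fst z *\<^sub>R u + snd z *\<^sub>R v)"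
  have pl: "bounded_linear p" unfolding p_def by (intro bounded_linear_intros)
  have Cp: "Ck_on (Suc 0) (\<lambda>z. ?fv (x + p z)) UNIV"
    by (rule Ck_on_compose[OF open_UNIV open_UNIV _ C(2)])
      (rule subset_UNIV, intro Ck_on_add Ck_on_const Ck_on_linear pl open_UNIV)
  have Dp: "frechet_derivative (\<lambda>z. ?fv (x + p z)) (at z) (1, 0) = frechet_derivative ?fv (at (x + p z)) u" for z
  proof -
    have "((\<lambda>z. ?fv (x + p z)) has_derivative (\<lambda>h. frechet_derivative ?fv (at (x + p z)) (p h))) (at z)"
      by (rule has_derivative_compose[OF _ Ck_on_Suc_has_derivative[OF C(2)]])
        (auto intro!: derivative_eq_intros bounded_linear_imp_has_derivative pl)
    from frechet_derivative_at[OF this] have "frechet_derivative (\<lambda>z. ?fv (x + p z)) (at z) (1, 0) = frechet_derivative ?fv (at (x + p z)) (p (1, 0))"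
      by (rule fun_cong[OF sym])
    also have "p (1, 0) = u" by (simp add: p_def)
    finally show ?thesis .
  qed
  have key: "?fu (x + t *\<^sub>R v) - ?fu x = integral {0..t} (\<lambda>\<tau>. frechet_derivative ?fv (at (x + \<tau> *\<^sub>R v)) u)"
    if t: "0 \<le> t" for t
  proof -
    have "integral {0..t} (\<lambda>\<tau>. ?fv (x + p (s, \<tau>))) = f (x + s *\<^sub>R u + t *\<^sub>R v) - f (x + s *\<^sub>R u)" for s
    proof -
      have "((\<lambda>\<tau>. ?fv (x + s *\<^sub>R u + \<tau> *\<^sub>R v)) has_integral
          f (x + s *\<^sub>R u + t *\<^sub>R v) - f (x + s *\<^sub>R u + 0 *\<^sub>R v)) {0..t}"
        by (rule fundamental_theorem_of_calculus[OF t frechet_derivative_along_line[OF C(3)]])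
      then show ?thesis by (simp add: p_def integral_unique add.assoc)
    qed
    then have "((\<lambda>s. f (x + s *\<^sub>R u + t *\<^sub>R v) - f (x + s *\<^sub>R u)) has_derivative
        (\<lambda>h. integral {0..t} (\<lambda>y. frechet_derivative (\<lambda>z. ?fv (x + p z)) (at (0, y)) (h, 0)))) (at 0)"
      using integral_parameter_has_derivative[OF Cp, of 0 t 0] by simp
    moreover have "((\<lambda>s. f (x + s *\<^sub>R u + t *\<^sub>R v) - f (x + s *\<^sub>R u)) has_vector_derivative
        ?fu (x + t *\<^sub>R v) - ?fu x) (at 0)"
      using has_vector_derivative_diff[OF frechet_derivative_along_line[OF C(3), of "x + t *\<^sub>R v" u 0]
          frechet_derivative_along_line[OF C(3), of x u 0]]
      by (simp add: ac_simps)
    ultimately have "(\<lambda>h. h *\<^sub>R (?fu (x + t *\<^sub>R v) - ?fu x)) =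
        (\<lambda>h. integral {0..t} (\<lambda>y. frechet_derivative (\<lambda>z. ?fv (x + p z)) (at (0, y)) (h, 0)))"
      using has_derivative_unique unfolding has_vector_derivative_def by blast
    from fun_cong[OF this, of 1] show ?thesis by (simp add: Dp) (simp add: p_def)
  qed
  have "((\<lambda>t. ?fu (x + t *\<^sub>R v) - ?fu x) has_vector_derivative frechet_derivative ?fu (at x) v) (at 0 within {0..1})"
    using has_vector_derivative_diff[OF frechet_derivative_along_line[OF C(1), of x v 0 "{0..1}"] has_vector_derivative_const[of "?fu x"]]
    by simp
  moreover have "((\<lambda>t. integral {0..t} (\<lambda>\<tau>. frechet_derivative ?fv (at (x + \<tau> *\<^sub>R v)) u)) has_vector_derivative
      frechet_derivative ?fv (at (x + 0 *\<^sub>R v)) u) (at 0 within {0..1})"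
  proof (rule integral_has_vector_derivative)
    have "continuous_on UNIV (\<lambda>y. frechet_derivative ?fv (at y) u)" using C(2) by simp
    then show "continuous_on {0..1} (\<lambda>\<tau>. frechet_derivative ?fv (at (x + \<tau> *\<^sub>R v)) u)"
      by (rule continuous_on_compose2) (auto intro!: continuous_intros)
  qed simp
  then have "((\<lambda>t. ?fu (x + t *\<^sub>R v) - ?fu x) has_vector_derivative
      frechet_derivative ?fv (at x) u) (at 0 within {0..1})"
    using has_vector_derivative_transform[of 0 "{0..1}" "\<lambda>t. ?fu (x + t *\<^sub>R v) - ?fu x"] key by auto
  ultimately show ?thesis
    by (rule vector_derivative_unique_within[rotated]) (simp add: trivial_limit_within islimpt_Icc)
qed

lemma frechet_derivative_translation:
  assumes "\<And>x. f (x + p) = f x" "f differentiable (at x)"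
  shows "frechet_derivative f (at (x + p)) = frechet_derivative f (at x)"
proof -
  have "((\<lambda>y. y - p) has_derivative (\<lambda>h. h)) (at (x + p))"
    by (auto intro!: derivative_eq_intros)
  then have "((\<lambda>y. f (y - p)) has_derivative frechet_derivative f (at x)) (at (x + p))"
    using has_derivative_compose[of "\<lambda>y. y - p" "\<lambda>h. h" "x + p" UNIV f "frechet_derivative f (at x)"]
      assms(2) by (simp add: frechet_derivative_works)
  moreover have "f (y - p) = f y" for y using assms(1)[of "y - p"] by simp
  ultimately have "(f has_derivative frechet_derivative f (at x)) (at (x + p))" by simp
  from frechet_derivative_at[OF this] show ?thesis by (rule sym)
qed

lemma frechet_derivative_constant_direction:
  assumes "\<And>s. f (x + s *\<^sub>R v) = f x" "Ck_on (Suc k) f UNIV"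
  shows "frechet_derivative f (at x) v = 0"
proof -
  have "((\<lambda>s. f x) has_vector_derivative frechet_derivative f (at x) v) (at 0)"
    using frechet_derivative_along_line[OF assms(2), of x v 0 UNIV] assms(1) by simp
  then show ?thesis using vector_derivative_unique_at has_vector_derivative_const by blast
qed

section \<open>The closed 3-form of a map into the general linear group\<close>

lemma bounded_bilinear_matrix_mult:
  "bounded_bilinear ((**) :: real^'n^'m \<Rightarrow> real^'p^'n \<Rightarrow> real^'p^'m)"
  unfolding bilinear_conv_bounded_bilinear[symmetric] bilinear_def
  by (auto intro!: linearI simp: vec_eq_iff matrix_matrix_mult_def sum.distrib sum_distrib_left algebra_simps)

lemma bounded_linear_trace: "bounded_linear (trace :: real^'n^'n \<Rightarrow> real)"
  unfolding linear_conv_bounded_linear[symmetric]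
  by (auto intro!: linearI simp: trace_def sum.distrib sum_distrib_left)

lemmas matrix_mult_linear =
    bounded_bilinear.zero_left[OF bounded_bilinear_matrix_mult]
    bounded_bilinear.zero_right[OF bounded_bilinear_matrix_mult]
    bounded_bilinear.add_left[OF bounded_bilinear_matrix_mult]
    bounded_bilinear.add_right[OF bounded_bilinear_matrix_mult]
    bounded_bilinear.diff_left[OF bounded_bilinear_matrix_mult]
    bounded_bilinear.diff_right[OF bounded_bilinear_matrix_mult]
    bounded_bilinear.minus_left[OF bounded_bilinear_matrix_mult]
    bounded_bilinear.minus_right[OF bounded_bilinear_matrix_mult]
  and trace_linear =
    linear_0[OF bounded_linear.linear[OF bounded_linear_trace]]
    linear_add[OF bounded_linear.linear[OF bounded_linear_trace]]
    linear_diff[OF bounded_linear.linear[OF bounded_linear_trace]]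
    linear_neg[OF bounded_linear.linear[OF bounded_linear_trace]]
  and matrix_mult_has_derivative = bounded_bilinear.FDERIV[OF bounded_bilinear_matrix_mult]

definition trace3 :: "real^'n^'n \<Rightarrow> real^'n^'n \<Rightarrow> real^'n^'n \<Rightarrow> real" where
  "trace3 a b c = trace (a ** b ** c) - trace (a ** c ** b)"

lemma trace_cyclic3: "trace ((a ** b) ** c) = trace ((c ** a) ** (b :: real^'n^'n))"
  by (metis matrix_mul_assoc trace_mul_sym)

lemma trace_cyclic4: "trace (((a ** b) ** c) ** d) = trace (((d ** a) ** b) ** (c :: real^'n^'n))"
  by (metis matrix_mul_assoc trace_mul_sym)

lemma trace3_swap: "trace3 a c b = - trace3 a b c"
  by (simp add: trace3_def)

lemma trace3_rotate: "trace3 b c a = trace3 a b (c :: real^'n^'n)"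
  unfolding trace3_def using trace_cyclic3[of b c a] trace_cyclic3[of b a c] trace_cyclic3[of a c b] by simp

lemma trace3_zero: "trace3 0 b c = 0" "trace3 a 0 c = 0" "trace3 a b 0 = 0" "trace3 a b b = 0"
  by (simp_all add: trace3_def matrix_mult_linear trace_linear)

lemma trace3_diff: "trace3 (x - y) b c = trace3 x b c - trace3 y b (c :: real^'n^'n)"
  by (simp add: trace3_def matrix_mult_linear trace_linear)

text \<open>The matrices \<open>s\<^sub>a\<^sub>b - a b\<close> stand for the derivative of the \<open>b\<close>-component of \<open>k dg\<close> in
  direction \<open>a\<close>.  The symmetric part \<open>s\<close> cancels because \<open>trace3\<close> is alternating, and the quartic
  part because a cyclic rotation of four letters is an odd permutation.\<close>

lemma trace3_closed:
  fixes a b c d :: "real^'n^'n"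
  shows "(trace3 (ab - a ** b) c d + trace3 b (ac - a ** c) d + trace3 b c (ad - a ** d))
       - (trace3 (ab - b ** a) c d + trace3 a (bc - b ** c) d + trace3 a c (bd - b ** d))
       + (trace3 (ac - c ** a) b d + trace3 a (bc - c ** b) d + trace3 a b (cd - c ** d))
       - (trace3 (ad - d ** a) b c + trace3 a (bd - d ** b) c + trace3 a b (cd - d ** c)) = 0"
proof -
  have s: "trace3 y x z = - trace3 x y z" "trace3 y z x = trace3 x y z" for x y z :: "real^'n^'n"
    by (metis trace3_rotate trace3_swap)+
  have q: "trace (x ** y ** z ** a) = trace (a ** x ** y ** z)" for x y z :: "real^'n^'n"
    by (rule trace_cyclic4)
  have q2: "trace (x ** y ** a ** z) = trace (a ** z ** x ** y)" for x y z :: "real^'n^'n"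
    using trace_cyclic4[of x y a z] trace_cyclic4[of z x y a] by simp
  have q3: "trace (x ** a ** y ** z) = trace (a ** y ** z ** x)" for x y z :: "real^'n^'n"
    using trace_cyclic4[of a y z x] by simp
  show ?thesis
    unfolding s(1)[of b "ac - a ** c" d] s(2)[of b c "ad - a ** d"] s(1)[of a "bc - b ** c" d]
      s(2)[of a c "bd - b ** d"] s(1)[of a "bc - c ** b" d] s(2)[of a b "cd - c ** d"]
      s(1)[of a "bd - d ** b" c] s(2)[of a b "cd - d ** c"] trace3_diff
    unfolding trace3_def matrix_mul_assoc q q2 q3 by linarith
qed

text \<open>For a smooth \<open>g\<close> with values in the general linear group and \<open>k = g\<inverse>\<close> these are the components
  of the matrix-valued form \<open>g\<inverse> dg\<close>.\<close>

definition left_form :: "('e::euclidean_space \<Rightarrow> real^'n^'n) \<Rightarrow> ('e \<Rightarrow> real^'n^'n) \<Rightarrow> 'e \<Rightarrow> 'e \<Rightarrow> real^'n^'n" where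
  "left_form g k v x = k x ** frechet_derivative g (at x) v"

definition trace_form :: "('e::euclidean_space \<Rightarrow> real^'n^'n) \<Rightarrow> ('e \<Rightarrow> real^'n^'n) \<Rightarrow> 'e \<Rightarrow> 'e \<Rightarrow> 'e \<Rightarrow> 'e \<Rightarrow> real" where
  "trace_form g k u v w x = trace3 (left_form g k u x) (left_form g k v x) (left_form g k w x)"

text \<open>A primitive of the contraction of \<open>trace_form\<close> with a vector field along which the derivative of
  \<open>g\<close> is \<open>D' g - g D\<close>, that is, along which \<open>g\<inverse> dg\<close> is \<open>g\<inverse> D' g - D\<close>.\<close>

definition boundary_form :: "real^'n^'n \<Rightarrow> real^'n^'n \<Rightarrow> ('e::euclidean_space \<Rightarrow> real^'n^'n) \<Rightarrow> ('e \<Rightarrow> real^'n^'n) \<Rightarrow> 'e \<Rightarrow> 'e \<Rightarrow> real" where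
  "boundary_form D D' g k v x =
     trace (D' ** (frechet_derivative g (at x) v ** k x)) + trace (D ** left_form g k v x)"

context
  fixes g k :: "'e::euclidean_space \<Rightarrow> real^'n^'n"
  assumes g2: "Ck_on (Suc (Suc 0)) g UNIV" and k2: "Ck_on (Suc (Suc 0)) k UNIV"
    and gk: "\<And>x. g x ** k x = mat 1" and kg: "\<And>x. k x ** g x = mat 1"
begin

private abbreviation partial_derivative :: "('e \<Rightarrow> 'b) \<Rightarrow> 'e \<Rightarrow> 'e \<Rightarrow> 'b::real_normed_vector" ("\<partial>") where
  "\<partial> f v x \<equiv> frechet_derivative f (at x) v"

private lemma Ck1:
  "Ck_on (Suc 0) g UNIV" "Ck_on (Suc 0) k UNIV" "Ck_on (Suc 0) (\<partial> g v) UNIV"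
  by (fact Ck_on_SucD[OF g2] Ck_on_SucD[OF k2] Ck_on_frechet_derivative[OF g2])+

private lemma der:
  "(g has_derivative (\<lambda>v. \<partial> g v x)) (at x)" "(k has_derivative (\<lambda>v. \<partial> k v x)) (at x)"
  "(\<partial> g u has_derivative (\<lambda>v. \<partial> (\<partial> g u) v x)) (at x)"
  by (rule Ck1[THEN Ck_on_Suc_has_derivative]; simp)+

private lemma derivative_inverse: "\<partial> k v x = - (left_form g k v x ** k x)"
proof -
  have "((\<lambda>x. k x ** g x) has_derivative (\<lambda>v. k x ** \<partial> g v x + \<partial> k v x ** g x)) (at x)"
    by (rule matrix_mult_has_derivative[OF der(2,1)])
  moreover have "((\<lambda>x. k x ** g x) has_derivative (\<lambda>v. 0)) (at x)"
    unfolding kg by (rule has_derivative_const)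
  ultimately have "k x ** \<partial> g v x + \<partial> k v x ** g x = 0"
    using has_derivative_unique by (metis (no_types, lifting))
  then have "(k x ** \<partial> g v x + \<partial> k v x ** g x) ** k x = 0"
    by (simp add: matrix_mult_linear)
  then have "k x ** \<partial> g v x ** k x + \<partial> k v x = 0"
    by (simp add: matrix_mult_linear matrix_mul_assoc[symmetric] gk)
  then show ?thesis by (simp add: left_form_def add_eq_0_iff)
qed

lemma Ck1_left_form: "Ck_on (Suc 0) (left_form g k v) UNIV"
  unfolding left_form_def[abs_def] by (intro Ck_on_bilinear[OF bounded_bilinear_matrix_mult] Ck1 open_UNIV)

lemma Ck1_trace_form: "Ck_on (Suc 0) (trace_form g k u v w) UNIV"
proof -
  have "Ck_on (Suc 0) (\<lambda>x. trace3 (left_form g k u x) (left_form g k v x) (left_form g k w x)) UNIV"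
    unfolding trace3_def diff_conv_add_uminus
    by (intro Ck_on_add Ck_on_linear_compose[OF bounded_linear_trace]
        Ck_on_linear_compose[OF bounded_linear_minus[OF bounded_linear_trace]]
        Ck_on_bilinear[OF bounded_bilinear_matrix_mult] Ck1_left_form open_UNIV)
  then show ?thesis by (simp only: trace_form_def[abs_def])
qed

lemma Ck1_boundary_form: "Ck_on (Suc 0) (boundary_form D D' g k v) UNIV"
  unfolding boundary_form_def[abs_def]
  by (intro Ck_on_add Ck_on_linear_compose[OF bounded_linear_trace]
      Ck_on_bilinear[OF bounded_bilinear_matrix_mult] Ck_on_const Ck1 Ck1_left_form open_UNIV)

private lemma left_form_has_derivative:
  "(left_form g k v has_derivative
     (\<lambda>u. k x ** \<partial> (\<partial> g v) u x - left_form g k u x ** left_form g k v x)) (at x)"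
proof -
  have "(left_form g k v has_derivative
     (\<lambda>u. k x ** \<partial> (\<partial> g v) u x + \<partial> k u x ** \<partial> g v x)) (at x)"
    unfolding left_form_def[abs_def] by (rule matrix_mult_has_derivative[OF der(2,3)])
  moreover have "\<partial> k u x ** \<partial> g v x = - (left_form g k u x ** left_form g k v x)" for u
    by (simp add: derivative_inverse left_form_def matrix_mult_linear matrix_mul_assoc)
  ultimately show ?thesis by simp
qed

private lemma trace_form_derivative:
  fixes u v w z
  defines "F \<equiv> \<lambda>u v x. k x ** \<partial> (\<partial> g v) u x - left_form g k u x ** left_form g k v x"
    and "A \<equiv> left_form g k"
  shows "\<partial> (trace_form g k u v w) z x =
    trace3 (F z u x) (A v x) (A w x) + trace3 (A u x) (F z v x) (A w x) + trace3 (A u x) (A v x) (F z w x)"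
proof -
  have dA: "(A v has_derivative (\<lambda>z. F z v x)) (at x)" for v
    unfolding A_def F_def by (rule left_form_has_derivative)
  have *: "((\<lambda>x. trace (A u x ** A v x ** A w x)) has_derivative
     (\<lambda>z. trace (A u x ** A v x ** F z w x + (A u x ** F z v x + F z u x ** A v x) ** A w x))) (at x)" for u v w
    by (intro bounded_linear.has_derivative[OF bounded_linear_trace] matrix_mult_has_derivative dA)
  have "(trace_form g k u v w has_derivative (\<lambda>z. trace3 (F z u x) (A v x) (A w x)
      + trace3 (A u x) (F z v x) (A w x) + trace3 (A u x) (A v x) (F z w x))) (at x)"
    unfolding trace_form_def[abs_def] trace3_def A_def[symmetric]
    by (rule has_derivative_eq_rhs[OF has_derivative_diff[OF * *]])
      (auto simp: fun_eq_iff matrix_mult_linear trace_linear)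
  from fun_cong[OF frechet_derivative_at[OF this], of z] show ?thesis by simp
qed

text \<open>Closedness of \<open>trace ((g\<inverse> dg)\<^sup>3)\<close>: the second derivatives of \<open>g\<close> are symmetric, so the derivatives of
  \<open>left_form\<close> have the shape that \<open>trace3_closed\<close> requires.\<close>

lemma trace_form_closed:
  "\<partial> (trace_form g k b c d) a x - \<partial> (trace_form g k a c d) b x
   + \<partial> (trace_form g k a b d) c x - \<partial> (trace_form g k a b c) d x = 0"
  unfolding trace_form_derivative
    frechet_derivative_commute[OF g2, of a x b] frechet_derivative_commute[OF g2, of a x c]
    frechet_derivative_commute[OF g2, of a x d] frechet_derivative_commute[OF g2, of b x c]
    frechet_derivative_commute[OF g2, of b x d] frechet_derivative_commute[OF g2, of c x d]
  by (rule trace3_closed)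

lemma boundary_form_derivative:
  "\<partial> (boundary_form D D' g k c) b x - \<partial> (boundary_form D D' g k b) c x =
   trace3 (k x ** D' ** g x - D) (left_form g k b x) (left_form g k c x)"
proof -
  let ?A = "\<lambda>v. left_form g k v x"
  have d: "\<partial> (boundary_form D D' g k v) u x =
      trace (D' ** (\<partial> g v x ** \<partial> k u x + \<partial> (\<partial> g v) u x ** k x))
      + trace (D ** (k x ** \<partial> (\<partial> g v) u x - ?A u ** ?A v))" for u v
  proof -
    have "(boundary_form D D' g k v has_derivative (\<lambda>u.
        trace (D' ** (\<partial> g v x ** \<partial> k u x + \<partial> (\<partial> g v) u x ** k x))
        + trace (D ** (k x ** \<partial> (\<partial> g v) u x - ?A u ** ?A v)))) (at x)"
      unfolding boundary_form_def[abs_def]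
      by (intro has_derivative_add bounded_linear.has_derivative[OF bounded_linear_trace]
         bounded_linear.has_derivative[OF bounded_bilinear.bounded_linear_right[OF bounded_bilinear_matrix_mult]]
         matrix_mult_has_derivative der left_form_has_derivative)
    from fun_cong[OF frechet_derivative_at[OF this], of u] show ?thesis by simp
  qed
  have g: "\<partial> g v x = g x ** ?A v" for v
    by (simp add: left_form_def matrix_mul_assoc gk)
  have e: "\<partial> g v x ** \<partial> k u x = - (g x ** ?A v ** ?A u ** k x)" for u v
    by (simp add: derivative_inverse matrix_mult_linear g matrix_mul_assoc)
  have c: "trace (D' ** (g x ** ?A v ** ?A u ** k x)) = trace (k x ** D' ** g x ** ?A v ** ?A u)" for u v
    using trace_mul_sym[of "D' ** g x ** ?A v ** ?A u" "k x"] by (simp add: matrix_mul_assoc)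
  have c': "trace (D' ** g x ** ?A v ** ?A u ** k x) = trace (k x ** D' ** g x ** ?A v ** ?A u)" for u v
    using c by (simp add: matrix_mul_assoc)
  show ?thesis
    unfolding d e frechet_derivative_commute[OF g2, of c x b]
    by (simp add: matrix_mult_linear trace_linear matrix_mul_assoc c' trace3_def)
qed

end

section \<open>Equivariant families of invertible matrices\<close>

lemma integrable_frechet_derivative:
  fixes f :: "'a::euclidean_space \<times> real \<Rightarrow> 'c::euclidean_space"
  assumes "Ck_on (Suc 0) f UNIV"
  shows "(\<lambda>y. frechet_derivative f (at (x, y)) v) integrable_on {a..b}"
proof -
  have "continuous_on UNIV (\<lambda>z. frechet_derivative f (at z) v)"
    using Ck_on_frechet_derivative[OF assms] by simp
  then have "continuous_on {a..b} (\<lambda>y. frechet_derivative f (at (x, y)) v)"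
    by (rule continuous_on_compose2) (auto intro!: continuous_intros)
  then show ?thesis by (rule integrable_continuous_real)
qed

lemma integral_frechet_derivative:
  fixes f :: "'a::euclidean_space \<times> real \<Rightarrow> 'c::euclidean_space"
  assumes "Ck_on (Suc 0) f UNIV" "a \<le> b"
  shows "integral {a..b} (\<lambda>y. frechet_derivative f (at (x, y)) (0, 1)) = f (x, b) - f (x, a)"
proof (rule integral_unique)
  have e: "(x, 0) + y *\<^sub>R (0, 1) = (x, y)" for y by simp
  show "((\<lambda>y. frechet_derivative f (at (x, y)) (0, 1)) has_integral f (x, b) - f (x, a)) {a..b}"
    using fundamental_theorem_of_calculus[OF assms(2) frechet_derivative_along_line[OF assms(1), of "(x, 0)" "(0, 1)"]]
    unfolding e .
qed

text \<open>Functions on \<open>((\<real> \<times> \<real>) \<times> \<real>) \<times> \<real>\<close> are integrated one coordinate at a time, from the right; each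
  step removes the last factor of the product.\<close>

definition param_integral :: "real \<Rightarrow> ('a \<times> real \<Rightarrow> real) \<Rightarrow> 'a \<Rightarrow> real" where
  "param_integral b f x = integral {0..b} (\<lambda>y. f (x, y))"

lemma param_integral_Ck1: "Ck_on (Suc 0) f UNIV \<Longrightarrow> Ck_on (Suc 0) (param_integral b f) UNIV"
  for f :: "'a::euclidean_space \<times> real \<Rightarrow> real"
  unfolding param_integral_def[abs_def] by (rule integral_parameter_Ck1)

lemma param_integral_derivative:
  fixes f :: "'a::euclidean_space \<times> real \<Rightarrow> real"
  assumes "Ck_on (Suc 0) f UNIV"
  shows "frechet_derivative (param_integral b f) (at x) v =
    integral {0..b} (\<lambda>y. frechet_derivative f (at (x, y)) (v, 0))"
  unfolding param_integral_def[abs_def] by (rule integral_parameter_frechet_derivative[OF assms])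

text \<open>One coordinate of the divergence theorem: a derivative in the direction of integration
  contributes only the flux through the two ends.\<close>

lemma integral_divergence:
  fixes c :: "'a::euclidean_space \<times> real \<Rightarrow> real"
  assumes c: "Ck_on (Suc 0) c UNIV" and b: "0 \<le> b" and h: "h integrable_on {0..b}"
    and eq: "\<And>y. f y = h y + frechet_derivative c (at (x, y)) (0, 1)"
  shows "integral {0..b} f = integral {0..b} h + (c (x, b) - c (x, 0))"
  unfolding eq[abs_def] using h integrable_frechet_derivative[OF c] integral_frechet_derivative[OF c b]
  by (simp add: integral_add)

text \<open>The coordinates \<open>(((r, \<theta>), t), \<psi>)\<close> are polar coordinates of a 4-ball: \<open>r\<close> is the radius, and
  \<open>(cos t e\<^sup>i\<^sup>\<theta>, sin t e\<^sup>i\<^sup>(\<^sup>\<theta>\<^sup>+\<^sup>\<psi>\<^sup>))\<close> the direction in the 3-sphere, on which the circle acts by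
  translation of \<open>\<theta>\<close>.  The hypotheses \<open>centre\<close>, \<open>t_0\<close>, \<open>t_1\<close> say that \<open>g\<close> respects the degeneration of
  these coordinates.  By closedness of the 3-form, the derivative in \<open>r\<close> of its integral over the
  sphere of radius \<open>r\<close> is an integral of divergences, whose boundary terms cancel by periodicity or
  vanish by degeneration; at radius \<open>0\<close> the integral is zero.  At radius \<open>1\<close> the integrand is the
  exterior derivative of \<open>boundary_form\<close>, so only the boundary \<open>t = \<pi>/2\<close> contributes, where the
  \<open>\<psi>\<close>-component of \<open>boundary_form\<close> is the constant \<open>trace D'\<^sup>2 - trace D\<^sup>2\<close>.\<close>

theorem trace_square_eq:
  fixes g k :: "((real \<times> real) \<times> real) \<times> real \<Rightarrow> real^'n^'n"
  assumes g2: "Ck_on (Suc (Suc 0)) g UNIV" and k2: "Ck_on (Suc (Suc 0)) k UNIV"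
    and gk: "\<And>x. g x ** k x = mat 1" and kg: "\<And>x. k x ** g x = mat 1"
    and centre: "\<And>\<theta> t \<psi>. g (((0, \<theta>), t), \<psi>) = g (((0, 0), 0), 0)"
    and t_0: "\<And>r \<theta> \<psi>. g (((r, \<theta>), 0), \<psi>) = g (((r, \<theta>), 0), 0)"
    and t_1: "\<And>r \<theta> \<psi>. g (((r, \<theta>), pi/2), \<psi>) = g (((r, \<theta> + \<psi>), pi/2), 0)"
    and periodic_\<theta>: "\<And>r \<theta> t \<psi>. g (((r, \<theta> + 2 * pi), t), \<psi>) = g (((r, \<theta>), t), \<psi>)"
    and periodic_\<psi>: "\<And>r \<theta> t \<psi>. g (((r, \<theta>), t), \<psi> + 2 * pi) = g (((r, \<theta>), t), \<psi>)"
    and equivariant: "\<And>\<theta> t \<psi>. frechet_derivative g (at (((1, \<theta>), t), \<psi>)) (((0, 1), 0), 0) =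
      D' ** g (((1, \<theta>), t), \<psi>) - g (((1, \<theta>), t), \<psi>) ** D"
  shows "trace (D ** D) = trace (D' ** D')"
proof -
  define e1 e2 e3 e4 :: "((real \<times> real) \<times> real) \<times> real" where
    "e1 = (((1, 0), 0), 0)" and "e2 = (((0, 1), 0), 0)" and "e3 = (((0, 0), 1), 0)" and "e4 = (((0, 0), 0), 1)"
  let ?d = "\<lambda>f v x. frechet_derivative f (at x) v"
  let ?L = "left_form g k" and ?T = "trace_form g k"
  note C1g = Ck_on_SucD[OF g2]
  have dg: "g differentiable (at x)" for x
    using Ck_on_Suc_has_derivative[OF C1g, of x] by (auto simp: differentiable_def)
  have bl: "linear (frechet_derivative g (at x))" for x
    using dg linear_frechet_derivative by blast
  have k_cong: "k x = k y" if "g x = g y" for x y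
  proof -
    have "k x = k x ** (g y ** k y)" by (simp add: gk)
    also have "\<dots> = k y" unfolding that[symmetric] by (simp add: matrix_mul_assoc kg)
    finally show ?thesis .
  qed
  have L_translate: "?L v (x + p) = ?L v x" if "\<And>x. g (x + p) = g x" for v x p
    unfolding left_form_def frechet_derivative_translation[OF that dg] k_cong[OF that] ..
  have L_const: "?L v x = 0" if "\<And>s. g (x + s *\<^sub>R v) = g x" for v x
    unfolding left_form_def frechet_derivative_constant_direction[OF that C1g] by (simp add: matrix_mult_linear)
  have L2: "?L e2 (((0, \<theta>), t), \<psi>) = 0" for \<theta> t \<psi>
    by (rule L_const) (simp add: e2_def centre[of _ t \<psi>])
  have L4: "?L e4 (((r, \<theta>), 0), \<psi>) = 0" for r \<theta> \<psi>
    by (rule L_const) (simp add: e4_def t_0[of _ _ "_ + _"] t_0[of _ _ \<psi>])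
  \<comment> \<open>On \<open>t = \<pi>/2\<close> only \<open>\<theta> + \<psi>\<close> matters, so the two derivatives agree.\<close>
  have d42: "?d g e4 (((r, \<theta>), pi/2), \<psi>) = ?d g e2 (((r, \<theta>), pi/2), \<psi>)" for r \<theta> \<psi>
  proof -
    have "?d g (e4 - e2) (((r, \<theta>), pi/2), \<psi>) = 0"
      by (rule frechet_derivative_constant_direction[OF _ C1g])
        (simp add: e4_def e2_def t_1[of _ _ "_ + _"] t_1[of _ _ \<psi>])
    then show ?thesis by (simp add: linear_diff[OF bl])
  qed
  have shift4: "g (x + (0, 2 * pi)) = g x" for x
  proof -
    obtain r \<theta> t \<psi> where "x = (((r, \<theta>), t), \<psi>)" by (metis surj_pair)
    then show ?thesis by (simp add: periodic_\<psi>)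
  qed
  have per4: "?L v (x, 2 * pi) = ?L v (x, 0)" for v x
    using L_translate[OF shift4, of v "(x, 0)"] by simp
  have shift2: "g (x + (((0, 2 * pi), 0), 0)) = g x" for x
  proof -
    obtain r \<theta> t \<psi> where "x = (((r, \<theta>), t), \<psi>)" by (metis surj_pair)
    then show ?thesis by (simp add: periodic_\<theta>)
  qed
  have per2: "?L v (((r, 2 * pi), t), \<psi>) = ?L v (((r, 0), t), \<psi>)" for v r t \<psi>
    using L_translate[OF shift2, of v "(((r, 0), t), \<psi>)"] by simp
  \<comment> \<open>\<open>w\<close> is the density of the 3-form on the spheres, and \<open>a\<close>, \<open>b\<close>, \<open>c\<close> are its fluxes in the
    directions \<open>\<theta>\<close>, \<open>t\<close>, \<open>\<psi>\<close>.\<close>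
  let ?w = "?T e2 e3 e4" and ?a = "?T e1 e3 e4" and ?b = "?T e1 e2 e4" and ?c = "?T e1 e2 e3"
  have C1T: "Ck_on (Suc 0) (?T u v w) UNIV" for u v w
    by (rule Ck1_trace_form[OF g2 k2 gk kg])
  let ?I1 = "param_integral (2 * pi) :: _ \<Rightarrow> (real \<times> real) \<times> real \<Rightarrow> real"
    and ?I2 = "param_integral (pi / 2) :: _ \<Rightarrow> real \<times> real \<Rightarrow> real"
    and ?I3 = "param_integral (2 * pi) :: _ \<Rightarrow> real \<Rightarrow> real"
  note C1I = param_integral_Ck1
  have I1: "?d (?I1 ?w) ((1, 0), 0) x = ?d (?I1 ?a) ((0, 1), 0) x - ?d (?I1 ?b) ((0, 0), 1) x" for x
  proof -
    have "integral {0..2*pi} (\<lambda>y. ?d ?w e1 (x, y)) =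
        integral {0..2*pi} (\<lambda>y. ?d ?a e2 (x, y) - ?d ?b e3 (x, y)) + (?c (x, 2 * pi) - ?c (x, 0))"
    proof (rule integral_divergence[OF C1T])
      show "(\<lambda>y. ?d ?a e2 (x, y) - ?d ?b e3 (x, y)) integrable_on {0..2*pi}"
        by (intro integrable_diff integrable_frechet_derivative C1T)
      show "?d ?w e1 (x, y) = ?d ?a e2 (x, y) - ?d ?b e3 (x, y) + ?d ?c (0, 1) (x, y)" for y
        using trace_form_closed[OF g2 k2 gk kg, where a = e1 and b = e2 and c = e3 and d = e4 and x = "(x, y)"]
        by (simp add: e4_def zero_prod_def)
    qed simp
    also have "integral {0..2*pi} (\<lambda>y. ?d ?a e2 (x, y) - ?d ?b e3 (x, y)) =
        integral {0..2*pi} (\<lambda>y. ?d ?a e2 (x, y)) - integral {0..2*pi} (\<lambda>y. ?d ?b e3 (x, y))"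
      by (rule integral_diff[OF integrable_frechet_derivative[OF C1T] integrable_frechet_derivative[OF C1T]])
    also have "?c (x, 2 * pi) = ?c (x, 0)" by (simp add: trace_form_def per4)
    finally show ?thesis
      unfolding param_integral_derivative[OF C1T]
      by (simp add: e1_def e2_def e3_def)
  qed
  have I2: "?d (?I2 (?I1 ?w)) (1, 0) x = ?d (?I2 (?I1 ?a)) (0, 1) x" for x
  proof -
    have "integral {0..pi/2} (\<lambda>y. ?d (?I1 ?a) ((0, 1), 0) (x, y)) =
        integral {0..pi/2} (\<lambda>y. ?d (?I1 ?w) ((1, 0), 0) (x, y)) + (?I1 ?b (x, pi/2) - ?I1 ?b (x, 0))"
    proof (rule integral_divergence[OF C1I[OF C1T]])
      show "(\<lambda>y. ?d (?I1 ?w) ((1, 0), 0) (x, y)) integrable_on {0..pi/2}"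
        by (intro integrable_frechet_derivative C1I C1T)
      show "?d (?I1 ?a) ((0, 1), 0) (x, y) = ?d (?I1 ?w) ((1, 0), 0) (x, y) + ?d (?I1 ?b) (0, 1) (x, y)" for y
        using I1[of "(x, y)"] by (simp add: zero_prod_def)
    qed simp
    also have "?I1 ?b (x, 0) = 0"
      by (cases x) (simp add: param_integral_def trace_form_def L4 trace3_zero)
    also have "?I1 ?b (x, pi/2) = 0"
      by (cases x) (simp add: param_integral_def trace_form_def left_form_def d42 trace3_zero)
    finally show ?thesis
      unfolding param_integral_derivative[OF C1I[OF C1T]] by simp
  qed
  have I3: "?d (?I3 (?I2 (?I1 ?w))) 1 r = 0" for r
  proof -
    have "?d (?I3 (?I2 (?I1 ?w))) 1 r = integral {0..2*pi} (\<lambda>y. ?d (?I2 (?I1 ?a)) (0, 1) (r, y))"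
      unfolding param_integral_derivative[OF C1I[OF C1I[OF C1T]]] I2 ..
    also have "\<dots> = ?I2 (?I1 ?a) (r, 2 * pi) - ?I2 (?I1 ?a) (r, 0)"
      by (rule integral_frechet_derivative[OF C1I[OF C1I[OF C1T]]]) simp
    also have "\<dots> = 0"
      by (simp add: param_integral_def trace_form_def per2)
    finally show ?thesis .
  qed
  have "(?I3 (?I2 (?I1 ?w)) has_real_derivative 0) (at r)" for r
  proof -
    have d: "(?I3 (?I2 (?I1 ?w)) has_derivative frechet_derivative (?I3 (?I2 (?I1 ?w))) (at r)) (at r)"
      by (rule Ck_on_Suc_has_derivative[OF C1I[OF C1I[OF C1I[OF C1T]]]]) simp
    have "?d (?I3 (?I2 (?I1 ?w))) h r = 0" for h
      using linear_scale[OF has_derivative_linear[OF d], of h 1] I3[of r] by simp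
    then have "frechet_derivative (?I3 (?I2 (?I1 ?w))) (at r) = (*) 0" by (simp add: fun_eq_iff)
    then show ?thesis
      using d unfolding has_field_derivative_def by simp
  qed
  then have "?I3 (?I2 (?I1 ?w)) 1 = ?I3 (?I2 (?I1 ?w)) 0"
    using DERIV_isconst_all by blast
  moreover have "?I3 (?I2 (?I1 ?w)) 0 = 0"
    by (simp add: param_integral_def trace_form_def L2 trace3_zero)
  moreover have "?I2 (?I1 ?w) (1, \<theta>) = 2 * pi * (trace (D' ** D') - trace (D ** D))" for \<theta>
  proof -
    let ?\<beta> = "boundary_form D D' g k"
    have C1\<beta>: "Ck_on (Suc 0) (?\<beta> v) UNIV" for v
      by (rule Ck1_boundary_form[OF g2 k2 gk kg])
    have k_eq: "?L e2 (((1, \<theta>), t), \<psi>) = k (((1, \<theta>), t), \<psi>) ** D' ** g (((1, \<theta>), t), \<psi>) - D" for t \<psi>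
      unfolding left_form_def e2_def equivariant
      by (simp add: matrix_mult_linear matrix_mul_assoc kg)
    have \<beta>4: "?\<beta> e4 (((1, \<theta>), 0), \<psi>) = 0" for \<psi>
    proof -
      have "?d g e4 (((1, \<theta>), 0), \<psi>) = g (((1, \<theta>), 0), \<psi>) ** ?L e4 (((1, \<theta>), 0), \<psi>)"
        by (simp add: left_form_def matrix_mul_assoc gk)
      then show ?thesis
        by (simp add: boundary_form_def L4 matrix_mult_linear trace_linear)
    qed
    have \<beta>2: "?\<beta> e4 (((1, \<theta>), pi/2), \<psi>) = trace (D' ** D') - trace (D ** D)" for \<psi>
    proof -
      let ?x = "(((1, \<theta>), pi/2), \<psi>)"
      have "?d g e4 ?x = D' ** g ?x - g ?x ** D"
        unfolding d42 unfolding e2_def by (rule equivariant)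
      moreover have "?L e4 ?x = k ?x ** D' ** g ?x - D"
        using k_eq[of "pi/2" \<psi>] d42[of 1 \<theta> \<psi>] by (simp add: left_form_def)
      moreover have "(D' ** g ?x - g ?x ** D) ** k ?x = D' - g ?x ** D ** k ?x"
        by (simp add: matrix_mult_linear matrix_mul_assoc[symmetric] gk)
      moreover have "trace (D' ** (g ?x ** D ** k ?x)) = trace (D ** (k ?x ** D' ** g ?x))"
        using trace_mul_sym[of "D' ** g ?x" "D ** k ?x"] by (simp add: matrix_mul_assoc)
      ultimately show ?thesis
        by (simp add: boundary_form_def matrix_mult_linear trace_linear)
    qed
    have w: "?w (((1, \<theta>), t), \<psi>) = ?d (?\<beta> e4) e3 (((1, \<theta>), t), \<psi>) - ?d (?\<beta> e3) e4 (((1, \<theta>), t), \<psi>)" for t \<psi>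
      unfolding boundary_form_derivative[OF g2 k2 gk kg] trace_form_def k_eq ..
    have \<beta>3: "?\<beta> e3 (x, 2 * pi) = ?\<beta> e3 (x, 0)" for x
    proof -
      have "g (x, 2 * pi) = g (x, 0)" "frechet_derivative g (at (x, 2 * pi)) = frechet_derivative g (at (x, 0))"
        using shift4[of "(x, 0)"] frechet_derivative_translation[OF shift4 dg, of "(x, 0)"] by simp_all
      then show ?thesis
        using k_cong[of "(x, 2 * pi)" "(x, 0)"] by (simp add: boundary_form_def per4)
    qed
    have "?I1 ?w ((1, \<theta>), t) = ?d (?I1 (?\<beta> e4)) (0, 1) ((1, \<theta>), t)" for t
    proof -
      let ?x = "((1, \<theta>), t)"
      have "integral {0..2*pi} (\<lambda>y. ?d (?\<beta> e4) e3 (?x, y)) =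
          integral {0..2*pi} (\<lambda>y. ?w (?x, y)) + (?\<beta> e3 (?x, 2 * pi) - ?\<beta> e3 (?x, 0))"
      proof (rule integral_divergence[OF C1\<beta>])
        show "(\<lambda>y. ?w (?x, y)) integrable_on {0..2*pi}"
          unfolding w by (unfold e4_def e3_def) (intro integrable_diff integrable_frechet_derivative C1\<beta>)
        show "?d (?\<beta> e4) e3 (?x, y) = ?w (?x, y) + ?d (?\<beta> e3) (0, 1) (?x, y)" for y
          unfolding w by (simp add: e4_def zero_prod_def)
      qed simp
      then have "integral {0..2*pi} (\<lambda>y. ?d (?\<beta> e4) e3 (?x, y)) = integral {0..2*pi} (\<lambda>y. ?w (?x, y))"
        using \<beta>3[of ?x] by simp
      then show ?thesis
        unfolding param_integral_derivative[OF C1\<beta>]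
        by (simp add: e3_def zero_prod_def param_integral_def)
    qed
    then have "?I2 (?I1 ?w) (1, \<theta>) = integral {0..pi/2} (\<lambda>t. ?d (?I1 (?\<beta> e4)) (0, 1) ((1, \<theta>), t))"
      by (simp add: param_integral_def[of "pi/2"])
    also have "\<dots> = ?I1 (?\<beta> e4) ((1, \<theta>), pi/2) - ?I1 (?\<beta> e4) ((1, \<theta>), 0)"
      by (rule integral_frechet_derivative[OF C1I[OF C1\<beta>]]) simp
    also have "\<dots> = 2 * pi * (trace (D' ** D') - trace (D ** D))"
      by (simp add: param_integral_def \<beta>4 \<beta>2)
    finally show ?thesis .
  qed
  then have "?I3 (?I2 (?I1 ?w)) 1 = 2 * pi * (2 * pi * (trace (D' ** D') - trace (D ** D)))"
    by (simp add: param_integral_def[of "2 * pi" "?I2 (?I1 ?w)"])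
  ultimately show ?thesis by simp
qed

lemma Ck_on_matrix:
  fixes F :: "'e::euclidean_space \<Rightarrow> real^'n \<Rightarrow> real^'m"
  assumes "open U" "\<And>v. Ck_on k (\<lambda>x. F x v) U"
  shows "Ck_on k (\<lambda>x. matrix (F x)) U"
proof (rule Ck_on_componentwise[OF assms(1)])
  fix b :: "real^'n^'m" assume "b \<in> Basis"
  then obtain i j where b: "b = axis i (axis j 1)"
    by (auto simp: Basis_vec_def)
  have "matrix (F x) \<bullet> b = F x (axis j 1) \<bullet> axis i 1" for x
    by (simp add: b inner_axis matrix_def)
  moreover have "Ck_on k (\<lambda>x. F x (axis j 1) \<bullet> axis i 1) U"
    by (intro Ck_on_inner assms Ck_on_const)
  ultimately show "Ck_on k (\<lambda>x. matrix (F x) \<bullet> b) U" by simp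
qed

text \<open>\<open>trace_square_eq\<close> for the derivative of \<open>f\<close> along the family \<open>\<iota>\<close>: differentiating
  \<open>f (R s x) = R' s (f x)\<close> in \<open>x\<close> gives \<open>g (R s x) R s = R' s g x\<close>, and differentiating this in \<open>s\<close>
  gives the equation on the boundary sphere.\<close>

theorem equivariant_diffeomorphism_trace_square:
  fixes f h :: "real^'n \<Rightarrow> real^'n" and R R' :: "real \<Rightarrow> real^'n^'n"
    and \<iota> :: "((real \<times> real) \<times> real) \<times> real \<Rightarrow> real^'n"
  assumes \<Omega>: "open \<Omega>" and f\<Omega>: "\<And>x. x \<in> \<Omega> \<Longrightarrow> f x \<in> \<Omega>" and h\<Omega>: "\<And>x. x \<in> \<Omega> \<Longrightarrow> h x \<in> \<Omega>"
    and hf: "\<And>x. x \<in> \<Omega> \<Longrightarrow> h (f x) = x" and fh: "\<And>x. x \<in> \<Omega> \<Longrightarrow> f (h x) = x"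
    and f3: "Ck_on 3 f \<Omega>" and h3: "Ck_on 3 h \<Omega>"
    and R\<Omega>: "\<And>s x. x \<in> \<Omega> \<Longrightarrow> R s *v x \<in> \<Omega>"
    and fR: "\<And>s x. x \<in> \<Omega> \<Longrightarrow> f (R s *v x) = R' s *v f x"
    and R: "(R has_vector_derivative D) (at 0)" "R 0 = mat 1"
    and R': "(R' has_vector_derivative D') (at 0)" "R' 0 = mat 1"
    and \<iota>2: "Ck_on 2 \<iota> UNIV" and \<iota>\<Omega>: "\<And>x. \<iota> x \<in> \<Omega>"
    and centre: "\<And>\<theta> t \<psi>. \<iota> (((0, \<theta>), t), \<psi>) = \<iota> (((0, 0), 0), 0)"
    and t_0: "\<And>r \<theta> \<psi>. \<iota> (((r, \<theta>), 0), \<psi>) = \<iota> (((r, \<theta>), 0), 0)"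
    and t_1: "\<And>r \<theta> \<psi>. \<iota> (((r, \<theta>), pi/2), \<psi>) = \<iota> (((r, \<theta> + \<psi>), pi/2), 0)"
    and periodic_\<theta>: "\<And>r \<theta> t \<psi>. \<iota> (((r, \<theta> + 2 * pi), t), \<psi>) = \<iota> (((r, \<theta>), t), \<psi>)"
    and periodic_\<psi>: "\<And>r \<theta> t \<psi>. \<iota> (((r, \<theta>), t), \<psi> + 2 * pi) = \<iota> (((r, \<theta>), t), \<psi>)"
    and equivariant: "\<And>\<theta> t \<psi> s. \<iota> (((1, \<theta> + s), t), \<psi>) = R s *v \<iota> (((1, \<theta>), t), \<psi>)"
  shows "trace (D ** D) = trace (D' ** D')"
proof -
  let ?f' = "\<lambda>x. frechet_derivative f (at x)" and ?h' = "\<lambda>x. frechet_derivative h (at x)"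
  have f3': "Ck_on (Suc (Suc (Suc 0))) f \<Omega>" and h3': "Ck_on (Suc (Suc (Suc 0))) h \<Omega>"
    and \<iota>2': "Ck_on (Suc (Suc 0)) \<iota> UNIV"
    using f3 h3 \<iota>2 by (simp_all only: numeral_2_eq_2 numeral_3_eq_3)
  have df: "(f has_derivative ?f' x) (at x)" and dh: "(h has_derivative ?h' x) (at x)" if "x \<in> \<Omega>" for x
    by (rule Ck_on_Suc_has_derivative[OF f3' that], rule Ck_on_Suc_has_derivative[OF h3' that])
  define g where "g = (\<lambda>x. matrix (?f' (\<iota> x)))"
  define k where "k = (\<lambda>x. matrix (?h' (f (\<iota> x))))"
  have f\<iota>: "Ck_on (Suc (Suc 0)) (\<lambda>x. f (\<iota> x)) UNIV"
    by (rule Ck_on_compose[OF open_UNIV \<Omega> _ Ck_on_SucD[OF f3'] \<iota>2']) (use \<iota>\<Omega> in auto)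
  have g2: "Ck_on (Suc (Suc 0)) g UNIV"
    unfolding g_def
    by (rule Ck_on_matrix[OF open_UNIV], rule Ck_on_compose[OF open_UNIV \<Omega> _ Ck_on_frechet_derivative[OF f3'] \<iota>2'])
      (use \<iota>\<Omega> in auto)
  have k2: "Ck_on (Suc (Suc 0)) k UNIV"
    unfolding k_def
    by (rule Ck_on_matrix[OF open_UNIV], rule Ck_on_compose[OF open_UNIV \<Omega> _ Ck_on_frechet_derivative[OF h3'] f\<iota>])
      (use \<iota>\<Omega> f\<Omega> in auto)
  have inverse: "a' \<circ> b' = id" if "\<And>x. x \<in> \<Omega> \<Longrightarrow> a (b x) = x" "y \<in> \<Omega>"
      "(b has_derivative b') (at y)" "(a has_derivative a') (at (b y))" for a b a' b' and y :: "real^'n"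
  proof -
    have "((\<lambda>x. a (b x)) has_derivative (\<lambda>v. a' (b' v))) (at y)"
      by (rule has_derivative_compose[OF that(3,4)])
    then have "((\<lambda>x. x) has_derivative (\<lambda>v. a' (b' v))) (at y)"
      by (rule has_derivative_transform_within_open[OF _ \<Omega> that(2)]) (rule that(1))
    then show ?thesis
      using has_derivative_unique[OF _ has_derivative_ident] by (auto simp: fun_eq_iff dest: fun_cong)
  qed
  have gk: "g x ** k x = mat 1" for x
  proof -
    have y: "f (\<iota> x) \<in> \<Omega>" by (rule f\<Omega>[OF \<iota>\<Omega>])
    have a: "(f has_derivative ?f' (\<iota> x)) (at (h (f (\<iota> x))))"
      using df[OF \<iota>\<Omega>] by (simp add: hf[OF \<iota>\<Omega>])
    have "?f' (\<iota> x) \<circ> ?h' (f (\<iota> x)) = id"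
      by (rule inverse[OF fh y dh[OF y] a])
    then show ?thesis
      unfolding g_def k_def
      by (simp add: matrix_compose[symmetric] has_derivative_linear[OF df[OF \<iota>\<Omega>]] has_derivative_linear[OF dh[OF y]] matrix_id_mat_1)
  qed
  have kg: "k x ** g x = mat 1" for x
    using gk[of x] matrix_left_right_inverse by blast
  show ?thesis
  proof (rule trace_square_eq[OF g2 k2 gk kg])
    fix r \<theta> t \<psi>
    show "g (((0, \<theta>), t), \<psi>) = g (((0, 0), 0), 0)" "g (((r, \<theta>), 0), \<psi>) = g (((r, \<theta>), 0), 0)"
      "g (((r, \<theta>), pi/2), \<psi>) = g (((r, \<theta> + \<psi>), pi/2), 0)"
      "g (((r, \<theta> + 2 * pi), t), \<psi>) = g (((r, \<theta>), t), \<psi>)"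
      "g (((r, \<theta>), t), \<psi> + 2 * pi) = g (((r, \<theta>), t), \<psi>)"
      unfolding g_def by (rule arg_cong[where f = "\<lambda>y. matrix (?f' y)"], rule centre t_0 t_1 periodic_\<theta> periodic_\<psi>)+
    let ?x = "(((1, \<theta>), t), \<psi>)" and ?e = "(((0, 1), 0), 0) :: ((real \<times> real) \<times> real) \<times> real"
    have eq: "g (?x + s *\<^sub>R ?e) ** R s = R' s ** g ?x" for s
    proof -
      have Rd: "((*v) (R s) has_derivative (*v) (R s)) (at y)" and R'd: "((*v) (R' s) has_derivative (*v) (R' s)) (at y)" for y
        by (simp_all add: linear_imp_has_derivative)
      have "((\<lambda>y. f (R s *v y)) has_derivative (\<lambda>v. ?f' (R s *v \<iota> ?x) (R s *v v))) (at (\<iota> ?x))"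
        by (rule has_derivative_compose[OF Rd df[OF R\<Omega>[OF \<iota>\<Omega>]]])
      moreover have "((\<lambda>y. f (R s *v y)) has_derivative (\<lambda>v. R' s *v ?f' (\<iota> ?x) v)) (at (\<iota> ?x))"
        by (rule has_derivative_transform_within_open[OF has_derivative_compose[OF df[OF \<iota>\<Omega>] R'd] \<Omega> \<iota>\<Omega>])
          (simp add: fR)
      ultimately have "?f' (R s *v \<iota> ?x) \<circ> (*v) (R s) = (*v) (R' s) \<circ> ?f' (\<iota> ?x)"
        using has_derivative_unique by (auto simp: comp_def)
      then have "matrix (?f' (R s *v \<iota> ?x)) ** R s = R' s ** matrix (?f' (\<iota> ?x))"
        using matrix_compose[of "(*v) (R s)" "?f' (R s *v \<iota> ?x)"] matrix_compose[of "?f' (\<iota> ?x)" "(*v) (R' s)"]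
          has_derivative_linear[OF df[OF \<iota>\<Omega>]] has_derivative_linear[OF df[OF R\<Omega>[OF \<iota>\<Omega>]]]
        by (simp add: matrix_of_matrix_vector_mul)
      then show ?thesis unfolding g_def using equivariant[of \<theta> s t \<psi>] by simp
    qed
    have line: "((\<lambda>s. g (?x + s *\<^sub>R ?e)) has_vector_derivative frechet_derivative g (at ?x) ?e) (at 0)"
      using frechet_derivative_along_line[OF Ck_on_SucD[OF g2], of ?x ?e 0 UNIV] by simp
    have "((\<lambda>s. g (?x + s *\<^sub>R ?e) ** R s) has_vector_derivative
        g ?x ** D + frechet_derivative g (at ?x) ?e ** mat 1) (at 0)"
      using bounded_bilinear.has_vector_derivative[OF bounded_bilinear_matrix_mult line R(1)] R(2) by simp
    moreover have "((\<lambda>s. R' s ** g ?x) has_vector_derivative D' ** g ?x) (at 0)"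
      using bounded_bilinear.has_vector_derivative[OF bounded_bilinear_matrix_mult R'(1) has_vector_derivative_const[of "g ?x"]]
      by (simp add: matrix_mult_linear)
    ultimately have "g ?x ** D + frechet_derivative g (at ?x) ?e ** mat 1 = D' ** g ?x"
      unfolding eq using vector_derivative_unique_at by blast
    then show "frechet_derivative g (at ?x) ?e = D' ** g ?x - g ?x ** D"
      by (simp add: algebra_simps)
  qed
qed

section \<open>Homogeneous extension of maps of a product of spheres\<close>

text \<open>The homogeneous extension of a diffeomorphism of \<open>S \<times> S\<close> preserves both norms and is a
  diffeomorphism of an open subset of a vector space.  Its derivatives at different points can be
  compared as matrices, unlike those of the original map, and it is equivariant under the same linear
  isometries.\<close>

definition radial :: "'a::euclidean_space \<times> 'b::euclidean_space \<Rightarrow> 'a \<times> 'b" where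
  "radial p = (inverse (norm (fst p)) *\<^sub>R fst p, inverse (norm (snd p)) *\<^sub>R snd p)"

definition cone_extension ::
    "('a::euclidean_space \<times> 'b::euclidean_space \<Rightarrow> 'a \<times> 'b) \<Rightarrow> 'a \<times> 'b \<Rightarrow> 'a \<times> 'b" where
  "cone_extension F p =
    (norm (fst p) *\<^sub>R fst (F (radial p)), norm (snd p) *\<^sub>R snd (F (radial p)))"

definition off_axes :: "('a::euclidean_space \<times> 'b::euclidean_space) set" where
  "off_axes = {p. fst p \<noteq> 0 \<and> snd p \<noteq> 0}"

lemma open_off_axes: "open off_axes"
  unfolding off_axes_def by (intro open_Collect_conj open_Collect_neq continuous_intros)

lemma off_axesD: "p \<in> off_axes \<Longrightarrow> fst p \<noteq> 0 \<and> snd p \<noteq> 0"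
  by (simp add: off_axes_def)

lemma radial_in_spheres: "p \<in> off_axes \<Longrightarrow> radial p \<in> sphere 0 1 \<times> sphere 0 1"
  by (auto simp: off_axes_def radial_def)

lemma Ck_on_radial:
  fixes U :: "('a::euclidean_space \<times> 'b::euclidean_space) set"
  assumes "open U" "U \<subseteq> off_axes"
  shows "Ck_on k radial U" "Ck_on k (\<lambda>p. norm (fst p)) U" "Ck_on k (\<lambda>p. norm (snd p)) U"
proof -
  have o: "open (- {0} :: 'a set)" "open (- {0} :: 'b set)" by (simp_all add: open_Compl)
  have fs: "Ck_on k fst U" "Ck_on k snd U"
    by (intro Ck_on_linear assms(1) bounded_linear_fst bounded_linear_snd)+
  have img: "fst ` U \<subseteq> - {0}" "snd ` U \<subseteq> - {0}"
    by (rule image_subsetI, use off_axesD[OF subsetD[OF assms(2)]] in simp)+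
  note compose = Ck_on_compose[OF assms(1) o(1) img(1) _ fs(1)] Ck_on_compose[OF assms(1) o(2) img(2) _ fs(2)]
  show "Ck_on k (\<lambda>p. norm (fst p)) U" "Ck_on k (\<lambda>p. norm (snd p)) U"
    by (rule compose(1)[OF Ck_on_norm[OF o(1)]], simp, rule compose(2)[OF Ck_on_norm[OF o(2)]], simp)
  have "Ck_on k (\<lambda>p. inverse (norm (fst p))) U" "Ck_on k (\<lambda>p. inverse (norm (snd p))) U"
    by (rule compose(1)[OF Ck_on_inverse_norm[OF o(1)]], simp, rule compose(2)[OF Ck_on_inverse_norm[OF o(2)]], simp)
  note this[THEN Ck_on_scaleR[OF assms(1)]]
  from Ck_on_Pair[OF assms(1) this(1)[OF fs(1)] this(2)[OF fs(2)]]
  show "Ck_on k radial U" by (simp only: radial_def[abs_def])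
qed

lemma Ck_on_cone_extension:
  assumes F: "smooth_map_on (sphere 0 1 \<times> sphere 0 1) F"
  shows "Ck_on k (cone_extension F) off_axes"
proof (rule Ck_on_local)
  fix p :: "'a \<times> 'b" assume p: "p \<in> off_axes"
  obtain U h where U: "open U" "radial p \<in> U" "\<And>k. Ck_on k h U"
    "\<And>y. y \<in> sphere 0 1 \<times> sphere 0 1 \<Longrightarrow> y \<in> U \<Longrightarrow> F y = h y"
    using smooth_map_on_extension[OF F radial_in_spheres[OF p]] by blast
  let ?V = "off_axes \<inter> radial -` U"
  have o: "open ?V"
    by (rule continuous_open_preimage[OF Ck_on_imp_continuous_on[OF Ck_on_radial(1)[OF open_off_axes subset_refl]] open_off_axes U(1)])
  have V: "?V \<subseteq> off_axes" by simp
  have h: "Ck_on k (\<lambda>p. h (radial p)) ?V"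
    by (rule Ck_on_compose[OF o U(1) _ U(3) Ck_on_radial(1)[OF o V]]) (simp add: image_subset_iff)
  have c: "Ck_on k (\<lambda>p. (norm (fst p) *\<^sub>R fst (h (radial p)), norm (snd p) *\<^sub>R snd (h (radial p)))) ?V"
    by (rule Ck_on_Pair[OF o Ck_on_scaleR[OF o Ck_on_radial(2)[OF o V] Ck_on_linear_compose[OF bounded_linear_fst o h]]
        Ck_on_scaleR[OF o Ck_on_radial(3)[OF o V] Ck_on_linear_compose[OF bounded_linear_snd o h]]])
  have "Ck_on k (cone_extension F) ?V"
  proof (rule Ck_on_cong[OF o _ c])
    fix y assume y: "y \<in> ?V"
    have "F (radial y) = h (radial y)"
      by (rule U(4)[OF radial_in_spheres]) (use y in simp_all)
    then show "(norm (fst y) *\<^sub>R fst (h (radial y)), norm (snd y) *\<^sub>R snd (h (radial y))) = cone_extension F y"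
      by (simp only: cone_extension_def)
  qed
  moreover have "p \<in> ?V" using p U(2) by simp
  ultimately show "\<exists>V. open V \<and> p \<in> V \<and> Ck_on k (cone_extension F) V"
    using o by (intro exI[of _ ?V] conjI)
qed

lemma norm_cone_extension:
  assumes "F ` (sphere 0 1 \<times> sphere 0 1) \<subseteq> sphere 0 1 \<times> sphere 0 1" "p \<in> off_axes"
  shows "norm (fst (cone_extension F p)) = norm (fst p)" "norm (snd (cone_extension F p)) = norm (snd p)"
proof -
  have "F (radial p) \<in> sphere 0 1 \<times> sphere 0 1"
    by (rule subsetD[OF assms(1) imageI[OF radial_in_spheres[OF assms(2)]]])
  then have "norm (fst (F (radial p))) = 1" "norm (snd (F (radial p))) = 1"
    unfolding mem_Times_iff mem_sphere_0 by blast+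
  then show "norm (fst (cone_extension F p)) = norm (fst p)" "norm (snd (cone_extension F p)) = norm (snd p)"
    by (simp_all only: cone_extension_def fst_conv snd_conv norm_scaleR abs_norm_cancel mult_1_right)
qed

lemma cone_extension_off_axes:
  assumes "F ` (sphere 0 1 \<times> sphere 0 1) \<subseteq> sphere 0 1 \<times> sphere 0 1" "p \<in> off_axes"
  shows "cone_extension F p \<in> off_axes"
  using off_axesD[OF assms(2)] norm_cone_extension[OF assms]
  unfolding off_axes_def mem_Collect_eq by (metis norm_eq_zero)

lemma radial_cone_extension:
  assumes "F ` (sphere 0 1 \<times> sphere 0 1) \<subseteq> sphere 0 1 \<times> sphere 0 1" "p \<in> off_axes"
  shows "radial (cone_extension F p) = F (radial p)"
  using off_axesD[OF assms(2)] unfolding radial_def[of "cone_extension F p"] norm_cone_extension[OF assms]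
  by (simp add: cone_extension_def)

lemma cone_extension_inverse:
  assumes "F ` (sphere 0 1 \<times> sphere 0 1) \<subseteq> sphere 0 1 \<times> sphere 0 1" "p \<in> off_axes"
    and "\<And>x. x \<in> sphere 0 1 \<times> sphere 0 1 \<Longrightarrow> G (F x) = x"
  shows "cone_extension G (cone_extension F p) = p"
proof -
  have "cone_extension G (cone_extension F p) = (norm (fst p) *\<^sub>R fst (radial p), norm (snd p) *\<^sub>R snd (radial p))"
    unfolding cone_extension_def[of G] radial_cone_extension[OF assms(1,2)] norm_cone_extension[OF assms(1,2)]
      assms(3)[OF radial_in_spheres[OF assms(2)]] ..
  then show ?thesis using off_axesD[OF assms(2)] by (simp add: radial_def)
qed

lemma norm_spin_act:
  assumes "g \<in> carrier Spin8"
  shows "norm (fst (spin_act g p)) = norm (fst p)" "norm (snd (spin_act g p)) = norm (snd p)"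
  using assms by (auto simp: spin_act_def carrier_Spin8 norm_SO8)

lemma spin_act_off_axes: "g \<in> carrier Spin8 \<Longrightarrow> p \<in> off_axes \<Longrightarrow> spin_act g p \<in> off_axes"
  unfolding off_axes_def mem_Collect_eq by (metis norm_spin_act norm_eq_zero)

lemma cone_extension_equivariant:
  assumes g: "g \<in> carrier Spin8" and p: "p \<in> off_axes"
    and F: "\<And>x. x \<in> S7xS7 \<Longrightarrow> F (spin_act g x) = spin_act g' (F x)"
  shows "cone_extension F (spin_act g p) = spin_act g' (cone_extension F p)"
proof -
  have "radial (spin_act g p) = spin_act g (radial p)"
    unfolding radial_def norm_spin_act[OF g] by (simp add: spin_act_def matrix_vector_mult_scaleR)
  moreover have "radial p \<in> S7xS7" using radial_in_spheres[OF p] by (simp add: S7xS7_def S7_def)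
  ultimately show ?thesis
    unfolding cone_extension_def norm_spin_act[OF g] by (simp only: F) (simp add: spin_act_def matrix_vector_mult_scaleR)
qed

section \<open>The weights of a circle and the sum of their squares\<close>

text \<open>Pairs of octonions as vectors with index type \<open>8 + 8\<close>, so that linear maps between them are square
  matrices and have a trace.\<close>

definition stack :: "octonion \<times> octonion \<Rightarrow> real^(8+8)" where
  "stack p = (\<chi> i. case i of Inl a \<Rightarrow> fst p $ a | Inr b \<Rightarrow> snd p $ b)"

definition unstack :: "real^(8+8) \<Rightarrow> octonion \<times> octonion" where
  "unstack v = ((\<chi> a. v $ Inl a), (\<chi> b. v $ Inr b))"

definition block_matrix :: "(real^8^8) \<times> (real^8^8) \<Rightarrow> real^(8+8)^(8+8)" where
  "block_matrix g = (\<chi> i j. case i of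
      Inl a \<Rightarrow> (case j of Inl b \<Rightarrow> fst g $ a $ b | Inr b \<Rightarrow> 0)
    | Inr a \<Rightarrow> (case j of Inl b \<Rightarrow> 0 | Inr b \<Rightarrow> snd g $ a $ b))"

lemma sum_UNIV_Plus: "(\<Sum>i\<in>UNIV. f i) = (\<Sum>a\<in>UNIV. f (Inl a)) + (\<Sum>b\<in>UNIV. f (Inr b))"
  for f :: "'a::finite + 'b::finite \<Rightarrow> 'c::comm_monoid_add"
  unfolding UNIV_Plus_UNIV[symmetric] by (simp add: sum.Plus del: UNIV_Plus_UNIV)

lemma unstack_stack [simp]: "unstack (stack p) = p"
  by (simp add: unstack_def stack_def prod_eq_iff vec_eq_iff)

lemma stack_unstack [simp]: "stack (unstack v) = v"
  by (auto simp: unstack_def stack_def vec_eq_iff split: sum.split)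

lemma bounded_linear_stack: "bounded_linear stack"
  unfolding linear_conv_bounded_linear[symmetric]
  by (auto intro!: linearI simp: stack_def vec_eq_iff split: sum.split)

lemma bounded_linear_unstack: "bounded_linear unstack"
  unfolding linear_conv_bounded_linear[symmetric]
  by (auto intro!: linearI simp: unstack_def vec_eq_iff split: sum.split)

lemma bounded_linear_block_matrix: "bounded_linear block_matrix"
  unfolding linear_conv_bounded_linear[symmetric]
  by (auto intro!: linearI simp: block_matrix_def vec_eq_iff split: sum.split)

lemma block_matrix_mult_vector: "block_matrix g *v v = stack (spin_act g (unstack v))"
  by (auto simp: block_matrix_def stack_def unstack_def spin_act_def vec_eq_iff matrix_vector_mult_def
      sum_UNIV_Plus split: sum.split)

lemma block_matrix_one: "block_matrix (mat 1, mat 1) = mat 1"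
  by (auto simp: block_matrix_def vec_eq_iff mat_def split: sum.split)

lemma trace_block_matrix_square:
  "trace (block_matrix (A, B) ** block_matrix (A, B)) = trace (A ** A) + trace (B ** B)"
  by (simp add: trace_def sum_UNIV_Plus block_matrix_def matrix_matrix_mult_def)

text \<open>The generator of rotation in the coordinate plane spanned by the axes \<open>i\<close> and \<open>j\<close>.\<close>

definition plane_generator :: "8 \<Rightarrow> 8 \<Rightarrow> real^8^8" where
  "plane_generator i j = axis j (axis i 1) - axis i (axis j 1)"

definition plane_projection :: "8 \<Rightarrow> 8 \<Rightarrow> real^8^8" where
  "plane_projection i j = axis i (axis i 1) + axis j (axis j 1)"

definition rot_generator :: "real \<Rightarrow> real \<Rightarrow> real \<Rightarrow> real \<Rightarrow> real^8^8" where
  "rot_generator a b c d = a *\<^sub>R plane_generator 1 2 + b *\<^sub>R plane_generator 3 4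
     + c *\<^sub>R plane_generator 5 6 + d *\<^sub>R plane_generator 7 8"

lemma rot_diag_eq_planes: "rot_diag a b c d =
    (cos a *\<^sub>R plane_projection 1 2 + sin a *\<^sub>R plane_generator 1 2)
  + (cos b *\<^sub>R plane_projection 3 4 + sin b *\<^sub>R plane_generator 3 4)
  + (cos c *\<^sub>R plane_projection 5 6 + sin c *\<^sub>R plane_generator 5 6)
  + (cos d *\<^sub>R plane_projection 7 8 + sin d *\<^sub>R plane_generator 7 8)"
  by (simp add: vec_eq_iff forall_8 rot_diag_def plane_projection_def plane_generator_def axis_def)

lemma rot_diag_has_vector_derivative:
  "((\<lambda>s. rot_diag (a * s) (b * s) (c * s) (d * s)) has_vector_derivative rot_generator a b c d) (at 0)"
  unfolding rot_diag_eq_planes rot_generator_def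
  by (auto intro!: derivative_eq_intros simp: has_real_derivative_iff_has_vector_derivative[symmetric])

lemma trace_rot_generator_square:
  "trace (rot_generator a b c d ** rot_generator a b c d) = - 2 * (a\<^sup>2 + b\<^sup>2 + c\<^sup>2 + d\<^sup>2)"
  by (simp add: trace_def sum_8 matrix_matrix_mult_def rot_generator_def plane_generator_def axis_def power2_eq_square)

text \<open>As \<open>r\<close> runs from \<open>1\<close> to \<open>0\<close>, the point \<open>x = (((r, \<theta>), t), \<psi>)\<close> moves from
  \<open>(cos t e\<^sup>i\<^sup>a\<^sup>\<theta>, sin t e\<^sup>i\<^sup>b\<^sup>(\<^sup>\<theta>\<^sup>+\<^sup>\<psi>\<^sup>))\<close>, in the first two complex coordinates, to the fifth basis vector.
  The path avoids \<open>0\<close>, and at \<open>r = 1\<close> translation of \<open>\<theta>\<close> is rotation with the weights \<open>a\<close>, \<open>b\<close>.\<close>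

definition wave :: "real \<Rightarrow> real \<Rightarrow> ((real \<times> real) \<times> real) \<times> real \<Rightarrow> octonion" where
  "wave a b x =
     (fst (fst (fst x)) * (cos (snd (fst x)) * cos (a * snd (fst (fst x))))) *\<^sub>R axis 1 1
   + (fst (fst (fst x)) * (cos (snd (fst x)) * sin (a * snd (fst (fst x))))) *\<^sub>R axis 2 1
   + (fst (fst (fst x)) * (sin (snd (fst x)) * cos (b * (snd (fst (fst x)) + snd x)))) *\<^sub>R axis 3 1
   + (fst (fst (fst x)) * (sin (snd (fst x)) * sin (b * (snd (fst (fst x)) + snd x)))) *\<^sub>R axis 4 1
   + (1 + - fst (fst (fst x))) *\<^sub>R axis 5 1"

lemma wave_nonzero: "wave a b x \<noteq> 0"
proof
  assume "wave a b x = 0"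
  then have c: "wave a b x $ i = 0" for i by simp
  have r: "fst (fst (fst x)) = 1" using c[of 5] by (simp add: wave_def axis_def)
  have "cos (snd (fst x)) = 0"
    using c[of 1] c[of 2] sin_zero_abs_cos_one[of "a * snd (fst (fst x))"]
    by (auto simp: wave_def axis_def r)
  moreover have "sin (snd (fst x)) = 0"
    using c[of 3] c[of 4] sin_zero_abs_cos_one[of "b * (snd (fst (fst x)) + snd x)"]
    by (auto simp: wave_def axis_def r)
  ultimately show False using sin_cos_squared_add[of "snd (fst x)"] by simp
qed

lemma Ck_on_wave: "Ck_on k (wave a b) UNIV"
proof -
  have r: "bounded_linear (\<lambda>x :: ((real \<times> real) \<times> real) \<times> real. fst (fst (fst x)))"
    and \<theta>: "bounded_linear (\<lambda>x :: ((real \<times> real) \<times> real) \<times> real. snd (fst (fst x)))"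
    and t: "bounded_linear (\<lambda>x :: ((real \<times> real) \<times> real) \<times> real. snd (fst x))"
    and \<psi>: "bounded_linear (\<lambda>x :: ((real \<times> real) \<times> real) \<times> real. snd x)"
    by (intro bounded_linear_intros)+
  note coordinates = r[THEN Ck_on_linear[OF open_UNIV]] \<theta>[THEN Ck_on_linear[OF open_UNIV]]
    t[THEN Ck_on_linear[OF open_UNIV]] \<psi>[THEN Ck_on_linear[OF open_UNIV]]
    bounded_linear_minus[OF r, THEN Ck_on_linear[OF open_UNIV]]
  show ?thesis
    unfolding wave_def[abs_def]
    by (intro Ck_on_add Ck_on_scaleR Ck_on_mult Ck_on_cos Ck_on_sin Ck_on_const open_UNIV coordinates)
qed

lemma cos_sin_int_shift:
  "cos (of_int n * (x + 2 * pi)) = cos (of_int n * x)" "sin (of_int n * (x + 2 * pi)) = sin (of_int n * x)"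
proof -
  have e: "of_int n * (x + 2 * pi) = of_int n * x + 2 * pi * of_int n" by (simp add: algebra_simps)
  show "cos (of_int n * (x + 2 * pi)) = cos (of_int n * x)" "sin (of_int n * (x + 2 * pi)) = sin (of_int n * x)"
    unfolding e cos_add sin_add cos_int_2pin sin_int_2pin by simp_all
qed

lemma wave_boundary:
  "wave a b (((0, \<theta>), t), \<psi>) = axis 5 1"
  "wave a b (((r, \<theta>), 0), \<psi>) = wave a b (((r, \<theta>), 0), 0)"
  "wave a b (((r, \<theta>), pi/2), \<psi>) = wave a b (((r, \<theta> + \<psi>), pi/2), 0)"
  by (simp_all add: wave_def)

lemma wave_periodic:
  "wave (of_int m) (of_int n) (((r, \<theta> + 2 * pi), t), \<psi>) = wave (of_int m) (of_int n) (((r, \<theta>), t), \<psi>)"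
  "wave (of_int m) (of_int n) (((r, \<theta>), t), \<psi> + 2 * pi) = wave (of_int m) (of_int n) (((r, \<theta>), t), \<psi>)"
proof -
  have "\<theta> + 2 * pi + \<psi> = (\<theta> + \<psi>) + 2 * pi" "\<theta> + (\<psi> + 2 * pi) = (\<theta> + \<psi>) + 2 * pi" by simp_all
  then show "wave (of_int m) (of_int n) (((r, \<theta> + 2 * pi), t), \<psi>) = wave (of_int m) (of_int n) (((r, \<theta>), t), \<psi>)"
    "wave (of_int m) (of_int n) (((r, \<theta>), t), \<psi> + 2 * pi) = wave (of_int m) (of_int n) (((r, \<theta>), t), \<psi>)"
    unfolding wave_def by (simp_all only: fst_conv snd_conv cos_sin_int_shift)
qed

lemma rot_diag_wave:
  "rot_diag (a * s) (b * s) c d *v wave a b (((1, \<theta>), t), \<psi>) = wave a b (((1, \<theta> + s), t), \<psi>)"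
proof -
  have e: "a * (\<theta> + s) = a * \<theta> + a * s" "b * (\<theta> + s + \<psi>) = b * (\<theta> + \<psi>) + b * s" by (simp_all add: algebra_simps)
  show ?thesis
    by (simp add: wave_def vec_eq_iff forall_8 matrix_vector_mult_def sum_8 rot_diag_def axis_def e cos_add sin_add
        algebra_simps del: distrib_left)
qed

text \<open>The one-parameter group with image \<open>circle_of n\<close>.\<close>

definition circle_elt :: "int^4 \<Rightarrow> real \<Rightarrow> (real^8^8) \<times> (real^8^8)" where
  "circle_elt n s = torus_elt (of_int (n$1) * s) (of_int (n$2) * s) (of_int (n$3) * s) (of_int (n$4) * s)"

lemma circle_of_range: "circle_of n = range (circle_elt n)"
  by (simp add: circle_of_eq circle_elt_def[abs_def])

lemma circle_elt_weights: "circle_elt n s =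
  (rot_diag (of_int (left_weights n $ 1) * s) (of_int (left_weights n $ 2) * s)
            (of_int (left_weights n $ 3) * s) (of_int (left_weights n $ 4) * s),
   rot_diag (of_int (right_weights n $ 1) * s) (of_int (right_weights n $ 2) * s)
            (of_int (right_weights n $ 3) * s) (of_int (right_weights n $ 4) * s))"
  by (simp add: circle_elt_def torus_elt_def left_weights_def right_weights_def algebra_simps)

lemma circle_elt_Spin8: "circle_elt n s \<in> carrier Spin8"
  by (simp add: circle_elt_def torus_elt_Spin8)

lemma circle_elt_0: "circle_elt n 0 = (mat 1, mat 1)"
  by (simp add: circle_elt_def torus_elt_def rot_diag_0)

lemma circle_elt_add: "circle_elt n (s + t) = circle_elt n s \<otimes>\<^bsub>Spin8\<^esub> circle_elt n t"
  by (simp add: circle_elt_def torus_elt_mult distrib_left)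

definition weight_square_sum :: "int^4 \<Rightarrow> int" where
  "weight_square_sum n = (\<Sum>i\<in>UNIV. (left_weights n $ i)\<^sup>2) + (\<Sum>i\<in>UNIV. (right_weights n $ i)\<^sup>2)"

definition circle_generator :: "int^4 \<Rightarrow> real^(8+8)^(8+8)" where
  "circle_generator n = block_matrix
  (rot_generator (of_int (left_weights n $ 1)) (of_int (left_weights n $ 2))
            (of_int (left_weights n $ 3)) (of_int (left_weights n $ 4)),
   rot_generator (of_int (right_weights n $ 1)) (of_int (right_weights n $ 2))
            (of_int (right_weights n $ 3)) (of_int (right_weights n $ 4)))"

lemma trace_circle_generator_square:
  "trace (circle_generator n ** circle_generator n) = - 2 * of_int (weight_square_sum n)"
  by (simp add: circle_generator_def trace_block_matrix_square trace_rot_generator_square weight_square_sum_def sum_4)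

lemma circle_elt_has_vector_derivative:
  "((\<lambda>s. block_matrix (circle_elt n s)) has_vector_derivative circle_generator n) (at 0)"
  unfolding circle_elt_weights circle_generator_def
  by (intro bounded_linear.has_vector_derivative[OF bounded_linear_block_matrix]
      has_vector_derivative_Pair rot_diag_has_vector_derivative)

text \<open>The 4-ball is \<open>wave\<close> in both factors, with the first two weights of each; the trace of the
  squared generator sees all eight weights.\<close>

theorem equivariant_diffeomorphism_weight_square_sum:
  assumes F: "diffeomorphism_on S7xS7 S7xS7 F"
    and eq: "\<And>s x. x \<in> S7xS7 \<Longrightarrow> F (spin_act (circle_elt n s) x) = spin_act (circle_elt m s) (F x)"
  shows "weight_square_sum n = weight_square_sum m"
proof -
  have M: "S7xS7 = sphere 0 1 \<times> sphere 0 1" by (simp add: S7xS7_def S7_def)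
  define G where "G = inv_into S7xS7 F"
  have b: "bij_betw F S7xS7 S7xS7" and sm: "smooth_map_on S7xS7 F" "smooth_map_on S7xS7 G"
    using F unfolding diffeomorphism_on_def G_def by blast+
  have img: "F ` (sphere 0 1 \<times> sphere 0 1) \<subseteq> sphere 0 1 \<times> sphere 0 1" "G ` (sphere 0 1 \<times> sphere 0 1) \<subseteq> sphere 0 1 \<times> sphere 0 1"
    using b bij_betw_inv_into[OF b] unfolding G_def M bij_betw_def by simp_all
  have inv: "G (F x) = x" "F (G x) = x" if "x \<in> sphere 0 1 \<times> sphere 0 1" for x
    using that bij_betw_inv_into_left[OF b, of x] bij_betw_inv_into_right[OF b, of x] unfolding G_def M by simp_all
  define \<Omega> where "\<Omega> = unstack -` off_axes"
  define f where "f = (\<lambda>v. stack (cone_extension F (unstack v)))"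
  define h where "h = (\<lambda>v. stack (cone_extension G (unstack v)))"
  define \<iota> where "\<iota> = (\<lambda>x. stack (wave (of_int (left_weights n $ 1)) (of_int (left_weights n $ 2)) x,
     wave (of_int (right_weights n $ 1)) (of_int (right_weights n $ 2)) x))"
  have o: "open \<Omega>" unfolding \<Omega>_def
    by (rule open_vimage[OF open_off_axes linear_continuous_on[OF bounded_linear_unstack]])
  have smooth: "Ck_on 3 (\<lambda>v. stack (cone_extension E (unstack v))) \<Omega>" if "smooth_map_on (sphere 0 1 \<times> sphere 0 1) E" for E
    by (rule Ck_on_linear_compose[OF bounded_linear_stack o
          Ck_on_compose[OF o open_off_axes _ Ck_on_cone_extension[OF that] Ck_on_linear[OF o bounded_linear_unstack]]])
      (simp add: \<Omega>_def image_subset_iff)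
  have "trace (circle_generator n ** circle_generator n) = trace (circle_generator m ** circle_generator m)"
  proof (rule equivariant_diffeomorphism_trace_square[where f = f and h = h and \<Omega> = \<Omega> and \<iota> = \<iota>
        and R = "\<lambda>s. block_matrix (circle_elt n s)" and R' = "\<lambda>s. block_matrix (circle_elt m s)"])
    show "open \<Omega>" by (rule o)
    show "Ck_on 3 f \<Omega>" "Ck_on 3 h \<Omega>"
      unfolding f_def h_def by (rule smooth[OF sm(1)[unfolded M]], rule smooth[OF sm(2)[unfolded M]])
    show "f x \<in> \<Omega>" "h x \<in> \<Omega>" "h (f x) = x" "f (h x) = x" if "x \<in> \<Omega>" for x
      using that img inv unfolding f_def h_def \<Omega>_def
      by (simp_all add: cone_extension_off_axes cone_extension_inverse)
    show "block_matrix (circle_elt n s) *v x \<in> \<Omega>" if "x \<in> \<Omega>" for s x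
      using that unfolding \<Omega>_def by (simp add: block_matrix_mult_vector spin_act_off_axes circle_elt_Spin8)
    show "f (block_matrix (circle_elt n s) *v x) = block_matrix (circle_elt m s) *v f x" if "x \<in> \<Omega>" for s x
      using that cone_extension_equivariant[OF circle_elt_Spin8, of "unstack x" F n s "circle_elt m s"] eq
      unfolding \<Omega>_def f_def by (simp add: block_matrix_mult_vector)
    show "((\<lambda>s. block_matrix (circle_elt n s)) has_vector_derivative circle_generator n) (at 0)"
      "((\<lambda>s. block_matrix (circle_elt m s)) has_vector_derivative circle_generator m) (at 0)"
      by (rule circle_elt_has_vector_derivative)+
    show "block_matrix (circle_elt n 0) = mat 1" "block_matrix (circle_elt m 0) = mat 1"
      by (simp_all add: circle_elt_0 block_matrix_one)
    show "Ck_on 2 \<iota> UNIV" unfolding \<iota>_def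
      by (intro Ck_on_linear_compose[OF bounded_linear_stack] Ck_on_Pair Ck_on_wave open_UNIV)
    show "\<iota> x \<in> \<Omega>" for x by (simp add: \<iota>_def \<Omega>_def off_axes_def wave_nonzero)
    fix r \<theta> t \<psi> s
    show "\<iota> (((0, \<theta>), t), \<psi>) = \<iota> (((0, 0), 0), 0)" unfolding \<iota>_def wave_boundary(1) ..
    show "\<iota> (((r, \<theta>), 0), \<psi>) = \<iota> (((r, \<theta>), 0), 0)" unfolding \<iota>_def wave_boundary(2)[of _ _ _ _ \<psi>] ..
    show "\<iota> (((r, \<theta>), pi/2), \<psi>) = \<iota> (((r, \<theta> + \<psi>), pi/2), 0)" unfolding \<iota>_def wave_boundary(3)[of _ _ _ _ \<psi>] ..
    show "\<iota> (((r, \<theta> + 2 * pi), t), \<psi>) = \<iota> (((r, \<theta>), t), \<psi>)" "\<iota> (((r, \<theta>), t), \<psi> + 2 * pi) = \<iota> (((r, \<theta>), t), \<psi>)"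
      unfolding \<iota>_def wave_periodic by (rule refl)+
    show "\<iota> (((1, \<theta> + s), t), \<psi>) = block_matrix (circle_elt n s) *v \<iota> (((1, \<theta>), t), \<psi>)"
      unfolding \<iota>_def block_matrix_mult_vector unstack_stack spin_act_def circle_elt_weights fst_conv snd_conv rot_diag_wave ..
  qed
  then show ?thesis unfolding trace_circle_generator_square by simp
qed

section \<open>Homomorphisms of the circle into the torus\<close>

text \<open>A differentiable homomorphism solves \<open>f' = f'(0) f\<close>, hence is an exponential; periodicity makes
  the exponent an integer.\<close>

lemma differentiable_circle_hom:
  fixes f :: "real \<Rightarrow> complex"
  assumes diff: "f differentiable (at 0)" and add: "\<And>s t. f (s + t) = f s * f t" and per: "f (2 * pi) = 1"
  shows "\<exists>k::int. \<forall>t. f t = cis (of_int k * t)"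
proof -
  obtain c where c: "(f has_vector_derivative c) (at 0)"
    using diff vector_derivative_works by blast
  have f0: "f 0 = 1" using add[of 0 "2 * pi"] per by simp
  have d: "(f has_vector_derivative f t * c) (at t)" for t
  proof -
    have "((\<lambda>s. s - t) has_vector_derivative 1) (at t)"
      by (auto intro!: derivative_eq_intros)
    then have "(f \<circ> (\<lambda>s. s - t) has_vector_derivative 1 *\<^sub>R c) (at t)"
      by (rule vector_diff_chain_at) (use c in simp)
    then have "((\<lambda>s. f t * f (s - t)) has_vector_derivative f t * c) (at t)"
      by (auto intro!: derivative_eq_intros simp: comp_def)
    moreover have "f t * f (s - t) = f s" for s using add[of t "s - t"] by simp
    ultimately show ?thesis by simp
  qed
  have e: "((\<lambda>s. exp (- c * of_real s)) has_vector_derivative exp (- c * of_real t) * (- c)) (at t)" for t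
    by (rule has_vector_derivative_real_field) (auto intro!: derivative_eq_intros)
  have "((\<lambda>s. f s * exp (- c * of_real s)) has_vector_derivative 0) (at t within UNIV)" for t
    using has_vector_derivative_mult[OF d e] by (simp add: algebra_simps)
  then obtain k where k: "\<And>t. f t * exp (- c * of_real t) = k"
    using has_vector_derivative_zero_constant[of UNIV "\<lambda>s. f s * exp (- c * of_real s)"] by auto
  have "k = 1" using k[of 0] f0 by simp
  then have f: "f t = exp (c * of_real t)" for t
    using k[of t] by (simp add: exp_minus field_simps)
  have "exp (c * of_real (2 * pi)) = 1" using f[of "2 * pi"] per by simp
  then obtain n :: int where "Re c = 0" "Im c * (2 * pi) = of_int (2 * n) * pi"
    unfolding exp_eq_1 by auto
  then have "Re c = 0" "Im c = of_int n" by simp_all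
  then have "c * of_real t = \<i> * of_real (of_int n * t)" for t
    by (simp add: complex_eq_iff)
  then have "f t = cis (of_int n * t)" for t by (simp only: f cis_conv_exp)
  then show ?thesis by blast
qed

text \<open>\<open>\<alpha>\<^sub>1\<close> and \<open>\<alpha>\<^sub>2\<close> are the angles of the first and last block of \<open>A\<close>, \<open>\<alpha>\<^sub>3\<close> and \<open>\<alpha>\<^sub>4\<close> those of the first
  two blocks of \<open>B\<close>.\<close>

definition torus_coords :: "(real^8^8) \<times> (real^8^8) \<Rightarrow> complex^4" where
  "torus_coords g = vector [Complex (fst g $ 1 $ 1) (fst g $ 2 $ 1), Complex (fst g $ 7 $ 7) (fst g $ 8 $ 7),
     Complex (snd g $ 1 $ 1) (snd g $ 2 $ 1), Complex (snd g $ 3 $ 3) (snd g $ 4 $ 3)]"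

lemma torus_coords_torus_elt: "torus_coords (torus_elt a1 a2 a3 a4) = vector [cis a1, cis a2, cis a3, cis a4]"
  by (simp add: torus_coords_def torus_elt_def rot_diag_def cis.code)

lemma torus_coords_circle_elt: "torus_coords (circle_elt n s) $ i = cis (of_int (n $ i) * s)"
  using exhaust_4[of i] by (auto simp: circle_elt_def torus_coords_torus_elt)

lemma torus_coords_mult:
  assumes "g \<in> T4" "h \<in> T4"
  shows "torus_coords (g \<otimes>\<^bsub>Spin8\<^esub> h) $ i = torus_coords g $ i * torus_coords h $ i"
  using assms exhaust_4[of i] by (auto simp: T4_eq torus_elt_mult torus_coords_torus_elt cis_mult)

lemma torus_coords_inject:
  assumes "g \<in> T4" "h \<in> T4" "torus_coords g = torus_coords h"
  shows "g = h"
proof -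
  obtain a1 a2 a3 a4 b1 b2 b3 b4 where e: "g = torus_elt a1 a2 a3 a4" "h = torus_elt b1 b2 b3 b4"
    using assms(1,2) unfolding T4_eq by blast
  have "cis a1 = cis b1" "cis a2 = cis b2" "cis a3 = cis b3" "cis a4 = cis b4"
    using assms(3) by (simp_all add: e torus_coords_torus_elt vec_eq_iff forall_4)
  then show ?thesis unfolding e by (intro torus_elt_periodic) (simp_all add: complex_eq_iff)
qed

lemma circle_elt_T4: "circle_elt n s \<in> T4"
  unfolding circle_elt_def T4_eq by blast

lemma bounded_linear_torus_coords: "bounded_linear (\<lambda>g. torus_coords g $ i)"
  unfolding linear_conv_bounded_linear[symmetric]
  using exhaust_4[of i] by (auto intro!: linearI simp: torus_coords_def complex_eq_iff)

lemma torus_hom: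
  assumes T: "\<And>s. \<Phi> s \<in> T4" and add: "\<And>s t. \<Phi> (s + t) = \<Phi> s \<otimes>\<^bsub>Spin8\<^esub> \<Phi> t"
    and per: "\<Phi> (2 * pi) = (mat 1, mat 1)" and diff: "\<Phi> differentiable (at 0)"
  shows "\<exists>m. \<forall>s. \<Phi> s = circle_elt m s"
proof -
  have "\<exists>k::int. \<forall>s. torus_coords (\<Phi> s) $ i = cis (of_int k * s)" for i
  proof (rule differentiable_circle_hom)
    show "(\<lambda>s. torus_coords (\<Phi> s) $ i) differentiable at 0"
      using differentiable_compose[OF bounded_linear_imp_differentiable[OF bounded_linear_torus_coords] diff] .
    show "torus_coords (\<Phi> (s + t)) $ i = torus_coords (\<Phi> s) $ i * torus_coords (\<Phi> t) $ i" for s t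
      unfolding add by (rule torus_coords_mult[OF T T])
    show "torus_coords (\<Phi> (2 * pi)) $ i = 1"
      using torus_coords_circle_elt[of 0 0 i] by (simp add: per circle_elt_0)
  qed
  then obtain k where k: "\<And>i s. torus_coords (\<Phi> s) $ i = cis (of_int (k i) * s)" by metis
  have "\<Phi> s = circle_elt (\<chi> i. k i) s" for s
    by (rule torus_coords_inject[OF T circle_elt_T4]) (simp add: vec_eq_iff k torus_coords_circle_elt)
  then show ?thesis by blast
qed

lemma smooth_map_on_curve_differentiable:
  assumes f: "smooth_map_on M f" and \<gamma>: "\<And>s::real. \<gamma> s \<in> M" "\<gamma> differentiable (at 0)"
  shows "(\<lambda>s. f (\<gamma> s)) differentiable (at 0)"
proof -
  obtain U h where U: "open U" "\<gamma> 0 \<in> U" "\<And>k. Ck_on k h U" "\<And>y. y \<in> M \<Longrightarrow> y \<in> U \<Longrightarrow> f y = h y"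
    using smooth_map_on_extension[OF f \<gamma>(1)] by blast
  have "h differentiable (at (\<gamma> 0))"
    using Ck_on_Suc_has_derivative[OF U(3) U(2)] by (rule differentiableI)
  then have "(\<lambda>s. h (\<gamma> s)) differentiable (at 0)"
    by (rule differentiable_compose) (rule \<gamma>(2))
  then obtain d where d: "((\<lambda>s. h (\<gamma> s)) has_derivative d) (at 0)"
    unfolding differentiable_def by blast
  have "eventually (\<lambda>s. \<gamma> s \<in> U) (at 0)"
    using differentiable_imp_continuous_within[OF \<gamma>(2)] U(1,2) by (metis isCont_def topological_tendstoD)
  then have "eventually (\<lambda>s. h (\<gamma> s) = f (\<gamma> s)) (at 0)"
    by (rule eventually_mono) (simp add: U(4) \<gamma>(1))
  then have "((\<lambda>s. f (\<gamma> s)) has_derivative d) (at 0)"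
    by (rule has_derivative_transform_eventually[OF d]) (simp_all add: U(2,4) \<gamma>(1))
  then show ?thesis by (rule differentiableI)
qed

lemma cos_eq_1_iff: "cos x = 1 \<longleftrightarrow> (\<exists>k::int. x = 2 * pi * of_int k)"
  using cos_one_2pi_int[of x] by (simp add: mult.commute mult.left_commute)

lemma pi_not_even_multiple: "pi \<noteq> 2 * pi * of_int k"
proof
  assume "pi = 2 * pi * of_int k"
  then have "of_int (2 * k) = (1::real)" by simp
  then have "2 * k = 1" by linarith
  then show False by presburger
qed

lemma cis_eq_1_iff: "cis x = 1 \<longleftrightarrow> cos x = 1"
  by (auto simp: complex_eq_iff cos_one_sin_zero)

lemma primitive_bezout:
  fixes n :: "int^4"
  assumes "Gcd (range (($) n)) = 1"
  obtains b :: "int^4" where "(\<Sum>i\<in>UNIV. b $ i * n $ i) = 1"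
proof -
  have "range (($) n) = {n$1, n$2, n$3, n$4}"
    unfolding UNIV_4 by simp
  then have g: "gcd (n$1) (gcd (n$2) (gcd (n$3) (n$4))) = 1" using assms by simp
  obtain u v where 1: "u * n$1 + v * gcd (n$2) (gcd (n$3) (n$4)) = 1" using g bezout_int by metis
  obtain u' v' where 2: "u' * n$2 + v' * gcd (n$3) (n$4) = gcd (n$2) (gcd (n$3) (n$4))" using bezout_int by metis
  obtain u'' v'' where 3: "u'' * n$3 + v'' * n$4 = gcd (n$3) (n$4)" using bezout_int by metis
  have "(\<Sum>i\<in>UNIV. (vector [u, v * u', v * v' * u'', v * v' * v''] :: int^4) $ i * n $ i) = 1"
    using 1 2 3 unfolding sum_4 vector_4 by algebra
  then show ?thesis by (rule that)
qed

lemma circle_elt_eq_one_iff: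
  assumes "Gcd (range (($) n)) = 1"
  shows "circle_elt n s = (mat 1, mat 1) \<longleftrightarrow> (\<exists>k::int. s = 2 * pi * of_int k)"
proof
  assume one: "circle_elt n s = (mat 1, mat 1)"
  have "\<exists>k::int. of_int (n $ i) * s = 2 * pi * of_int k" for i
    using one circle_elt_0[of n] torus_coords_circle_elt[of n s i] torus_coords_circle_elt[of n 0 i]
    by (simp add: cis_eq_1_iff cos_eq_1_iff[symmetric])
  then obtain k :: "4 \<Rightarrow> int" where k: "\<And>i. of_int (n $ i) * s = 2 * pi * of_int (k i)" by metis
  obtain b :: "int^4" where b: "(\<Sum>i\<in>UNIV. b $ i * n $ i) = 1" by (rule primitive_bezout[OF assms])
  have "s = of_int (\<Sum>i\<in>UNIV. b $ i * n $ i) * s" by (simp add: b)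
  also have "\<dots> = (\<Sum>i\<in>UNIV. of_int (b $ i) * (of_int (n $ i) * s))"
    by (simp add: sum_distrib_right mult.assoc)
  also have "\<dots> = 2 * pi * of_int (\<Sum>i\<in>UNIV. b $ i * k i)"
    unfolding k by (simp add: sum_distrib_left algebra_simps)
  finally show "\<exists>k::int. s = 2 * pi * of_int k" by blast
next
  assume "\<exists>k::int. s = 2 * pi * of_int k"
  then obtain k :: int where k: "s = 2 * pi * of_int k" by blast
  have "cis (of_int (n $ i) * s) = 1" for i
    unfolding cis_eq_1_iff cos_eq_1_iff k by (intro exI[of _ "n $ i * k"]) simp
  then have "circle_elt n s = circle_elt n 0"
    by (intro torus_coords_inject circle_elt_T4) (simp add: vec_eq_iff torus_coords_circle_elt)
  then show "circle_elt n s = (mat 1, mat 1)" by (simp add: circle_elt_0)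
qed

lemma circle_elt_differentiable: "circle_elt n differentiable (at s)"
  unfolding circle_elt_def[abs_def] torus_elt_def rot_diag_eq_planes
  by (auto intro!: differentiableI derivative_eq_intros)

lemma weight_square_sum_scale: "weight_square_sum (\<chi> i. l * n $ i) = l\<^sup>2 * weight_square_sum n"
  by (simp add: weight_square_sum_def sum_4 left_weights_def right_weights_def algebra_simps power2_eq_square)

text \<open>If \<open>m\<^sub>i s\<close> and \<open>n\<^sub>i u\<close> agree modulo \<open>2 \<pi>\<close> for all \<open>i\<close>, then \<open>(m\<^sub>i n\<^sub>j - m\<^sub>j n\<^sub>i) s\<close> is a multiple of
  \<open>2 \<pi>\<close>.  A non-zero value \<open>p\<close> of this minor is refuted by \<open>s = \<pi>/p\<close>.\<close>

lemma circle_contained_imp_parallel: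
  assumes "\<And>s. \<exists>u. circle_elt m s = circle_elt n u"
  shows "m $ i * n $ j = m $ j * n $ i"
proof (rule ccontr)
  define p where "p = m $ i * n $ j - m $ j * n $ i"
  define q where "q = pi / of_int p"
  assume "m $ i * n $ j \<noteq> m $ j * n $ i"
  then have "p \<noteq> 0" by (simp add: p_def)
  obtain u where u: "circle_elt m q = circle_elt n u" using assms by blast
  have "\<exists>k::int. of_int (m $ i) * q - of_int (n $ i) * u = 2 * pi * of_int k" for i
  proof -
    have "cis (of_int (m $ i) * q) = cis (of_int (n $ i) * u)"
      unfolding torus_coords_circle_elt[symmetric] u ..
    then have "cis (of_int (m $ i) * q - of_int (n $ i) * u) = 1"
      by (simp add: cis_divide[symmetric])
    then show ?thesis unfolding cis_eq_1_iff cos_eq_1_iff .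
  qed
  then obtain k :: "4 \<Rightarrow> int" where k: "\<And>i. of_int (m $ i) * q - of_int (n $ i) * u = 2 * pi * of_int (k i)" by metis
  have "pi = of_int p * q" using \<open>p \<noteq> 0\<close> by (simp add: q_def)
  also have "\<dots> = of_int (n $ j) * (of_int (m $ i) * q - of_int (n $ i) * u)
      - of_int (n $ i) * (of_int (m $ j) * q - of_int (n $ j) * u)"
    by (simp add: p_def algebra_simps)
  also have "\<dots> = 2 * pi * of_int (n $ j * k i - n $ i * k j)"
    unfolding k by (simp add: algebra_simps)
  finally show False using pi_not_even_multiple by blast
qed

text \<open>The composition of \<open>\<phi>\<close> with the parametrization is a one-parameter group with integral weights \<open>m\<close>
  inside the circle of \<open>n'\<close>, so \<open>m = l n'\<close> with \<open>l\<close> an integer, as \<open>n'\<close> is primitive.  Injectivity of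
  \<open>\<phi>\<close> forces \<open>l = \<plusminus>1\<close>.\<close>

lemma circle_iso_weights:
  assumes n: "Gcd (range (($) n)) = 1" and n': "Gcd (range (($) n')) = 1"
    and \<phi>: "lie_iso (Spin8\<lparr>carrier := circle_of n\<rparr>) (Spin8\<lparr>carrier := circle_of n'\<rparr>) \<phi>"
  obtains m where "\<And>s. \<phi> (circle_elt n s) = circle_elt m s" "weight_square_sum m = weight_square_sum n'"
proof -
  have iso: "\<phi> \<in> iso (Spin8\<lparr>carrier := circle_of n\<rparr>) (Spin8\<lparr>carrier := circle_of n'\<rparr>)"
    and smooth: "smooth_map_on (circle_of n) \<phi>"
    using \<phi> by (auto simp: lie_iso_def diffeomorphism_on_def)
  have mem: "circle_elt n s \<in> circle_of n" for n s by (auto simp: circle_of_range)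
  have img: "\<phi> (circle_elt n s) \<in> circle_of n'" for s
    using iso mem by (auto simp: iso_def bij_betw_def)
  have inj: "inj_on \<phi> (circle_of n)" using iso by (simp add: iso_def bij_betw_def)
  have mult: "\<phi> (circle_elt n (s + t)) = \<phi> (circle_elt n s) \<otimes>\<^bsub>Spin8\<^esub> \<phi> (circle_elt n t)" for s t
    unfolding circle_elt_add using iso mem[of n] by (auto simp: iso_def hom_def)
  have one: "\<phi> (mat 1, mat 1) = (mat 1, mat 1)"
  proof -
    have g: "group (Spin8\<lparr>carrier := circle_of k\<rparr>)" for k
      using group.subgroup_imp_group[OF group.subgroup_imp_group[OF group_Spin8 subgroup_T4] subgroup_circle_of] by simp
    have "\<phi> \<one>\<^bsub>Spin8\<lparr>carrier := circle_of n\<rparr>\<^esub> = \<one>\<^bsub>Spin8\<lparr>carrier := circle_of n'\<rparr>\<^esub>"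
      using iso by (intro hom_one g) (simp add: iso_def)
    then show ?thesis by (simp add: one_Spin8)
  qed
  have T4: "circle_of n' \<subseteq> T4" using circle_elt_T4 by (auto simp: circle_of_range)
  have "\<exists>m. \<forall>s. \<phi> (circle_elt n s) = circle_elt m s"
  proof (rule torus_hom)
    show "\<phi> (circle_elt n s) \<in> T4" for s using img T4 by blast
    have "circle_elt n (2 * pi) = (mat 1, mat 1)"
      unfolding circle_elt_eq_one_iff[OF n] by (intro exI[of _ 1]) simp
    then show "\<phi> (circle_elt n (2 * pi)) = (mat 1, mat 1)" by (simp add: one)
    show "(\<lambda>s. \<phi> (circle_elt n s)) differentiable at 0"
      by (rule smooth_map_on_curve_differentiable[OF smooth mem circle_elt_differentiable])
  qed (rule mult)
  then obtain m where m: "\<And>s. \<phi> (circle_elt n s) = circle_elt m s" by blast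
  have "\<exists>u. circle_elt m s = circle_elt n' u" for s
    using img[of s] unfolding m circle_of_range by blast
  then have par: "m $ i * n' $ j = m $ j * n' $ i" for i j by (rule circle_contained_imp_parallel)
  obtain b :: "int^4" where b: "(\<Sum>i\<in>UNIV. b $ i * n' $ i) = 1" by (rule primitive_bezout[OF n'])
  define l where "l = (\<Sum>i\<in>UNIV. b $ i * m $ i)"
  have "m $ i = l * n' $ i" for i
  proof -
    have "m $ i = (\<Sum>j\<in>UNIV. b $ j * n' $ j) * m $ i" by (simp add: b)
    also have "\<dots> = (\<Sum>j\<in>UNIV. b $ j * (m $ i * n' $ j))" by (simp add: sum_distrib_left sum_distrib_right ac_simps)
    also have "\<dots> = l * n' $ i" unfolding par[of i] by (simp add: l_def sum_distrib_left sum_distrib_right ac_simps)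
    finally show ?thesis .
  qed
  then have ml: "m = (\<chi> i. l * n' $ i)" by (simp add: vec_eq_iff)
  have ker: "\<exists>k::int. s = 2 * pi * of_int k" if "circle_elt m s = (mat 1, mat 1)" for s
  proof -
    have "\<phi> (circle_elt n s) = \<phi> (circle_elt n 0)" using that by (simp add: m circle_elt_0 one)
    then have "circle_elt n s = (mat 1, mat 1)"
      using inj_onD[OF inj _ mem mem] by (metis circle_elt_0)
    then show ?thesis by (simp add: circle_elt_eq_one_iff[OF n])
  qed
  have scale: "circle_elt m s = circle_elt n' (of_int l * s)" for s
    by (simp add: ml circle_elt_def ac_simps)
  have l0: "l \<noteq> 0"
  proof
    assume "l = 0"
    then show False using ker[of pi] pi_not_even_multiple by (auto simp: scale circle_elt_0)
  qed
  have "circle_elt m (2 * pi / of_int l) = (mat 1, mat 1)"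
    unfolding scale circle_elt_eq_one_iff[OF n'] using l0 by (intro exI[of _ 1]) simp
  then obtain k :: int where "2 * pi / of_int l = 2 * pi * of_int k" using ker by blast
  then have "of_int (k * l) = (1::real)" using l0 by (simp add: field_simps)
  then have "k * l = 1" by linarith
  then have "l\<^sup>2 = 1" using zmult_eq_1_iff[of k l] by auto
  then have "weight_square_sum m = weight_square_sum n'" unfolding ml weight_square_sum_scale by simp
  then show ?thesis using that m by blast
qed

theorem equivalent_circles_weight_square_sum:
  assumes "Gcd (range (($) n)) = 1" "Gcd (range (($) n')) = 1"
    and "equivalent_actions (Spin8\<lparr>carrier := circle_of n\<rparr>) S7xS7 spin_act
                        (Spin8\<lparr>carrier := circle_of n'\<rparr>) S7xS7 spin_act"
  shows "weight_square_sum n = weight_square_sum n'"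
proof -
  obtain \<phi> F where \<phi>: "lie_iso (Spin8\<lparr>carrier := circle_of n\<rparr>) (Spin8\<lparr>carrier := circle_of n'\<rparr>) \<phi>"
    and F: "diffeomorphism_on S7xS7 S7xS7 F"
    and eq: "\<And>g x. g \<in> circle_of n \<Longrightarrow> x \<in> S7xS7 \<Longrightarrow> F (spin_act g x) = spin_act (\<phi> g) (F x)"
    using assms(3) unfolding equivalent_actions_def by auto
  obtain m where m: "\<And>s. \<phi> (circle_elt n s) = circle_elt m s" "weight_square_sum m = weight_square_sum n'"
    using circle_iso_weights[OF assms(1,2) \<phi>] by blast
  have "weight_square_sum n = weight_square_sum m"
    by (rule equivariant_diffeomorphism_weight_square_sum[OF F]) (simp add: eq m(1)[symmetric] circle_of_range)
  then show ?thesis using m(2) by simp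
qed

section \<open>Free circle actions on the product of two 7-spheres\<close>

lemma rotation_fixed_point:
  fixes x y :: real
  assumes "cos a * x - sin a * y = x" "sin a * x + cos a * y = y" "cos a \<noteq> 1"
  shows "x = 0" "y = 0"
proof -
  have e: "2 - 2 * cos a = (cos a - 1)\<^sup>2 + (sin a)\<^sup>2"
    using sin_cos_squared_add2[of a] by (simp add: power2_diff)
  have "x * (2 - 2 * cos a) = (cos a - 1) * (cos a * x - sin a * y - x) + sin a * (sin a * x + cos a * y - y)"
    unfolding e by algebra
  moreover have "y * (2 - 2 * cos a) = (cos a - 1) * (sin a * x + cos a * y - y) - sin a * (cos a * x - sin a * y - x)"
    unfolding e by algebra
  ultimately have "x * (2 - 2 * cos a) = 0" "y * (2 - 2 * cos a) = 0"
    by (simp_all add: assms(1,2))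
  moreover have "2 - 2 * cos a \<noteq> 0" using assms(3) by simp
  ultimately show "x = 0" "y = 0" by auto
qed

lemma rot_diag_fixed_iff:
  "(\<exists>x\<in>S7. rot_diag a b c d *v x = x) \<longleftrightarrow> cos a = 1 \<or> cos b = 1 \<or> cos c = 1 \<or> cos d = 1"
proof
  assume "\<exists>x\<in>S7. rot_diag a b c d *v x = x"
  then obtain x where x: "norm x = 1" "rot_diag a b c d *v x = x" by (auto simp: S7_def)
  show "cos a = 1 \<or> cos b = 1 \<or> cos c = 1 \<or> cos d = 1"
  proof (rule ccontr)
    assume "\<not> ?thesis"
    then have "x = 0"
      using x(2) rotation_fixed_point[of a "x$1" "x$2"] rotation_fixed_point[of b "x$3" "x$4"]
        rotation_fixed_point[of c "x$5" "x$6"] rotation_fixed_point[of d "x$7" "x$8"]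
      by (simp add: vec_eq_iff forall_8 matrix_vector_mult_def sum_8 rot_diag_def)
    then show False using x(1) by simp
  qed
next
  have S: "axis i 1 \<in> S7" for i by (simp add: S7_def)
  have "rot_diag a b c d *v axis 1 1 = axis 1 1" if "cos a = 1"
    using that cos_one_sin_zero[OF that]
    by (simp add: vec_eq_iff forall_8 matrix_vector_mult_def sum_8 rot_diag_def axis_def)
  moreover have "rot_diag a b c d *v axis 3 1 = axis 3 1" if "cos b = 1"
    using that cos_one_sin_zero[OF that]
    by (simp add: vec_eq_iff forall_8 matrix_vector_mult_def sum_8 rot_diag_def axis_def)
  moreover have "rot_diag a b c d *v axis 5 1 = axis 5 1" if "cos c = 1"
    using that cos_one_sin_zero[OF that]
    by (simp add: vec_eq_iff forall_8 matrix_vector_mult_def sum_8 rot_diag_def axis_def)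
  moreover have "rot_diag a b c d *v axis 7 1 = axis 7 1" if "cos d = 1"
    using that cos_one_sin_zero[OF that]
    by (simp add: vec_eq_iff forall_8 matrix_vector_mult_def sum_8 rot_diag_def axis_def)
  moreover assume "cos a = 1 \<or> cos b = 1 \<or> cos c = 1 \<or> cos d = 1"
  ultimately show "\<exists>x\<in>S7. rot_diag a b c d *v x = x" using S by blast
qed

lemma gcd_eq_1_iff_common_period:
  fixes p q :: int
  shows "gcd p q = 1 \<longleftrightarrow>
    (\<forall>s::real. cos (of_int p * s) = 1 \<and> cos (of_int q * s) = 1 \<longrightarrow> (\<exists>k::int. s = 2 * pi * of_int k))"
proof (intro iffI allI impI)
  fix s :: real assume g: "gcd p q = 1" and "cos (of_int p * s) = 1 \<and> cos (of_int q * s) = 1"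
  then obtain k l :: int where kl: "of_int p * s = 2 * pi * of_int k" "of_int q * s = 2 * pi * of_int l"
    unfolding cos_eq_1_iff by blast
  obtain u v where uv: "u * p + v * q = 1" using g bezout_int by metis
  have "s = of_int (u * p + v * q) * s" by (simp add: uv)
  also have "\<dots> = of_int u * (of_int p * s) + of_int v * (of_int q * s)" by (simp add: algebra_simps)
  also have "\<dots> = 2 * pi * of_int (u * k + v * l)" unfolding kl by (simp add: algebra_simps)
  finally show "\<exists>k::int. s = 2 * pi * of_int k" by blast
next
  assume H: "\<forall>s::real. cos (of_int p * s) = 1 \<and> cos (of_int q * s) = 1 \<longrightarrow> (\<exists>k::int. s = 2 * pi * of_int k)"
  show "gcd p q = 1"
  proof (cases "gcd p q = 0")
    case True
    then have "\<exists>k::int. pi = 2 * pi * of_int k" using H[rule_format, of pi] by simp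
    then show ?thesis using pi_not_even_multiple by blast
  next
    case False
    let ?d = "gcd p q"
    have "cos (of_int r * (2 * pi / of_int ?d)) = 1" if d: "?d dvd r" for r
    proof -
      obtain r' where r: "r = ?d * r'" using d by (rule dvdE)
      have "of_int r * (2 * pi / of_int ?d) = 2 * pi * of_int r'"
        using False by (subst (1) r) auto
      then show ?thesis unfolding cos_eq_1_iff by blast
    qed
    then obtain k :: int where "2 * pi / of_int ?d = 2 * pi * of_int k" using H by blast
    then have "of_int (k * ?d) = (1::real)" using False by (simp add: field_simps)
    then have "k * ?d = 1" by linarith
    then have "?d dvd 1" by (metis dvd_triv_right)
    then show ?thesis by simp
  qed
qed

lemma exists_4: "(\<exists>i::4. P i) \<longleftrightarrow> P 1 \<or> P 2 \<or> P 3 \<or> P 4"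
  by (metis exhaust_4)

lemma circle_elt_fixed_iff:
  "(\<exists>p\<in>S7xS7. spin_act (circle_elt n s) p = p) \<longleftrightarrow>
    (\<exists>i j. cos (of_int (left_weights n $ i) * s) = 1 \<and> cos (of_int (right_weights n $ j) * s) = 1)"
proof -
  have "(\<exists>p\<in>S7xS7. spin_act (circle_elt n s) p = p) \<longleftrightarrow>
    (\<exists>x\<in>S7. fst (circle_elt n s) *v x = x) \<and> (\<exists>y\<in>S7. snd (circle_elt n s) *v y = y)"
    by (auto simp: S7xS7_def spin_act_def)
  also have "\<dots> \<longleftrightarrow> (\<exists>i. cos (of_int (left_weights n $ i) * s) = 1) \<and> (\<exists>j. cos (of_int (right_weights n $ j) * s) = 1)"
    unfolding circle_elt_weights fst_conv snd_conv rot_diag_fixed_iff exists_4 ..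
  finally show ?thesis by blast
qed

theorem circle_acts_freely_iff:
  assumes n: "Gcd (range (($) n)) = 1"
  shows "acts_freely (Spin8\<lparr>carrier := circle_of n\<rparr>) S7xS7 spin_act \<longleftrightarrow>
    (\<forall>i j. gcd (left_weights n $ i) (right_weights n $ j) = 1)"
proof -
  have "acts_freely (Spin8\<lparr>carrier := circle_of n\<rparr>) S7xS7 spin_act \<longleftrightarrow>
    (\<forall>s. (\<exists>p\<in>S7xS7. spin_act (circle_elt n s) p = p) \<longrightarrow> circle_elt n s = (mat 1, mat 1))"
    by (auto simp: acts_freely_def circle_of_range one_Spin8)
  also have "\<dots> \<longleftrightarrow> (\<forall>i j. gcd (left_weights n $ i) (right_weights n $ j) = 1)"
    unfolding circle_elt_fixed_iff circle_elt_eq_one_iff[OF n] gcd_eq_1_iff_common_period by blast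
  finally show ?thesis .
qed

lemma gcd_eq_1I: "u * a + v * b = 1 \<Longrightarrow> gcd a b = 1" for a b :: int
  by (metis dvd_add dvd_mult gcd_dvd1 gcd_dvd2 gcd_ge_0_int zdvd1_eq abs_of_nonneg)

lemma diffeomorphism_on_id: "diffeomorphism_on N N (\<lambda>x. x)"
proof -
  have "smooth_map_on N (\<lambda>x. x)"
  proof (rule smooth_map_onI)
    show "Ck_on k (\<lambda>x. x) UNIV" for k
      by (rule Ck_on_linear[OF open_UNIV bounded_linear_ident])
  qed auto
  then show ?thesis
    by (intro diffeomorphism_onI[where g = "\<lambda>x. x"]) auto
qed

lemma equivalent_actions_refl: "equivalent_actions L M act L M act"
  unfolding equivalent_actions_def lie_iso_def
  by (intro exI[of _ "\<lambda>x. x"]) (auto simp: iso_def hom_def bij_betw_def diffeomorphism_on_id)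

text \<open>For \<open>(2, 6k + 2, 1, -1)\<close> the left weights are \<open>2, 2, 6k + 4, 6k + 2\<close> and the right weights
  \<open>1, -1, 6k + 1, 6k + 5\<close>.\<close>

definition free_family :: "nat \<Rightarrow> int^4" where
  "free_family k = vector [2, 6 * int k + 2, 1, - 1]"

lemma free_family_primitive: "Gcd (range (($) (free_family k))) = 1"
proof -
  have "Gcd (range (($) (free_family k))) dvd free_family k $ 3" by (intro Gcd_dvd) simp
  then show ?thesis by (simp add: free_family_def)
qed

lemma free_family_free: "free_family k \<in> free_tuples"
proof -
  have "gcd 2 (6 * int k + 1) = 1" by (rule gcd_eq_1I[of "- 3 * int k" _ 1]) simp
  moreover have "gcd 2 (6 * int k + 5) = 1" by (rule gcd_eq_1I[of "- 3 * int k - 2" _ 1]) simp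
  moreover have "gcd (6 * int k + 4) (6 * int k + 1) = 1"
    by (rule gcd_eq_1I[of "- 2 * int k" _ "1 + 2 * int k"]) (simp add: algebra_simps)
  moreover have "gcd (6 * int k + 4) (6 * int k + 5) = 1" by (rule gcd_eq_1I[of "- 1" _ 1]) simp
  moreover have "gcd (6 * int k + 2) (6 * int k + 1) = 1" by (rule gcd_eq_1I[of 1 _ "- 1"]) simp
  moreover have "gcd (6 * int k + 2) (6 * int k + 5) = 1"
    by (rule gcd_eq_1I[of "- 2 * int k - 2" _ "2 * int k + 1"]) (simp add: algebra_simps)
  ultimately have "\<forall>i j. gcd (left_weights (free_family k) $ i) (right_weights (free_family k) $ j) = 1"
    by (simp add: forall_4 left_weights_def right_weights_def free_family_def add.commute)
  then show ?thesis
    using circle_acts_freely_iff[OF free_family_primitive] free_family_primitive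
    by (simp add: free_tuples_def)
qed

lemma weight_square_sum_free_family: "weight_square_sum (free_family k) = 144 * (int k * (int k + 1)) + 56"
  by (simp add: weight_square_sum_def sum_4 left_weights_def right_weights_def free_family_def
      algebra_simps power2_eq_square)

theorem infinitely_many_free_circles: "infinite (free_tuples // free_tuples_equiv)"
proof
  assume fin: "finite (free_tuples // free_tuples_equiv)"
  define c where "c = (\<lambda>k. free_tuples_equiv `` {free_family k})"
  have "inj c"
  proof (rule injI)
    fix k l assume "c k = c l"
    moreover have "free_family l \<in> c l"
      by (simp add: c_def free_tuples_equiv_def free_family_free equivalent_actions_refl)
    ultimately have "free_family l \<in> c k" by simp
    then have "weight_square_sum (free_family k) = weight_square_sum (free_family l)"
      by (intro equivalent_circles_weight_square_sum free_family_primitive) (simp add: c_def free_tuples_equiv_def)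
    then have "int k * (int k + 1) = int l * (int l + 1)"
      unfolding weight_square_sum_free_family by simp
    then have "(int k - int l) * (int k + int l + 1) = 0" by (simp add: algebra_simps)
    then show "k = l" by auto
  qed
  moreover have "range c \<subseteq> free_tuples // free_tuples_equiv"
    unfolding c_def by (auto intro: quotientI free_family_free)
  ultimately show False using fin range_inj_infinite finite_subset by blast
qed

section \<open>Free circle actions on the product of a 6-sphere and a 7-sphere\<close>

lemma cis_Arg_unit: "norm z = 1 \<Longrightarrow> cis (Arg z) = z"
  using cis_Arg[of z] by (cases "z = 0") (auto simp: sgn_div_norm)

lemma group_unit_circle: "group unit_circle"
proof (rule groupI)
  fix z assume "z \<in> carrier unit_circle"
  then have "norm z = 1" "z \<noteq> 0" by (auto simp: unit_circle_def)
  then show "\<exists>w\<in>carrier unit_circle. w \<otimes>\<^bsub>unit_circle\<^esub> z = \<one>\<^bsub>unit_circle\<^esub>"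
    by (intro bexI[of _ "inverse z"]) (simp_all add: unit_circle_def norm_inverse)
qed (auto simp: unit_circle_def norm_mult)

text \<open>The inverse of a Lie group isomorphism to the unit circle, composed with \<open>cis\<close>, is a differentiable
  one-parameter group in the torus, hence of the form \<open>circle_elt m\<close>.\<close>

lemma circle_subgroup_parametrization:
  assumes "circle_subgroup S (Spin7\<lparr>carrier := T3\<rparr>)"
  shows "\<exists>\<phi> m. lie_iso (Spin7\<lparr>carrier := S\<rparr>) unit_circle \<phi> \<and> m $ 1 = 0 \<and> S = circle_of m
    \<and> (\<forall>s. \<phi> (circle_elt m s) = cis s)"
proof -
  obtain \<phi> where \<phi>: "lie_iso (Spin7\<lparr>carrier := S\<rparr>) unit_circle \<phi>" and sub: "subgroup S (Spin7\<lparr>carrier := T3\<rparr>)"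
    using assms by (auto simp: circle_subgroup_def)
  have S: "S \<subseteq> T3" using subgroup.subset[OF sub] by simp
  have gS: "group (Spin7\<lparr>carrier := S\<rparr>)"
    using group.subgroup_imp_group[OF group.subgroup_imp_group[OF group_Spin7 subgroup_T3] sub] by simp
  have iso: "\<phi> \<in> iso (Spin7\<lparr>carrier := S\<rparr>) unit_circle" using \<phi> by (simp add: lie_iso_def)
  define \<psi> where "\<psi> = inv_into S \<phi>"
  have \<psi>: "lie_iso unit_circle (Spin7\<lparr>carrier := S\<rparr>) \<psi>"
    using lie_iso_inv[OF gS \<phi>] by (simp add: \<psi>_def)
  then have iso': "\<psi> \<in> iso unit_circle (Spin7\<lparr>carrier := S\<rparr>)" and smooth: "smooth_map_on (sphere 0 1) \<psi>"
    by (auto simp: lie_iso_def diffeomorphism_on_def unit_circle_def)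
  have b: "bij_betw \<phi> S (sphere 0 1)" using iso by (simp add: iso_def unit_circle_def)
  have cis: "cis s \<in> sphere 0 1" for s by simp
  have mem: "\<psi> (cis s) \<in> S" for s
    using bij_betw_inv_into[OF b] cis unfolding \<psi>_def bij_betw_def by blast
  have add: "\<psi> (cis (s + t)) = \<psi> (cis s) \<otimes>\<^bsub>Spin8\<^esub> \<psi> (cis t)" for s t
    using iso' cis[of s] cis[of t] by (simp add: iso_def hom_def unit_circle_def Spin7_simps cis_mult[symmetric])
  have "\<exists>m. \<forall>s. \<psi> (cis s) = circle_elt m s"
  proof (rule torus_hom)
    show "\<psi> (cis s) \<in> T4" for s using mem S T3_subset_T4 by blast
    have "\<psi> \<one>\<^bsub>unit_circle\<^esub> = \<one>\<^bsub>Spin7\<lparr>carrier := S\<rparr>\<^esub>"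
      using iso' by (intro hom_one group_unit_circle gS) (simp add: iso_def)
    then show "\<psi> (cis (2 * pi)) = (mat 1, mat 1)"
      by (simp add: unit_circle_def Spin7_simps one_Spin8)
    have "cis differentiable (at 0)"
      unfolding differentiable_def by (rule exI) (rule has_derivative_cis[OF has_derivative_ident])
    then show "(\<lambda>s. \<psi> (cis s)) differentiable at 0"
      by (rule smooth_map_on_curve_differentiable[OF smooth cis])
  qed (rule add)
  then obtain m where m: "\<And>s. \<psi> (cis s) = circle_elt m s" by blast
  have \<phi>m: "\<phi> (circle_elt m s) = cis s" for s
    using bij_betw_inv_into_right[OF b cis[of s]] unfolding m[symmetric] \<psi>_def .
  have "S = circle_of m"
  proof
    show "circle_of m \<subseteq> S" using mem by (auto simp: circle_of_range m)
    show "S \<subseteq> circle_of m"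
    proof
      fix g assume g: "g \<in> S"
      then have "norm (\<phi> g) = 1" using b by (auto simp: bij_betw_def)
      then have "\<phi> g = cis (Arg (\<phi> g))" by (simp add: cis_Arg_unit)
      then have "g = circle_elt m (Arg (\<phi> g))"
        using bij_betw_inv_into_left[OF b g] unfolding m[symmetric] \<psi>_def by metis
      then show "g \<in> circle_of m" by (auto simp: circle_of_range)
    qed
  qed
  moreover have "m $ 1 = 0"
  proof (rule ccontr)
    assume n0: "m $ 1 \<noteq> 0"
    have "circle_elt m (pi / of_int (m $ 1)) \<in> T3" using mem S unfolding m by blast
    then have "torus_coords (circle_elt m (pi / of_int (m $ 1))) $ 1 = 1"
      by (auto simp: T3_eq torus_coords_torus_elt)
    then show False using n0 by (simp add: torus_coords_circle_elt)
  qed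
  ultimately show ?thesis using \<phi> \<phi>m by (intro exI[of _ \<phi>] exI[of _ m] conjI allI)
qed

text \<open>With \<open>\<alpha>\<^sub>1 = 0\<close> the first component fixes the second basis vector \<open>i\<close>, so freeness on the product
  means that no right weight has a period in common with the weight \<open>0\<close>.\<close>

lemma free_circle_right_weights:
  assumes \<phi>: "\<And>s. \<phi> (circle_elt m s) = cis s" and m1: "m $ 1 = 0"
    and free: "acts_freely (Spin7\<lparr>carrier := circle_of m\<rparr>) S6xS7 spin_act"
  shows "right_weights m $ j = 1 \<or> right_weights m $ j = - 1"
proof -
  have "gcd 0 (right_weights m $ j) = 1"
    unfolding gcd_eq_1_iff_common_period
  proof (intro allI impI)
    fix s :: real assume "cos (of_int 0 * s) = 1 \<and> cos (of_int (right_weights m $ j) * s) = 1"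
    then have "\<exists>y\<in>S7. snd (circle_elt m s) *v y = y"
      unfolding circle_elt_weights snd_conv rot_diag_fixed_iff using exhaust_4[of j] by auto
    then obtain y where y: "y \<in> S7" "snd (circle_elt m s) *v y = y" by blast
    have x: "fst (circle_elt m s) *v axis 2 1 = axis 2 1"
      by (simp add: circle_elt_def torus_elt_def m1 vec_eq_iff forall_8 matrix_vector_mult_def sum_8 rot_diag_def axis_def)
    have "(axis 2 1, y) \<in> S6xS7"
    proof -
      have "axis 2 1 \<in> S7" by (simp add: S7_def)
      moreover have "oct_Re (axis 2 1) = 0" by (simp add: oct_Re_def axis_def)
      ultimately show ?thesis using y(1) by (simp add: S6xS7_def S7xS7_def)
    qed
    moreover have "spin_act (circle_elt m s) (axis 2 1, y) = (axis 2 1, y)"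
      by (simp add: spin_act_def x y(2))
    moreover have "circle_elt m s \<in> circle_of m" by (auto simp: circle_of_range)
    ultimately have "circle_elt m s = (mat 1, mat 1)"
      using free unfolding acts_freely_def by (auto simp: Spin7_simps one_Spin8)
    then have "cis s = cis 0" using \<phi>[of s] \<phi>[of 0] by (simp add: circle_elt_0)
    then show "\<exists>k::int. s = 2 * pi * of_int k" by (simp add: cis_eq_1_iff cos_eq_1_iff)
  qed
  then show ?thesis by auto
qed

lemma free_circle_weights:
  assumes m1: "m $ 1 = 0" and r: "\<And>j. right_weights m $ j = 1 \<or> right_weights m $ j = - 1"
  obtains "left_weights m $ 3 = 0" "left_weights m $ 4 = 0" "left_weights m $ 2 = 2 \<or> left_weights m $ 2 = - 2"
  | "left_weights m $ 2 = 0" "left_weights m $ 4 = 0" "left_weights m $ 3 = 2 \<or> left_weights m $ 3 = - 2"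
  | "left_weights m $ 2 = 0" "left_weights m $ 3 = 0" "left_weights m $ 4 = 2 \<or> left_weights m $ 4 = - 2"
proof -
  have "(left_weights m $ 3 = 0 \<and> left_weights m $ 4 = 0 \<and> (left_weights m $ 2 = 2 \<or> left_weights m $ 2 = - 2)) \<or>
    (left_weights m $ 2 = 0 \<and> left_weights m $ 4 = 0 \<and> (left_weights m $ 3 = 2 \<or> left_weights m $ 3 = - 2)) \<or>
    (left_weights m $ 2 = 0 \<and> left_weights m $ 3 = 0 \<and> (left_weights m $ 4 = 2 \<or> left_weights m $ 4 = - 2))"
    using r[of 1] r[of 2] r[of 3] r[of 4] unfolding left_weights_def right_weights_def vector_4 m1 by (elim disjE) auto
  then show ?thesis using that by blast
qed

definition signed_permutation :: "('n \<Rightarrow> 'n) \<Rightarrow> ('n \<Rightarrow> real) \<Rightarrow> real^'n \<Rightarrow> real^'n" where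
  "signed_permutation \<sigma> e x = (\<chi> k. e k * x $ \<sigma> k)"

lemma bounded_linear_signed_permutation: "bounded_linear (signed_permutation \<sigma> e)"
  unfolding linear_conv_bounded_linear[symmetric]
  by (rule linearI) (simp_all add: signed_permutation_def vec_eq_iff algebra_simps)

lemma signed_permutation_involution:
  assumes "\<And>k. \<sigma> (\<sigma> k) = k" "\<And>k. e k * e (\<sigma> k) = 1"
  shows "signed_permutation \<sigma> e (signed_permutation \<sigma> e x) = x"
  using assms by (simp add: signed_permutation_def vec_eq_iff mult.assoc[symmetric])

lemma norm_signed_permutation:
  assumes "\<And>k. \<sigma> (\<sigma> k) = k" "\<And>k. (e k)\<^sup>2 = 1"
  shows "norm (signed_permutation \<sigma> e x) = norm x"
proof -
  have "(\<Sum>k\<in>UNIV. (x $ \<sigma> k)\<^sup>2) = (\<Sum>k\<in>UNIV. (x $ k)\<^sup>2)"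
    by (rule sum.reindex_bij_witness[of _ \<sigma> \<sigma>]) (simp_all add: assms(1))
  then show ?thesis
    by (simp add: norm_vec_def L2_set_def signed_permutation_def power_mult_distrib assms(2))
qed

text \<open>The common normal form of the free circle actions: left weights \<open>0, 2, 0, 0\<close> and right weights
  \<open>1, 1, 1, 1\<close>.  It does not come from a circle in the maximal torus of \<open>Spin8\<close>.\<close>

definition model_act :: "complex \<Rightarrow> octonion \<times> octonion \<Rightarrow> octonion \<times> octonion" where
  "model_act z p = spin_act (rot_diag 0 (2 * Arg z) 0 0, rot_diag (Arg z) (Arg z) (Arg z) (Arg z)) p"

lemma model_act_cis: "model_act (cis s) p = spin_act (rot_diag 0 (2 * s) 0 0, rot_diag s s s s) p"
proof -
  have "cis (Arg (cis s)) = cis s" by (rule cis_Arg_unit) simp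
  then have "cos (Arg (cis s)) = cos s" "sin (Arg (cis s)) = sin s" by (simp_all add: complex_eq_iff)
  then show ?thesis by (simp add: model_act_def rot_diag_def cos_double sin_double)
qed

lemma signed_permutation_S6xS7:
  assumes "\<And>k. \<sigma> (\<sigma> k) = k" "\<And>k. (e k)\<^sup>2 = 1" "\<And>k. \<tau> (\<tau> k) = k" "\<And>k. (d k)\<^sup>2 = 1"
    and "\<sigma> 1 = 1" "p \<in> S6xS7"
  shows "(signed_permutation \<sigma> e (fst p), signed_permutation \<tau> d (snd p)) \<in> S6xS7"
  using assms(5,6) norm_signed_permutation[OF assms(1,2)] norm_signed_permutation[OF assms(3,4)]
  by (auto simp: S6xS7_def S7xS7_def S7_def oct_Re_def signed_permutation_def)

text \<open>Interchanging two coordinate planes moves the non-zero left weight to the second plane, and a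
  reflection in a plane changes the sign of its weight.  Reflections in all interchanged planes at once
  keep the linear map an involution, so that it is its own smooth inverse.\<close>

lemma free_circle_equivalent_model:
  assumes \<phi>: "lie_iso (Spin7\<lparr>carrier := circle_of m\<rparr>) unit_circle \<phi>" "\<And>s. \<phi> (circle_elt m s) = cis s"
    and m1: "m $ 1 = 0" and r: "\<And>j. right_weights m $ j = 1 \<or> right_weights m $ j = - 1"
  shows "equivalent_actions (Spin7\<lparr>carrier := circle_of m\<rparr>) S6xS7 spin_act unit_circle S6xS7 model_act"
proof -
  let ?R = "\<lambda>s. fst (circle_elt m s)"
  have l1: "left_weights m $ 1 = 0" by (simp add: left_weights_def m1)
  have "\<exists>\<sigma> e. (\<forall>k. \<sigma> (\<sigma> k) = k) \<and> (\<forall>k. e k * e (\<sigma> k) = 1) \<and> (\<forall>k. (e k)\<^sup>2 = 1) \<and> \<sigma> 1 = 1 \<and>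
     (\<forall>s x. signed_permutation \<sigma> e (?R s *v x) = rot_diag 0 (2 * s) 0 0 *v signed_permutation \<sigma> e x)"
  proof (rule free_circle_weights[OF m1 r])
    assume h: "left_weights m $ 3 = 0" "left_weights m $ 4 = 0" "left_weights m $ 2 = 2 \<or> left_weights m $ 2 = - 2"
    show ?thesis
      by (rule exI[of _ "\<lambda>k. k"], rule exI[of _ "\<lambda>k. if k = 4 then of_int (left_weights m $ 2) / 2 else 1"])
        (use h(3) in \<open>auto simp: circle_elt_weights l1 h(1,2) signed_permutation_def vec_eq_iff forall_8 matrix_vector_mult_def sum_8 rot_diag_def\<close>)
  next
    assume h: "left_weights m $ 2 = 0" "left_weights m $ 4 = 0" "left_weights m $ 3 = 2 \<or> left_weights m $ 3 = - 2"
    show ?thesis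
      by (rule exI[of _ "\<lambda>k. if k = 3 then 5 else if k = 5 then 3 else if k = 4 then 6 else if k = 6 then 4 else k"],
          rule exI[of _ "\<lambda>k. if k = 4 \<or> k = 6 then of_int (left_weights m $ 3) / 2 else 1"])
        (use h(3) in \<open>auto simp: circle_elt_weights l1 h(1,2) signed_permutation_def vec_eq_iff forall_8 matrix_vector_mult_def sum_8 rot_diag_def\<close>)
  next
    assume h: "left_weights m $ 2 = 0" "left_weights m $ 3 = 0" "left_weights m $ 4 = 2 \<or> left_weights m $ 4 = - 2"
    show ?thesis
      by (rule exI[of _ "\<lambda>k. if k = 3 then 7 else if k = 7 then 3 else if k = 4 then 8 else if k = 8 then 4 else k"],
          rule exI[of _ "\<lambda>k. if k = 4 \<or> k = 8 then of_int (left_weights m $ 4) / 2 else 1"])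
        (use h(3) in \<open>auto simp: circle_elt_weights l1 h(1,2) signed_permutation_def vec_eq_iff forall_8 matrix_vector_mult_def sum_8 rot_diag_def\<close>)
  qed
  then obtain \<sigma> e where \<sigma>: "\<And>k. \<sigma> (\<sigma> k) = k" "\<And>k. e k * e (\<sigma> k) = 1" "\<And>k. (e k)\<^sup>2 = 1" "\<sigma> 1 = 1"
    and P: "\<And>s x. signed_permutation \<sigma> e (?R s *v x) = rot_diag 0 (2 * s) 0 0 *v signed_permutation \<sigma> e x"
    by blast
  define d :: "8 \<Rightarrow> real" where "d = (\<lambda>k. if k = 2 then of_int (right_weights m $ 1) else if k = 4 then of_int (right_weights m $ 2)
    else if k = 6 then of_int (right_weights m $ 3) else if k = 8 then of_int (right_weights m $ 4) else 1)"
  have d: "d k * d k = 1" "(d k)\<^sup>2 = 1" for k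
    using r[of 1] r[of 2] r[of 3] r[of 4] by (auto simp: d_def)
  have Q: "signed_permutation (\<lambda>k. k) d (snd (circle_elt m s) *v y) = rot_diag s s s s *v signed_permutation (\<lambda>k. k) d y" for s y
    using r[of 1] r[of 2] r[of 3] r[of 4]
    by (auto simp: circle_elt_weights signed_permutation_def vec_eq_iff forall_8 matrix_vector_mult_def sum_8 rot_diag_def d_def)
  define F where "F = (\<lambda>p. (signed_permutation \<sigma> e (fst p), signed_permutation (\<lambda>k. k) d (snd p)))"
  have lin: "bounded_linear F" unfolding F_def
    by (intro bounded_linear_Pair bounded_linear_compose[OF bounded_linear_signed_permutation] bounded_linear_fst bounded_linear_snd)
  have smooth: "smooth_map_on S6xS7 F"
  proof (rule smooth_map_onI)
    show "Ck_on k F UNIV" for k by (rule Ck_on_linear[OF open_UNIV lin])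
  qed auto
  have inv: "F (F p) = p" for p
    unfolding F_def by (simp add: signed_permutation_involution \<sigma> d)
  have img: "F ` S6xS7 \<subseteq> S6xS7"
    unfolding F_def using signed_permutation_S6xS7[OF \<sigma>(1,3) _ d(2) \<sigma>(4), of "\<lambda>k. k"] by auto
  have "diffeomorphism_on S6xS7 S6xS7 F"
    by (rule diffeomorphism_onI[OF smooth smooth img img inv inv])
  moreover have "F (spin_act g p) = model_act (\<phi> g) (F p)" if "g \<in> circle_of m" for g p
    using that by (auto simp: circle_of_range \<phi>(2) model_act_cis F_def spin_act_def P Q)
  ultimately show ?thesis unfolding equivalent_actions_def using \<phi>(1)
    by (intro exI[of _ \<phi>] exI[of _ F]) auto
qed

text \<open>Conjugating the complex coordinates with weight \<open>-1\<close> makes all weights equal to \<open>1\<close>.\<close>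

lemma free_circle_projection_hopf:
  assumes \<phi>: "lie_iso (Spin7\<lparr>carrier := circle_of m\<rparr>) unit_circle \<phi>" "\<And>s. \<phi> (circle_elt m s) = cis s"
    and r: "\<And>j. right_weights m $ j = 1 \<or> right_weights m $ j = - 1"
  shows "equivalent_actions (Spin7\<lparr>carrier := circle_of m\<rparr>) S7 spin_act_snd
    unit_circle (sphere 0 1 :: (complex^4) set) hopf_act"
proof -
  define \<epsilon> :: "4 \<Rightarrow> real" where "\<epsilon> = (\<lambda>j. of_int (right_weights m $ j))"
  have \<epsilon>: "\<epsilon> j = 1 \<or> \<epsilon> j = - 1" for j using r[of j] by (auto simp: \<epsilon>_def)
  have \<epsilon>2: "\<epsilon> j * (\<epsilon> j * x) = x" "(\<epsilon> j)\<^sup>2 = 1" for j x using \<epsilon>[of j] by auto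
  define F :: "octonion \<Rightarrow> complex^4" where
    "F = (\<lambda>y. vector [Complex (y$1) (\<epsilon> 1 * y$2), Complex (y$3) (\<epsilon> 2 * y$4), Complex (y$5) (\<epsilon> 3 * y$6), Complex (y$7) (\<epsilon> 4 * y$8)])"
  define G :: "complex^4 \<Rightarrow> octonion" where
    "G = (\<lambda>v. vector [Re (v$1), \<epsilon> 1 * Im (v$1), Re (v$2), \<epsilon> 2 * Im (v$2), Re (v$3), \<epsilon> 3 * Im (v$3), Re (v$4), \<epsilon> 4 * Im (v$4)])"
  have GF: "G (F y) = y" for y by (simp add: F_def G_def vec_eq_iff forall_8 \<epsilon>2)
  have FG: "F (G v) = v" for v by (simp add: F_def G_def vec_eq_iff forall_4 \<epsilon>2 complex_eq_iff)
  have norm: "norm (F y) = norm y" for y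
    by (simp add: norm_vec_def L2_set_def sum_4 sum_8 F_def cmod_def power_mult_distrib \<epsilon>2)
  have linF: "bounded_linear F" unfolding linear_conv_bounded_linear[symmetric]
    by (rule linearI) (simp_all add: F_def vec_eq_iff forall_4 complex_eq_iff algebra_simps)
  have linG: "bounded_linear G" unfolding linear_conv_bounded_linear[symmetric]
    by (rule linearI) (simp_all add: G_def vec_eq_iff forall_8 algebra_simps)
  have "diffeomorphism_on S7 (sphere 0 1) F"
  proof (rule diffeomorphism_onI)
    show "smooth_map_on S7 F"
    proof (rule smooth_map_onI)
      show "Ck_on k F UNIV" for k by (rule Ck_on_linear[OF open_UNIV linF])
    qed auto
    show "smooth_map_on (sphere 0 1) G"
    proof (rule smooth_map_onI)
      show "Ck_on k G UNIV" for k by (rule Ck_on_linear[OF open_UNIV linG])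
    qed auto
    show "F ` S7 \<subseteq> sphere 0 1" by (auto simp: S7_def norm)
    show "G ` sphere 0 1 \<subseteq> S7" using norm[of "G _"] by (auto simp: S7_def FG)
  qed (rule GF FG)+
  moreover have "F (spin_act_snd g y) = hopf_act (\<phi> g) (F y)" if g: "g \<in> circle_of m" for g y
  proof -
    obtain s where s: "g = circle_elt m s" using g by (auto simp: circle_of_range)
    have cs: "cos (s * \<epsilon> j) = cos s" "sin (s * \<epsilon> j) = \<epsilon> j * sin s" for j
      using \<epsilon>[of j] by auto
    have g2: "snd (circle_elt m s) = rot_diag (\<epsilon> 1 * s) (\<epsilon> 2 * s) (\<epsilon> 3 * s) (\<epsilon> 4 * s)"
      by (simp add: circle_elt_weights \<epsilon>_def)
    show ?thesis
      unfolding s \<phi>(2) spin_act_snd_def g2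
      by (simp add: hopf_act_def F_def vec_eq_iff forall_4 matrix_vector_mult_def sum_8 rot_diag_def complex_eq_iff
          cs algebra_simps \<epsilon>2)
  qed
  ultimately show ?thesis unfolding equivalent_actions_def using \<phi>(1)
    by (intro exI[of _ \<phi>] exI[of _ F]) auto
qed


text \<open>The circle \<open>(0, 0, 1, 1)\<close> acts with left weights \<open>0, 2, 0, 0\<close> and right weights \<open>1, 1, -1, 1\<close>.\<close>

lemma exists_free_circle:
  defines "m \<equiv> vector [0, 0, 1, 1] :: int^4"
  shows "circle_subgroup (circle_of m) (Spin7\<lparr>carrier := T3\<rparr>)"
    and "acts_freely (Spin7\<lparr>carrier := circle_of m\<rparr>) S6xS7 spin_act"
proof -
  have elt: "circle_elt m s = (rot_diag 0 (2 * s) 0 0, rot_diag s s (- s) s)" for s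
    by (simp add: circle_elt_def m_def torus_elt_def)
  have prim: "Gcd (range (($) m)) = 1"
  proof -
    have "Gcd (range (($) m)) dvd m $ 3" by (intro Gcd_dvd) simp
    then show ?thesis by (simp add: m_def)
  qed
  show "acts_freely (Spin7\<lparr>carrier := circle_of m\<rparr>) S6xS7 spin_act"
    unfolding acts_freely_def
  proof (intro ballI impI)
    fix g p assume "g \<in> carrier (Spin7\<lparr>carrier := circle_of m\<rparr>)" and p: "p \<in> S6xS7" and fixed: "spin_act g p = p"
    then obtain s where s: "g = circle_elt m s" by (auto simp: circle_of_range)
    have "snd p \<in> S7" using p by (auto simp: S6xS7_def S7xS7_def)
    moreover have "rot_diag s s (- s) s *v snd p = snd p"
      using arg_cong[OF fixed, of snd] by (simp add: spin_act_def s elt)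
    ultimately have "cos s = 1" using rot_diag_fixed_iff[of s s "- s" s] by auto
    then have "circle_elt m s = (mat 1, mat 1)"
      unfolding circle_elt_eq_one_iff[OF prim] cos_eq_1_iff .
    then show "g = \<one>\<^bsub>Spin7\<lparr>carrier := circle_of m\<rparr>\<^esub>"
      by (simp add: s Spin7_simps one_Spin8)
  qed
  have "subgroup (circle_of m) (Spin7\<lparr>carrier := T3\<rparr>)"
  proof -
    have S: "subgroup (circle_of m) Spin8"
      by (rule group.incl_subgroup[OF group_Spin8 subgroup_T4 subgroup_circle_of])
    have eq: "Spin7 = Spin8\<lparr>carrier := carrier Spin7\<rparr>" by (simp add: Spin7_def)
    have T: "subgroup T3 Spin8"
      by (rule group.incl_subgroup[OF group_Spin8 subgroup_Spin7]) (use subgroup_T3 eq in simp)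
    have "circle_of m \<subseteq> T3"
      by (auto simp: circle_of_range circle_elt_def m_def T3_eq)
    then have "subgroup (circle_of m) (Spin8\<lparr>carrier := T3\<rparr>)"
      by (rule group.subgroup_incl[OF group_Spin8 S T])
    then show ?thesis by (subst eq) simp
  qed
  moreover have "lie_iso (Spin7\<lparr>carrier := circle_of m\<rparr>) unit_circle (\<lambda>g. torus_coords g $ 3)"
    unfolding lie_iso_def
  proof
    have val: "torus_coords (circle_elt m s) $ 3 = cis s" for s
      by (simp add: torus_coords_circle_elt m_def)
    \<comment> \<open>The inverse sends \<open>cis s\<close> to \<open>circle_elt m s\<close>, whose entries are quadratic polynomials in
      the real and imaginary part of \<open>cis s\<close>.\<close>
    define h where "h = (\<lambda>z.
       (plane_projection 1 2 + ((Re z * Re z + - (Im z * Im z)) *\<^sub>R plane_projection 3 4 + (2 * (Re z * Im z)) *\<^sub>R plane_generator 3 4)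
         + plane_projection 5 6 + plane_projection 7 8,
        (Re z *\<^sub>R plane_projection 1 2 + Im z *\<^sub>R plane_generator 1 2)
      + (Re z *\<^sub>R plane_projection 3 4 + Im z *\<^sub>R plane_generator 3 4)
      + (Re z *\<^sub>R plane_projection 5 6 + (- Im z) *\<^sub>R plane_generator 5 6)
      + (Re z *\<^sub>R plane_projection 7 8 + Im z *\<^sub>R plane_generator 7 8)))"
    have h: "h (cis s) = circle_elt m s" for s
      unfolding elt rot_diag_eq_planes h_def by (simp add: cos_double sin_double power2_eq_square)
    have mem: "circle_elt m s \<in> circle_of m" for s by (auto simp: circle_of_range)
    have inv: "torus_coords (h z) $ 3 = z" "h z \<in> circle_of m" if "z \<in> sphere 0 1" for z
      using cis_Arg_unit[of z] that h[of "Arg z"] val[of "Arg z"] mem[of "Arg z"] by simp_all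
    have inv': "h (torus_coords g $ 3) = g" "torus_coords g $ 3 \<in> sphere 0 1" if g: "g \<in> circle_of m" for g
    proof -
      obtain s where "g = circle_elt m s" using g by (auto simp: circle_of_range)
      then show "h (torus_coords g $ 3) = g" "torus_coords g $ 3 \<in> sphere 0 1"
        by (simp_all add: val h)
    qed
    have img: "(\<lambda>g. torus_coords g $ 3) ` circle_of m \<subseteq> sphere 0 1" "h ` sphere 0 1 \<subseteq> circle_of m"
      by (intro image_subsetI inv inv'; assumption)+
    have bij: "bij_betw (\<lambda>g. torus_coords g $ 3) (circle_of m) (sphere 0 1)"
      by (rule bij_betw_byWitness[where f' = h, OF _ _ img]) (intro ballI inv inv'; assumption)+
    show "(\<lambda>g. torus_coords g $ 3) \<in> iso (Spin7\<lparr>carrier := circle_of m\<rparr>) unit_circle"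
    proof -
      have T4: "g \<in> T4" if "g \<in> circle_of m" for g
        using that circle_elt_T4 by (auto simp: circle_of_range)
      show ?thesis
        using bij img(1) by (simp add: iso_def hom_def unit_circle_def Spin7_simps torus_coords_mult[OF T4 T4] image_subset_iff Pi_def)
    qed
    have smooth: "smooth_map_on (circle_of m) (\<lambda>g. torus_coords g $ 3)"
    proof (rule smooth_map_onI)
      show "Ck_on k (\<lambda>g. torus_coords g $ 3) UNIV" for k
        by (rule Ck_on_linear[OF open_UNIV bounded_linear_torus_coords])
    qed auto
    have smooth_h: "smooth_map_on (sphere 0 1) h"
    proof (rule smooth_map_onI)
      have lin: "Ck_on k Re UNIV" "Ck_on k Im UNIV" "Ck_on k (\<lambda>z. - Im z) UNIV" for k
        by (intro Ck_on_linear open_UNIV bounded_linear_Re bounded_linear_Im bounded_linear_minus)+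
      show "Ck_on k h UNIV" for k
        unfolding h_def
        by (intro Ck_on_Pair Ck_on_add Ck_on_scaleR Ck_on_mult Ck_on_const lin open_UNIV
            Ck_on_linear_compose[OF bounded_linear_minus[OF bounded_linear_ident]])
    qed auto
    have "diffeomorphism_on (circle_of m) (sphere 0 1) (\<lambda>g. torus_coords g $ 3)"
      by (rule diffeomorphism_onI[OF smooth smooth_h img inv'(1) inv(1)])
    then show "diffeomorphism_on (carrier (Spin7\<lparr>carrier := circle_of m\<rparr>)) (carrier unit_circle) (\<lambda>g. torus_coords g $ 3)"
      by (simp add: unit_circle_def)
  qed
  ultimately show "circle_subgroup (circle_of m) (Spin7\<lparr>carrier := T3\<rparr>)"
    unfolding circle_subgroup_def by auto
qed

lemma free_circle_subgroup_equivalences: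
  assumes S: "circle_subgroup S (Spin7\<lparr>carrier := T3\<rparr>)" and free: "acts_freely (Spin7\<lparr>carrier := S\<rparr>) S6xS7 spin_act"
  shows "equivalent_actions (Spin7\<lparr>carrier := S\<rparr>) S6xS7 spin_act unit_circle S6xS7 model_act"
    and "equivalent_actions (Spin7\<lparr>carrier := S\<rparr>) S7 spin_act_snd unit_circle (sphere 0 1 :: (complex^4) set) hopf_act"
proof -
  obtain \<phi> m where h: "lie_iso (Spin7\<lparr>carrier := S\<rparr>) unit_circle \<phi>" "m $ 1 = 0" "S = circle_of m"
    and \<phi>: "\<And>s. \<phi> (circle_elt m s) = cis s"
    using circle_subgroup_parametrization[OF S] by (metis (no_types, lifting))
  have r: "right_weights m $ j = 1 \<or> right_weights m $ j = - 1" for j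
    by (rule free_circle_right_weights[OF \<phi> h(2) free[unfolded h(3)]])
  show "equivalent_actions (Spin7\<lparr>carrier := S\<rparr>) S6xS7 spin_act unit_circle S6xS7 model_act"
    unfolding h(3) by (rule free_circle_equivalent_model[OF h(1)[unfolded h(3)] \<phi> h(2) r])
  show "equivalent_actions (Spin7\<lparr>carrier := S\<rparr>) S7 spin_act_snd unit_circle (sphere 0 1 :: (complex^4) set) hopf_act"
    unfolding h(3) by (rule free_circle_projection_hopf[OF h(1)[unfolded h(3)] \<phi> r])
qed

lemma free_circle_subgroups_equivalent:
  assumes S: "circle_subgroup S (Spin7\<lparr>carrier := T3\<rparr>)" "acts_freely (Spin7\<lparr>carrier := S\<rparr>) S6xS7 spin_act"
    and S': "circle_subgroup S' (Spin7\<lparr>carrier := T3\<rparr>)" "acts_freely (Spin7\<lparr>carrier := S'\<rparr>) S6xS7 spin_act"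
  shows "equivalent_actions (Spin7\<lparr>carrier := S\<rparr>) S6xS7 spin_act (Spin7\<lparr>carrier := S'\<rparr>) S6xS7 spin_act"
proof (rule equivalent_actions_trans[OF free_circle_subgroup_equivalences(1)[OF S]])
  have sub: "subgroup S' (Spin7\<lparr>carrier := T3\<rparr>)" using S'(1) by (simp add: circle_subgroup_def)
  have "S' \<subseteq> carrier Spin7"
    using subgroup.subset[OF sub] subgroup.subset[OF subgroup_T3] by auto
  then have "spin_act g p \<in> S6xS7" if "g \<in> carrier (Spin7\<lparr>carrier := S'\<rparr>)" "p \<in> S6xS7" for g p
    using that by (intro spin_act_S6xS7) auto
  moreover have "group (Spin7\<lparr>carrier := S'\<rparr>)"
    using group.subgroup_imp_group[OF group.subgroup_imp_group[OF group_Spin7 subgroup_T3] sub] by simp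
  ultimately show "equivalent_actions unit_circle S6xS7 model_act (Spin7\<lparr>carrier := S'\<rparr>) S6xS7 spin_act"
    by (intro equivalent_actions_sym[OF _ _ free_circle_subgroup_equivalences(1)[OF S']])
qed

theorem theorem7p10:
  shows "(\<forall>n :: int^4. Gcd (range (($) n)) = 1 \<longrightarrow>
           (acts_freely (Spin8\<lparr>carrier := circle_of n\<rparr>) S7xS7 spin_act \<longleftrightarrow>
              (\<forall>i j. gcd (left_weights n $ i) (right_weights n $ j) = 1)))
       \<and> infinite (free_tuples // free_tuples_equiv)
       \<and> (\<exists>S. circle_subgroup S (Spin7\<lparr>carrier := T3\<rparr>) \<and>
              acts_freely (Spin7\<lparr>carrier := S\<rparr>) S6xS7 spin_act)
       \<and> (\<forall>S S'.
              circle_subgroup S (Spin7\<lparr>carrier := T3\<rparr>) \<and>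
              acts_freely (Spin7\<lparr>carrier := S\<rparr>) S6xS7 spin_act \<and>
              circle_subgroup S' (Spin7\<lparr>carrier := T3\<rparr>) \<and>
              acts_freely (Spin7\<lparr>carrier := S'\<rparr>) S6xS7 spin_act \<longrightarrow>
              equivalent_actions (Spin7\<lparr>carrier := S\<rparr>) S6xS7 spin_act
                                 (Spin7\<lparr>carrier := S'\<rparr>) S6xS7 spin_act)
       \<and> (\<forall>S.
              circle_subgroup S (Spin7\<lparr>carrier := T3\<rparr>) \<and>
              acts_freely (Spin7\<lparr>carrier := S\<rparr>) S6xS7 spin_act \<longrightarrow>
              equivalent_actions (Spin7\<lparr>carrier := S\<rparr>) S7 spin_act_snd
                                 unit_circle (sphere 0 1 :: (complex^4) set) hopf_act)"
  using circle_acts_freely_iff infinitely_many_free_circles exists_free_circle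
    free_circle_subgroups_equivalent free_circle_subgroup_equivalences(2)
  by blast

end
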